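(* Let $k,n\ge 1$, let $\bar z=(z_1,\dots,z_k)\in\mathbb C^k$ have pairwise distinct entries and let $\bar\alpha=(\alpha_1,\dots,\alpha_n)\in\mathbb C^n$ have pairwise distinct entries. Let $\pi^{\langle n\rangle}_{\bar z}:U(\mathfrak{gl}_n[t])\to\operatorname{End}(\mathfrak P_{kn})$ and $\pi^{\langle k\rangle}_{-\bar\alpha}:U(\mathfrak{gl}_k[t])\to\operatorname{End}(\mathfrak P_{kn})$ be the homomorphisms determined by $$\pi^{\langle n\rangle}_{\bar z}(e^{\langle n\rangle}_{ij}\otimes t^s)=\sum_{a=1}^k z_a^s\,\xi_{ai}\partial_{aj},\qquad \pi^{\langle k\rangle}_{-\bar\alpha}(e^{\langle k\rangle}_{ab}\otimes t^s)=\sum_{i=1}^n(-\alpha_i)^s\,\xi_{ai}\partial_{bi}.$$ Then $\pi^{\langle n\rangle}_{\bar z}\bigl(\mathcal B^{\langle n\rangle}_{\bar\alpha}\bigr)=\pi^{\langle k\rangle}_{-\bar\alpha}\bigl(\mathcal B^{\langle k\rangle}_{\bar z}\bigr)$.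
   Context: $\mathfrak P_{kn}$ is the space of polynomials in $kn$ pairwise anticommuting variables $\xi_{ai}$ ($a=1,\dots,k$, $i=1,\dots,n$), so $\xi_{ai}\xi_{bj}=-\xi_{bj}\xi_{ai}$ and $\xi_{ai}^2=0$. The left derivation $\partial_{ai}$ is the linear map sending a monomial $\xi_{c_1}\cdots\xi_{c_l}$ (each $c_r$ a double index) to $(-1)^{s-1}\xi_{c_1}\cdots\xi_{c_{s-1}}\xi_{c_{s+1}}\cdots\xi_{c_l}$ if $c_s=(a,i)$ for some $s$, and to $0$ otherwise. For $N\ge1$, $\mathfrak{gl}_N[t]=\mathfrak{gl}_N\otimes\mathbb C[t]$ with pointwise bracket; $e_{ij}$ ($i,j=1,\dots,N$) are the standard generators of $\mathfrak{gl}_N$, $[e_{ij},e_{kl}]=\delta_{jk}e_{il}-\delta_{il}e_{kj}$; superscripts $\langle n\rangle,\langle k\rangle$ indicate $N=n$ or $N=k$. For $g\in\mathfrak{gl}_N$ put $g(x)=\sum_{s\ge0}(g\otimes t^s)x^{-s-1}$. For an $N\times N$ matrix $A=(a_{ij})$ with noncommuting entries, $\operatorname{rdet}A=\sum_{\sigma\in S_N}(-1)^\sigma a_{1\sigma(1)}\cdots a_{N\sigma(N)}$. For a sequence $\bar\beta=(\beta_1,\dots,\beta_N)$ of pairwise distinct complex numbers, the universal differential operator is $\mathcal D_{\bar\beta}=\operatorname{rdet}\bigl((\tfrac{d}{dx}-\beta_i)\delta_{ij}-e_{ji}(x)\bigr)_{i,j=1}^N$; writing it with all powers of $d/dx$ on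 the right, $\mathcal D_{\bar\beta}=(d/dx)^N+\sum_{i=1}^N B_i(x)(d/dx)^{N-i}$ with $B_i(x)=\sum_{j\ge0}B_{ij}x^{-j}$, $B_{ij}\in U(\mathfrak{gl}_N[t])$. The Bethe algebra $\mathcal B^{\langle N\rangle}_{\bar\beta}\subset U(\mathfrak{gl}_N[t])$ is the subalgebra generated by $B_{ij}$, $i=1,\dots,N$, $j\ge1$. *)

theory Defs
  imports "HOL-Combinatorics.Permutations" Complex_Main
begin

text \<open>Basis of P_kn: monomials xi_S for S a subset of {1..k} x {1..n}, the factors
  written in increasing lexicographic order of the double index (a,i).
  An endomorphism is encoded by its matrix M S T = coefficient of xi_S in M(xi_T);
  all matrices used below vanish outside the basis index set.\<close>

type_synonym endo = "(nat \<times> nat) set \<Rightarrow> (nat \<times> nat) set \<Rightarrow> complex"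

definition idxs :: "nat \<Rightarrow> nat \<Rightarrow> (nat \<times> nat) set set" where
  "idxs k n = Pow ({1..k} \<times> {1..n})"

definition idx_less :: "nat \<times> nat \<Rightarrow> nat \<times> nat \<Rightarrow> bool" where
  "idx_less c d \<longleftrightarrow> fst c < fst d \<or> (fst c = fst d \<and> snd c < snd d)"

definition ezero :: endo where "ezero = (\<lambda>S T. 0)"

definition eone :: "nat \<Rightarrow> nat \<Rightarrow> endo" where
  "eone k n = (\<lambda>S T. if S = T \<and> T \<in> idxs k n then 1 else 0)"

definition eadd :: "endo \<Rightarrow> endo \<Rightarrow> endo" where
  "eadd A B = (\<lambda>S T. A S T + B S T)"

definition escale :: "complex \<Rightarrow> endo \<Rightarrow> endo" where
  "escale c A = (\<lambda>S T. c * A S T)"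

definition emul :: "nat \<Rightarrow> nat \<Rightarrow> endo \<Rightarrow> endo \<Rightarrow> endo" where
  "emul k n A B = (\<lambda>S T. \<Sum>R\<in>idxs k n. A S R * B R T)"

definition esum :: "'x set \<Rightarrow> ('x \<Rightarrow> endo) \<Rightarrow> endo" where
  "esum F f = (\<lambda>S T. \<Sum>x\<in>F. f x S T)"

text \<open>The operator xi_(a,i) composed with the left derivation d_(b,j):
  d_(b,j) xi_T = (-1)^(#factors before (b,j)) xi_(T - {(b,j)}) if (b,j) in T, else 0;
  xi_(a,i) xi_T' = (-1)^(#factors before (a,i)) xi_(T' + {(a,i)}) if (a,i) not in T', else 0.\<close>
definition xi_d :: "nat \<Rightarrow> nat \<Rightarrow> nat \<times> nat \<Rightarrow> nat \<times> nat \<Rightarrow> endo" where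
  "xi_d k n c d = (\<lambda>S T.
     if T \<in> idxs k n \<and> d \<in> T \<and> c \<notin> T - {d} \<and> S = insert c (T - {d})
     then (-1) ^ (card {e \<in> T. idx_less e d} + card {e \<in> T - {d}. idx_less e c})
     else 0)"

text \<open>An operator sum_{p,q} P p q x^(-q) (d/dx)^p, all powers of d/dx on the right;
  P p q is the coefficient of x^(-q) (d/dx)^p.\<close>
type_synonym dop = "nat \<Rightarrow> nat \<Rightarrow> endo"

definition dop_one :: "nat \<Rightarrow> nat \<Rightarrow> dop" where
  "dop_one k n = (\<lambda>p q. if p = 0 \<and> q = 0 then eone k n else ezero)"

text \<open>Product, using (d/dx)^a g = sum_m (a choose m) g^(m) (d/dx)^(a-m) and
  (d/dx)^m x^(-q) = (-1)^m q(q+1)...(q+m-1) x^(-q-m).\<close>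
definition dop_mul :: "nat \<Rightarrow> nat \<Rightarrow> dop \<Rightarrow> dop \<Rightarrow> dop" where
  "dop_mul k n P Q = (\<lambda>r q.
     esum {(m, b, q1). m \<le> q \<and> b \<le> r \<and> q1 \<le> q - m}
       (\<lambda>(m, b, q1). escale (of_nat ((r + m - b) choose m) * (-1) ^ m * pochhammer (of_nat (q - m - q1)) m)
          (emul k n (P (r + m - b) q1) (Q b (q - m - q1)))))"

definition dop_prod :: "nat \<Rightarrow> nat \<Rightarrow> dop list \<Rightarrow> dop" where
  "dop_prod k n Ps = foldr (dop_mul k n) Ps (dop_one k n)"

definition dop_rdet :: "nat \<Rightarrow> nat \<Rightarrow> nat \<Rightarrow> (nat \<Rightarrow> nat \<Rightarrow> dop) \<Rightarrow> dop" where
  "dop_rdet k n N A = (\<lambda>p q. esum {\<sigma>. \<sigma> permutes {1..N}}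
      (\<lambda>\<sigma>. escale (of_int (sign \<sigma>)) (dop_prod k n (map (\<lambda>i. A i (\<sigma> i)) [1..<N+1]) p q)))"

text \<open>Entries (d/dx - beta_i) delta_ij - g_ji(x) with g_ji(x) = sum_s g j i s x^(-s-1),
  where g i j s stands for the image of e_ij (x) t^s.\<close>
definition univ_entry :: "nat \<Rightarrow> nat \<Rightarrow> (nat \<Rightarrow> complex) \<Rightarrow> (nat \<Rightarrow> nat \<Rightarrow> nat \<Rightarrow> endo)
     \<Rightarrow> nat \<Rightarrow> nat \<Rightarrow> dop" where
  "univ_entry k n \<beta> g i j = (\<lambda>p q.
     if p = 1 \<and> q = 0 then (if i = j then eone k n else ezero)
     else if p = 0 \<and> q = 0 then (if i = j then escale (- \<beta> i) (eone k n) else ezero)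
     else if p = 0 \<and> q \<ge> 1 then escale (-1) (g j i (q - 1))
     else ezero)"

text \<open>Image of the universal differential operator D_beta under a representation
  with g i j s = pi(e_ij (x) t^s).\<close>
definition univ_op :: "nat \<Rightarrow> nat \<Rightarrow> nat \<Rightarrow> (nat \<Rightarrow> complex) \<Rightarrow> (nat \<Rightarrow> nat \<Rightarrow> nat \<Rightarrow> endo) \<Rightarrow> dop" where
  "univ_op k n N \<beta> g = dop_rdet k n N (univ_entry k n \<beta> g)"

definition bethe_gen :: "nat \<Rightarrow> nat \<Rightarrow> nat \<Rightarrow> (nat \<Rightarrow> complex) \<Rightarrow> (nat \<Rightarrow> nat \<Rightarrow> nat \<Rightarrow> endo)
     \<Rightarrow> nat \<Rightarrow> nat \<Rightarrow> endo" where
  "bethe_gen k n N \<beta> g i j = univ_op k n N \<beta> g (N - i) j"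

inductive_set subalg :: "nat \<Rightarrow> nat \<Rightarrow> endo set \<Rightarrow> endo set" for k n G where
  one: "eone k n \<in> subalg k n G"
| gen: "A \<in> G \<Longrightarrow> A \<in> subalg k n G"
| add: "A \<in> subalg k n G \<Longrightarrow> B \<in> subalg k n G \<Longrightarrow> eadd A B \<in> subalg k n G"
| scale: "A \<in> subalg k n G \<Longrightarrow> escale c A \<in> subalg k n G"
| mul: "A \<in> subalg k n G \<Longrightarrow> B \<in> subalg k n G \<Longrightarrow> emul k n A B \<in> subalg k n G"

definition bethe_image :: "nat \<Rightarrow> nat \<Rightarrow> nat \<Rightarrow> (nat \<Rightarrow> complex) \<Rightarrow> (nat \<Rightarrow> nat \<Rightarrow> nat \<Rightarrow> endo)
     \<Rightarrow> endo set" where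
  "bethe_image k n N \<beta> g =
     subalg k n {bethe_gen k n N \<beta> g i j | i j. 1 \<le> i \<and> i \<le> N \<and> 1 \<le> j}"

definition pi_n :: "nat \<Rightarrow> nat \<Rightarrow> (nat \<Rightarrow> complex) \<Rightarrow> nat \<Rightarrow> nat \<Rightarrow> nat \<Rightarrow> endo" where
  "pi_n k n z i j s = esum {1..k} (\<lambda>a. escale (z a ^ s) (xi_d k n (a, i) (a, j)))"

definition pi_k :: "nat \<Rightarrow> nat \<Rightarrow> (nat \<Rightarrow> complex) \<Rightarrow> nat \<Rightarrow> nat \<Rightarrow> nat \<Rightarrow> endo" where
  "pi_k k n \<alpha> a b s = esum {1..n} (\<lambda>i. escale ((- \<alpha> i) ^ s) (xi_d k n (a, i) (b, i)))"

end

theory Submission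
  imports Defs "HOL-Computational_Algebra.Formal_Laurent_Series" "HOL-Library.FSet"
begin

text \<open>Put \<open>X\<^sub>a = x - z\<^sub>a\<close> and \<open>D\<^sub>i = d/dx - \<alpha>\<^sub>i\<close>. After the Fourier transform \<open>x' = - d/dx\<close>, \<open>d/dx' = x\<close>
  the universal operator of gl(k) is the row determinant of \<open>M'\<close> with entries
  \<open>M'\<^sub>a\<^sub>b = X\<^sub>a \<delta>\<^sub>a\<^sub>b + \<Sum>\<^sub>i \<xi>\<^sub>b\<^sub>i \<partial>\<^sub>a\<^sub>i / D\<^sub>i\<close>, while that of gl(n) is the row determinant of \<open>M\<close> with
  entries \<open>M\<^sub>i\<^sub>j = D\<^sub>i \<delta>\<^sub>i\<^sub>j - \<Sum>\<^sub>a \<xi>\<^sub>a\<^sub>j \<partial>\<^sub>a\<^sub>i / X\<^sub>a\<close>. Both belong to the supermatrix with diagonal blocks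
  \<open>X\<close>, \<open>D\<close> and off-diagonal blocks \<open>\<xi>\<close>, \<open>\<partial>\<close>, and comparing its two Berezinian
  factorizations gives \<open>rdet M' (\<Prod>\<^sub>a X\<^sub>a)\<^sup>-\<^sup>1 rdet M = \<Prod>\<^sub>i D\<^sub>i\<close>. This is proved by expressing the
  determinants through auxiliary odd variables \<open>c\<^sub>i\<close>, \<open>\<theta>\<^sub>a\<close> and trading the factors \<open>X\<^sub>a\<close> one at a time.
  In the ring of series in \<open>1/x\<close> and \<open>(d/dx)\<^sup>-\<^sup>1\<close> both factors have leading coefficient one and the
  product has scalar coefficients, so the coefficients of either factor are obtained recursively
  from those of the other one inside the algebra they generate.\<close>

section \<open>Row determinants and anticommuting elements\<close>

text \<open>A row determinant over a noncommutative ring is not multiplicative, so the two block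
  factorizations cannot be compared determinant by determinant. A product of linear forms in
  anticommuting variables, however, expands to a row determinant without permuting its entries, and
  products can be manipulated factor by factor. Eliminating one even variable b means putting b =
  \<open>X_a^-1 \<eta>_a\<close>, which is not central; hence identities are proved for the
  coefficients of powers of a formal central b and evaluated afterwards. The elimination leaves
  \<partial> to the left of \<xi>. Reordering costs the sum of all 1/X_a on the diagonal, the
  logarithmic derivative of the product of the X_a. Conjugation by this product removes it, which is
  where the inverse in the middle of the identity comes from. The identity is available only on the
  range of the product of all auxiliary variables, so it is read on Fock states in which these are
  occupied. The Fourier transform reverses the order of x and d/dx, so the normally ordered
  coefficients are triangular combinations of those of the gl(k) operator.\<close>

definition row_det :: "nat \<Rightarrow> (nat \<Rightarrow> nat \<Rightarrow> 'r::ring_1) \<Rightarrow> 'r" where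
  "row_det N A = (\<Sum>\<sigma> | \<sigma> permutes {1..N}. of_int (sign \<sigma>) * prod_list (map (\<lambda>i. A i (\<sigma> i)) [1..<N+1]))"

lemma prod_list_commute:
  fixes y :: "'r::monoid_mult"
  assumes "\<And>x. x \<in> set xs \<Longrightarrow> y * f x = f x * y"
  shows "y * prod_list (map f xs) = prod_list (map f xs) * y"
  using assms
proof (induction xs)
  case (Cons x xs)
  then have "y * f x = f x * y" and IH: "y * prod_list (map f xs) = prod_list (map f xs) * y" by auto
  have "y * (f x * prod_list (map f xs)) = (y * f x) * prod_list (map f xs)" by (simp add: mult.assoc)
  also have "\<dots> = f x * (y * prod_list (map f xs))" by (simp add: \<open>y * f x = f x * y\<close> mult.assoc)
  also have "\<dots> = f x * prod_list (map f xs) * y" by (simp add: IH mult.assoc)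
  finally show ?case by (simp add: mult.assoc)
qed simp

lemma sum_commute:
  fixes y :: "'r::ring_1"
  assumes "\<And>x. x \<in> A \<Longrightarrow> y * f x = f x * y"
  shows "y * sum f A = sum f A * y"
  using assms by (simp add: sum_distrib_left sum_distrib_right)

lemma prod_list_conj:
  fixes u :: "'r::monoid_mult"
  assumes "v * u = 1" "u * v = 1"
  shows "prod_list (map (\<lambda>i. u * f i * v) xs) = u * prod_list (map f xs) * v"
proof (induction xs)
  case (Cons x xs)
  have "u * f x * v * (u * prod_list (map f xs) * v) = u * f x * (v * u) * prod_list (map f xs) * v"
    by (simp only: mult.assoc)
  then show ?case using Cons assms by (simp add: mult.assoc)
qed (use assms in simp)

lemma row_det_conj:
  fixes u :: "'r::ring_1"
  assumes "v * u = 1" "u * v = 1"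
  shows "row_det N (\<lambda>i j. u * A i j * v) = u * row_det N A * v"
  unfolding row_det_def sum_distrib_left sum_distrib_right
proof (rule sum.cong)
  fix \<sigma>
  let ?P = "prod_list (map (\<lambda>i. A i (\<sigma> i)) [1..<N+1])"
  show "of_int (sign \<sigma>) * prod_list (map (\<lambda>i. u * A i (\<sigma> i) * v) [1..<N+1])
      = u * (of_int (sign \<sigma>) * ?P) * v"
    unfolding prod_list_conj[OF assms] by (metis mult.assoc mult_of_int_commute)
qed simp

lemma prod_list_anticommute:
  fixes w :: "'i \<Rightarrow> 'r::ring_1"
  assumes "\<And>i j. w i * w j = - (w j * w i)"
  shows "w a * prod_list (map w xs) = (-1) ^ length xs * (prod_list (map w xs) * w a)"
proof (induction xs)
  case (Cons x xs)
  have "w a * (w x * prod_list (map w xs)) = - (w x * (w a * prod_list (map w xs)))"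
    using assms[of a x] by (simp add: mult.assoc[symmetric])
  also have "\<dots> = - (w x * ((-1) ^ length xs * (prod_list (map w xs) * w a)))" by (simp only: Cons)
  also have "\<dots> = (-1) ^ length (x # xs) * (w x * prod_list (map w xs) * w a)"
    by (cases "even (length xs)") (auto simp: mult.assoc)
  finally show ?case by simp
qed simp

lemma prod_list_anticommute_transpose:
  fixes w :: "'i \<Rightarrow> 'r::ring_1"
  assumes w: "\<And>i j. w i * w j = - (w j * w i)"
    and xs: "distinct xs" "a \<in> set xs" "b \<in> set xs" "a \<noteq> b"
  shows "prod_list (map (\<lambda>i. w (transpose a b i)) xs) = - prod_list (map w xs)"
proof -
  have *: "prod_list (map (\<lambda>i. w (transpose a b i)) xs) = - prod_list (map w xs)"
    if dist: "distinct xs" and xs: "xs = us @ a # vs @ b # ws" for a b us vs ws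
  proof -
    have fixed: "map (\<lambda>i. w (transpose a b i)) l = map w l" if "a \<notin> set l" "b \<notin> set l" for l
      using that by (auto simp: transpose_def)
    let ?P = "prod_list (map w vs)" and ?s = "(-1) ^ length vs :: 'r"
    note move = prod_list_anticommute[of w, OF w]
    \<comment> \<open>Carrying \<open>w b\<close> across \<open>?P\<close> costs \<open>?s\<close>;
      carrying \<open>w a\<close> back across it costs the same sign, so only the sign of the
      adjacent swap is left.\<close>
    have "w b * ?P * w a = ?s * (?P * w b) * w a"
      by (simp only: move)
    also have "\<dots> = ?s * ?P * (w b * w a)" by (simp only: mult.assoc)
    also have "\<dots> = - (?s * (?P * w a) * w b)"
      by (simp add: w[of b a] mult.assoc)
    also have "\<dots> = - (w a * ?P * w b)"
      by (simp only: move)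
    finally have sw: "w b * ?P * w a = - (w a * ?P * w b)" .
    have "prod_list (map (\<lambda>i. w (transpose a b i)) xs)
        = prod_list (map w us) * (w b * ?P * w a) * prod_list (map w ws)"
      using dist xs by (simp add: fixed mult.assoc)
    also have "\<dots> = - prod_list (map w xs)" unfolding sw by (simp add: xs mult.assoc)
    finally show ?thesis .
  qed
  obtain us vs where us: "xs = us @ a # vs" using xs split_list by metis
  consider "b \<in> set us" | "b \<in> set vs" using us xs by auto
  then show ?thesis
  proof cases
    case 1
    then obtain us1 us2 where "us = us1 @ b # us2" using split_list by metis
    then show ?thesis using *[of us1 b us2 a vs] us xs by (simp add: transpose_commute)
  next
    case 2
    then obtain vs1 vs2 where "vs = vs1 @ b # vs2" using split_list by metis
    then show ?thesis using *[of us a vs1 b vs2] us xs by simp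
  qed
qed

lemma prod_list_anticommute_permutes:
  fixes w :: "nat \<Rightarrow> 'r::ring_1"
  assumes w: "\<And>i j. w i * w j = - (w j * w i)" and p: "p permutes {1..N}"
  shows "prod_list (map (\<lambda>i. w (p i)) [1..<N+1]) = of_int (sign p) * prod_list (map w [1..<N+1])"
  using p finite_atLeastAtMost w
proof (induction p arbitrary: w rule: permutes_induct)
  case id
  then show ?case by simp
next
  case (swap a b p)
  show ?case
  proof (cases "a = b")
    case True
    then show ?thesis using swap by simp
  next
    case False
    \<comment> \<open>The transposition is absorbed into the family, to which the induction
      hypothesis applies because \<open>w\<close> was left arbitrary.\<close>
    have "prod_list (map (\<lambda>i. w ((transpose a b \<circ> p) i)) [1..<N+1])
       = of_int (sign p) * prod_list (map (\<lambda>i. w (transpose a b i)) [1..<N+1])"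
      using swap.IH[of "\<lambda>i. w (transpose a b i)", OF swap.prems] by (simp only: comp_def)
    also have "\<dots> = - (of_int (sign p) * prod_list (map w [1..<N+1]))"
      by (subst prod_list_anticommute_transpose[of w, OF swap.prems])
        (use swap.hyps False in \<open>simp_all del: upt_Suc\<close>)
    also have "\<dots> = of_int (sign (transpose a b \<circ> p)) * prod_list (map w [1..<N+1])"
      using swap.hyps False permutation_permutes[of p] finite_atLeastAtMost[of 1 N]
      by (subst sign_compose) (auto simp: permutation_swap_id sign_swap_id)
    finally show ?thesis .
  qed
qed

lemma prod_list_anticommute_not_distinct:
  fixes w :: "'i \<Rightarrow> 'r::ring_1"
  assumes w: "\<And>i j. w i * w j = - (w j * w i)" and w0: "\<And>i. w i * w i = 0" and "\<not> distinct js"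
  shows "prod_list (map w js) = 0"
proof -
  obtain xs ys zs y where js: "js = xs @ [y] @ ys @ [y] @ zs" using assms(3) not_distinct_decomp by blast
  have "w y * prod_list (map w ys) * w y = (-1) ^ length ys * (prod_list (map w ys) * (w y * w y))"
    unfolding prod_list_anticommute[of w, OF w] by (simp only: mult.assoc)
  then have "w y * prod_list (map w ys) * w y = 0" by (simp add: w0)
  moreover have "prod_list (map w js) = prod_list (map w xs) * (w y * prod_list (map w ys) * w y) * prod_list (map w zs)"
    by (simp add: js mult.assoc)
  ultimately show ?thesis by simp
qed

lemma prod_list_sum_expand:
  fixes A :: "'i \<Rightarrow> 'j \<Rightarrow> 'r::ring_1"
  assumes comm: "\<And>i j l. w l * A i j = A i j * w l" and "finite J"
  shows "prod_list (map (\<lambda>i. \<Sum>j\<in>J. A i j * w j) xs)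
    = (\<Sum>js | set js \<subseteq> J \<and> length js = length xs. prod_list (map2 A xs js) * prod_list (map w js))"
proof (induction xs)
  case Nil
  have "{js. set js \<subseteq> J \<and> length js = length []} = {[]}" by auto
  then show ?case by simp
next
  case (Cons x xs)
  let ?L = "\<lambda>m. {js. set js \<subseteq> J \<and> length js = m}"
  have L: "?L (Suc m) = (\<lambda>(j, js). j # js) ` (J \<times> ?L m)" for m
    by (auto simp: length_Suc_conv image_iff)
  have inj: "inj_on (\<lambda>(j, js). j # js) (J \<times> ?L m)" for m by (auto simp: inj_on_def)
  have c: "w j * prod_list (map2 A xs js) = prod_list (map2 A xs js) * w j" for j js
    using prod_list_commute[of "zip xs js" "w j" "case_prod A"] comm by auto
  have "prod_list (map (\<lambda>i. \<Sum>j\<in>J. A i j * w j) (x # xs))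
     = (\<Sum>(j, js)\<in>J \<times> ?L (length xs). (A x j * w j) * (prod_list (map2 A xs js) * prod_list (map w js)))"
    by (simp add: Cons sum_product sum.cartesian_product)
  also have "\<dots> = (\<Sum>(j, js)\<in>J \<times> ?L (length xs). prod_list (map2 A (x # xs) (j # js)) * prod_list (map w (j # js)))"
  proof (intro sum.cong refl, clarify)
    fix j js
    have "A x j * w j * (prod_list (map2 A xs js) * prod_list (map w js))
      = A x j * (w j * prod_list (map2 A xs js)) * prod_list (map w js)" by (simp only: mult.assoc)
    also have "\<dots> = A x j * (prod_list (map2 A xs js) * w j) * prod_list (map w js)" by (simp only: c)
    finally show "A x j * w j * (prod_list (map2 A xs js) * prod_list (map w js))
      = prod_list (map2 A (x # xs) (j # js)) * prod_list (map w (j # js))" by (simp add: mult.assoc)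
  qed
  also have "\<dots> = (\<Sum>js\<in>?L (length (x # xs)). prod_list (map2 A (x # xs) js) * prod_list (map w js))"
    unfolding length_Cons L sum.reindex[OF inj] by (simp only: case_prod_unfold comp_def)
  finally show ?case by simp
qed

text \<open>Of the words in the \<open>w j\<close> that arise from multiplying out, those with a
  repeated letter vanish and the others are sorted at the cost of the sign of a permutation. The
  entries \<open>A i j\<close> are moved past the \<open>w l\<close> but never past each other, so
  they stay in row order.\<close>

theorem prod_list_row_det:
  fixes A :: "nat \<Rightarrow> nat \<Rightarrow> 'r::ring_1"
  assumes w: "\<And>i j. w i * w j = - (w j * w i)" and w0: "\<And>i. w i * w i = 0"
    and comm: "\<And>i j l. w l * A i j = A i j * w l"
  shows "prod_list (map (\<lambda>i. \<Sum>j\<in>{1..N}. A i j * w j) [1..<N+1])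
    = row_det N A * prod_list (map w [1..<N+1])"
proof -
  let ?f = "\<lambda>js. prod_list (map2 A [1..<N+1] js) * prod_list (map w js)"
  let ?L = "{js. set js \<subseteq> {1..N} \<and> length js = N}"
  let ?g = "\<lambda>\<sigma>. map \<sigma> [1..<N+1]"
  let ?P = "{\<sigma>. \<sigma> permutes {1..N}}"
  have inj: "inj_on ?g ?P"
  proof (rule inj_onI)
    fix p q assume p: "p \<in> ?P" and q: "q \<in> ?P" and e: "?g p = ?g q"
    show "p = q"
    proof
      fix x show "p x = q x"
      proof (cases "x \<in> {1..N}")
        case True
        then have "x \<in> set [1..<N+1]" by auto
        then show ?thesis using e by (simp only: map_eq_conv)
      next
        case False then show ?thesis using p q by (simp add: permutes_def)
      qed
    qed
  qed
  have img: "?g ` ?P = {js \<in> ?L. distinct js}"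
  proof (intro equalityI subsetI)
    fix js assume "js \<in> ?g ` ?P"
    then obtain p where p: "p permutes {1..N}" "js = ?g p" by auto
    then show "js \<in> {js \<in> ?L. distinct js}"
      using permutes_inj_on[OF p(1)] permutes_in_image[OF p(1)]
      by (auto simp: distinct_map less_Suc_eq_le)
  next
    fix js assume js: "js \<in> {js \<in> ?L. distinct js}"
    \<comment> \<open>Positions in \<open>js\<close> start at 0 while rows start at 1; outside
      {1..N} the identity is forced by \<open>permutes\<close>.\<close>
    define p where "p = (\<lambda>i. if i \<in> {1..N} then js ! (i - 1) else i)"
    have "js = ?g p"
      using js by (intro nth_equalityI) (auto simp: p_def simp del: upt_Suc)
    moreover have "p permutes {1..N}"
    proof (rule bij_imp_permutes)
      have "inj_on p {1..N}"
        using js by (auto simp: inj_on_def p_def nth_eq_iff_index_eq)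
      moreover have "p ` {1..N} \<subseteq> {1..N}"
      proof
        fix y assume "y \<in> p ` {1..N}"
        then obtain i where "i \<in> {1..N}" "y = js ! (i - 1)" by (auto simp: p_def)
        then have "y \<in> set js" using js by (auto intro!: nth_mem)
        then show "y \<in> {1..N}" using js by blast
      qed
      ultimately show "bij_betw p {1..N} {1..N}"
        by (simp add: bij_betw_def endo_inj_surj)
    qed (unfold p_def, simp only: if_False)
    ultimately show "js \<in> ?g ` ?P" by auto
  qed
  have finL: "finite ?L" by (simp add: finite_lists_length_eq)
  have "prod_list (map (\<lambda>i. \<Sum>j\<in>{1..N}. A i j * w j) [1..<N+1]) = sum ?f ?L"
    using prod_list_sum_expand[of w A "{1..N}" "[1..<N+1]"] comm by (simp del: upt_Suc)
  also have "\<dots> = sum ?f {js \<in> ?L. distinct js}"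
    using finL prod_list_anticommute_not_distinct[of w, OF w w0]
    by (intro sum.mono_neutral_right) (auto simp del: upt_Suc)
  also have "\<dots> = (\<Sum>\<sigma>\<in>?P. ?f (?g \<sigma>))"
    using sum.reindex[OF inj, of ?f] img by simp
  also have "\<dots> = row_det N A * prod_list (map w [1..<N+1])"
    unfolding row_det_def sum_distrib_right
  proof (rule sum.cong)
    fix \<sigma> assume "\<sigma> \<in> ?P"
    then have "prod_list (map w (?g \<sigma>)) = of_int (sign \<sigma>) * prod_list (map w [1..<N+1])"
      using prod_list_anticommute_permutes[of w, OF w, of \<sigma> N] by (simp add: comp_def del: upt_Suc)
    moreover have "map2 A [1..<N+1] (?g \<sigma>) = map (\<lambda>i. A i (\<sigma> i)) [1..<N+1]"
      by (intro nth_equalityI) (auto simp del: upt_Suc)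
    ultimately show "?f (?g \<sigma>) = of_int (sign \<sigma>) * prod_list (map (\<lambda>i. A i (\<sigma> i)) [1..<N+1]) * prod_list (map w [1..<N+1])"
      by (metis mult.assoc mult_of_int_commute)
  qed simp
  finally show ?thesis .
qed

section \<open>Elimination of one even variable\<close>

text \<open>One elimination in abstract form. For a central b the relations \<open>\<phi>x\<close>,
  \<open>qx\<close> and \<open>\<phi>\<eta>\<close> say, power by power, that
  \<open>\<phi> i + q i b\<close> commutes with \<open>x - \<eta> / b\<close>. The root
  \<open>\<beta>\<close> of the latter expression is then substituted for b.\<close>

locale linear_elimination =
  fixes \<phi> q :: "nat \<Rightarrow> 'r::ring_1" and x xi \<eta> \<beta> :: 'r
  assumes two_torsion_free: "\<And>y::'r. y + y = 0 \<Longrightarrow> y = 0"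
    and \<phi>\<phi>: "\<And>i j. \<phi> i * \<phi> j = - (\<phi> j * \<phi> i)"
    and qq: "\<And>i j. q i * q j = - (q j * q i)"
    and \<phi>q: "\<And>i j. \<phi> i * q j = - (q j * \<phi> i)"
    and \<phi>\<eta>: "\<And>i. \<phi> i * \<eta> = \<eta> * \<phi> i"
    and \<phi>x: "\<And>i. \<phi> i * x = x * \<phi> i + (q i * \<eta> - \<eta> * q i)"
    and qx: "\<And>i. q i * x = x * q i"
    and inverse: "xi * x = 1" "x * xi = 1"
    and \<beta>: "\<beta> = xi * \<eta>"
begin

text \<open>The coefficient of \<open>b ^ m\<close> in the product of the factors \<open>\<phi> i + q i b\<close> over the list,
  for a central variable \<open>b\<close>.\<close>
fun coef :: "nat list \<Rightarrow> nat \<Rightarrow> 'r" where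
  "coef [] m = (if m = 0 then 1 else 0)"
| "coef (i # l) m = \<phi> i * coef l m + (case m of 0 \<Rightarrow> 0 | Suc m' \<Rightarrow> q i * coef l m')"

lemma \<phi>_sq: "\<phi> i * \<phi> i = 0" and q_sq: "q i * q i = 0"
  using \<phi>\<phi>[of i i] qq[of i i] by (auto intro!: two_torsion_free simp: eq_neg_iff_add_eq_0)

lemma \<phi>_left: "\<phi> i * (\<phi> j * y) = - (\<phi> j * (\<phi> i * y))"
  and q_left: "q i * (q j * y) = - (q j * (q i * y))"
  and \<phi>q_left: "\<phi> i * (q j * y) = - (q j * (\<phi> i * y))"
  and \<phi>_sq_left: "\<phi> i * (\<phi> i * y) = 0"
  and q_sq_left: "q i * (q i * y) = 0"
  and \<phi>\<eta>_left: "\<phi> i * (\<eta> * y) = \<eta> * (\<phi> i * y)"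
  and qx_left: "q i * (x * y) = x * (q i * y)"
  and \<phi>x_left: "\<phi> i * (x * y) = x * (\<phi> i * y) + (q i * (\<eta> * y) - \<eta> * (q i * y))"
  using arg_cong[OF \<phi>\<phi>, of "\<lambda>u. u * y" i j] arg_cong[OF qq, of "\<lambda>u. u * y" i j]
    arg_cong[OF \<phi>q, of "\<lambda>u. u * y" i j] arg_cong[OF \<phi>_sq, of "\<lambda>u. u * y" i]
    arg_cong[OF q_sq, of "\<lambda>u. u * y" i] arg_cong[OF \<phi>\<eta>, of "\<lambda>u. u * y" i]
    arg_cong[OF qx, of "\<lambda>u. u * y" i] arg_cong[OF \<phi>x, of "\<lambda>u. u * y" i]
  by (simp_all add: mult.assoc distrib_right left_diff_distrib)

lemma coef_0_\<eta>: "coef l 0 * \<eta> = \<eta> * coef l 0"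
  by (induction l) (simp_all add: mult.assoc \<phi>\<eta>_left)

text \<open>Every factor \<open>\<phi> i + q i b\<close> commutes with
  \<open>x - \<eta> / b\<close>, hence so does the product. This is the coefficient of
  \<open>b ^ m\<close>; that of \<open>1 / b\<close> is \<open>coef_0_\<eta>\<close>.\<close>

lemma coef_relation: "coef l m * x - coef l (Suc m) * \<eta> = x * coef l m - \<eta> * coef l (Suc m)"
proof (induction l arbitrary: m)
  case (Cons i l)
  define f where "f m = coef l m * x - coef l (Suc m) * \<eta>" for m
  have f: "f m = x * coef l m - \<eta> * coef l (Suc m)" for m by (simp add: f_def Cons)
  have "coef (i # l) m * x - coef (i # l) (Suc m) * \<eta>
     = \<phi> i * f m + q i * (case m of 0 \<Rightarrow> - (coef l 0 * \<eta>) | Suc m' \<Rightarrow> f m')"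
    unfolding f_def by (cases m) (simp_all add: algebra_simps)
  also have "(case m of 0 \<Rightarrow> - (coef l 0 * \<eta>) | Suc m' \<Rightarrow> f m')
     = (case m of 0 \<Rightarrow> 0 | Suc m' \<Rightarrow> x * coef l m') - \<eta> * coef l m"
    by (cases m) (simp_all add: f coef_0_\<eta>)
  finally show ?case
    by (cases m) (simp_all add: f algebra_simps \<phi>\<eta>_left qx_left \<phi>x_left)
qed simp

text \<open>The factors anticommute and have square zero, so a factor that already occurs
  annihilates the product; this is the coefficient of \<open>b ^ m\<close>.\<close>

lemma coef_annihilated: "j \<in> set l \<Longrightarrow> \<phi> j * coef l m + (case m of 0 \<Rightarrow> 0 | Suc m' \<Rightarrow> q j * coef l m') = 0"
proof (induction l arbitrary: m)
  case (Cons i l)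
  show ?case
  proof (cases "i = j")
    case True
    then show ?thesis
      by (cases m; cases "m - 1") (simp_all add: distrib_left \<phi>_sq_left q_sq_left \<phi>q_left[of j j])
  next
    case False
    then have IH: "\<phi> j * coef l m = - (case m of 0 \<Rightarrow> 0 | Suc m' \<Rightarrow> q j * coef l m')" for m
      using Cons by (simp add: eq_neg_iff_add_eq_0)
    show ?thesis
      by (cases m; cases "m - 1")
        (simp_all add: distrib_left \<phi>_left[of j i] q_left[of j i] \<phi>q_left[of j i] IH mult_minus_right \<phi>q_left[of i j])
  qed
qed simp

lemma coef_eq_0: "length l < m \<Longrightarrow> coef l m = 0"
  by (induction l arbitrary: m) (auto split: nat.split)

lemma xi_left: "xi * (x * y) = y" "x * (xi * y) = y"
  using inverse by (simp_all flip: mult.assoc)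

lemma \<eta>_eq: "\<eta> = x * \<beta>" by (simp add: \<beta> xi_left)

lemma x_cancel: "x * y = x * z \<Longrightarrow> y = z" by (metis xi_left(1))

text \<open>After multiplication by \<open>x\<close>, the correction term
  \<open>\<eta> * q i\<close> in \<open>\<phi>x\<close> cancels against the contribution of
  \<open>q i * \<beta>\<close>. The two summands need not commute with \<open>\<beta>\<close>
  separately.\<close>

lemma \<beta>_commute: "\<beta> * (\<phi> i + q i * \<beta>) = (\<phi> i + q i * \<beta>) * \<beta>"
proof (rule x_cancel)
  have "x * (\<beta> * (\<phi> i + q i * \<beta>)) = \<eta> * \<phi> i + \<eta> * q i * \<beta>"
    by (simp add: \<eta>_eq distrib_left mult.assoc)
  also have "\<dots> = \<phi> i * (x * \<beta>) + \<eta> * q i * \<beta>" using \<phi>\<eta>[of i] \<eta>_eq by simp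
  also have "\<dots> = x * (\<phi> i * \<beta>) + q i * (\<eta> * \<beta>)" by (simp add: \<phi>x_left mult.assoc)
  also have "\<dots> = x * ((\<phi> i + q i * \<beta>) * \<beta>)"
    by (simp add: \<eta>_eq distrib_left distrib_right mult.assoc qx_left)
  finally show "x * (\<beta> * (\<phi> i + q i * \<beta>)) = x * ((\<phi> i + q i * \<beta>) * \<beta>)" .
qed

text \<open>\<open>\<beta>\<close> can be carried to the right past a whole factor, so the
  computation is that for a central b. The new family again satisfies \<open>\<phi>\<phi>\<close>,
  which allows a further elimination.\<close>

lemma eliminated_anticommute:
  "(\<phi> i + q i * \<beta>) * (\<phi> j + q j * \<beta>) = - ((\<phi> j + q j * \<beta>) * (\<phi> i + q i * \<beta>))"
proof -
  have *: "(\<phi> i + q i * \<beta>) * (\<phi> j + q j * \<beta>)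
     = \<phi> i * \<phi> j + (\<phi> i * q j + q i * \<phi> j) * \<beta> + q i * q j * \<beta> * \<beta>" for i j
  proof -
    have "(\<phi> i + q i * \<beta>) * (\<phi> j + q j * \<beta>) = \<phi> i * (\<phi> j + q j * \<beta>) + q i * (\<beta> * (\<phi> j + q j * \<beta>))"
      by (simp add: distrib_right mult.assoc)
    then show ?thesis unfolding \<beta>_commute by (simp add: distrib_left distrib_right mult.assoc)
  qed
  show ?thesis unfolding *[of i j] *[of j i] \<phi>\<phi>[of i j] qq[of i j] \<phi>q by (simp add: algebra_simps)
qed

lemma coef_eval: "prod_list (map (\<lambda>i. \<phi> i + q i * \<beta>) l) = (\<Sum>m\<le>length l. coef l m * \<beta> ^ m)"
proof (induction l)
  case (Cons i l)
  let ?S = "\<Sum>m\<le>length l. coef l m * \<beta> ^ m"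
  have "\<beta> * ?S = ?S * \<beta>"
    unfolding Cons[symmetric] by (rule prod_list_commute) (rule \<beta>_commute)
  then have "(\<phi> i + q i * \<beta>) * ?S = \<phi> i * ?S + q i * (?S * \<beta>)"
    by (simp add: distrib_right mult.assoc)
  also have "\<dots> = (\<Sum>m\<le>length l. \<phi> i * coef l m * \<beta> ^ m) + (\<Sum>m\<le>length l. q i * coef l m * \<beta> ^ Suc m)"
    by (simp add: sum_distrib_left sum_distrib_right mult.assoc power_commutes)
  also have "(\<Sum>m\<le>length l. \<phi> i * coef l m * \<beta> ^ m) = (\<Sum>m\<le>Suc (length l). \<phi> i * coef l m * \<beta> ^ m)"
    by (simp add: coef_eq_0)
  also have "(\<Sum>m\<le>length l. q i * coef l m * \<beta> ^ Suc m)
      = (\<Sum>m\<le>Suc (length l). (case m of 0 \<Rightarrow> 0 | Suc m' \<Rightarrow> q i * coef l m') * \<beta> ^ m)"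
    by (subst sum.atMost_Suc_shift) simp
  finally show ?case
    by (simp add: Cons sum.distrib[symmetric] distrib_right del: sum.atMost_Suc)
qed simp

text \<open>Evaluation at the root of \<open>x - \<eta> / b\<close>: as
  \<open>\<eta> * \<beta> ^ m = x * \<beta> ^ Suc m\<close>, consecutive terms cancel. What survives
  is, by \<open>coef_0\<close>, the product before the elimination times \<open>x\<close>.\<close>

lemma coef_telescope: "(\<Sum>m\<le>length l. (coef l m * x - coef l (Suc m) * \<eta>) * \<beta> ^ m) = coef l 0 * x"
proof -
  have "(coef l m * x - coef l (Suc m) * \<eta>) * \<beta> ^ m = coef l m * x * \<beta> ^ m - coef l (Suc m) * x * \<beta> ^ Suc m" for m
    by (simp add: left_diff_distrib \<eta>_eq mult.assoc)
  then have "(\<Sum>m\<le>length l. (coef l m * x - coef l (Suc m) * \<eta>) * \<beta> ^ m)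
     = (\<Sum>m\<le>length l. coef l m * x * \<beta> ^ m - coef l (Suc m) * x * \<beta> ^ Suc m)" by (simp only:)
  also have "\<dots> = coef l 0 * x" by (subst sum_telescope) (simp add: coef_eq_0)
  finally show ?thesis .
qed

lemma coef_0: "coef l 0 = prod_list (map \<phi> l)"
  by (induction l) simp_all

lemma coef_commute:
  assumes "\<And>i. \<phi> i * y = y * \<phi> i" "\<And>i. q i * y = y * q i"
  shows "coef l m * y = y * coef l m"
proof (induction l arbitrary: m)
  case (Cons i l)
  have "\<phi> i * (y * u) = y * (\<phi> i * u)" "q i * (y * u) = y * (q i * u)" for u
    using assms[of i] by (metis mult.assoc)+
  then show ?case by (cases m) (simp_all add: distrib_left distrib_right mult.assoc Cons)
qed simp

end

section \<open>The duality identity\<close>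

lemma inverse_commute:
  fixes x :: "'r::monoid_mult"
  assumes "u * x = x * u" "xi * x = 1" "x * xi = 1"
  shows "u * xi = xi * u"
  by (metis assms mult.assoc mult_1 mult_1_right)

lemma
  fixes u :: "'r::ring_1"
  shows mult_commute: "x * u = u * x \<Longrightarrow> y * u = u * y \<Longrightarrow> x * y * u = u * (x * y)"
    and mult_anticommute_left: "x * u = - (u * x) \<Longrightarrow> y * u = u * y \<Longrightarrow> x * y * u = - (u * (x * y))"
    and mult_anticommute_right: "x * u = u * x \<Longrightarrow> y * u = - (u * y) \<Longrightarrow> x * y * u = - (u * (x * y))"
    and mult_anticommute_both: "x * u = - (u * x) \<Longrightarrow> y * u = - (u * y) \<Longrightarrow> x * y * u = u * (x * y)"
proof -
  have *: "x * y * u = x * (y * u)" "u * x * y = u * (x * y)" by (simp_all only: mult.assoc)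
  show "x * y * u = u * (x * y)" if "x * u = u * x" "y * u = u * y"
    unfolding *(1) that(2) mult.assoc[symmetric] that(1) ..
  show "x * y * u = - (u * (x * y))" if "x * u = - (u * x)" "y * u = u * y"
    unfolding *(1) that(2) mult.assoc[symmetric] that(1) by simp
  show "x * y * u = - (u * (x * y))" if "x * u = u * x" "y * u = - (u * y)"
    unfolding *(1) that(2) mult_minus_right mult.assoc[symmetric] that(1) ..
  show "x * y * u = u * (x * y)" if "x * u = - (u * x)" "y * u = - (u * y)"
    unfolding *(1) that(2) mult_minus_right mult.assoc[symmetric] that(1) by simp
qed

text \<open>The \<open>c i\<close> share the parity of \<xi> and \<delta>, so that
  \<open>\<xi> a j * c j\<close> is even. The \<open>\<theta> a\<close> carry a parity of their own
  and commute with \<xi>, \<delta> and \<open>c\<close>, so that they pass freely through the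
  factors \<open>\<Phi> a i\<close>.\<close>

locale duality =
  fixes k n :: nat and X Xi D Di :: "nat \<Rightarrow> 'r::ring_1"
    and \<xi> \<delta> :: "nat \<Rightarrow> nat \<Rightarrow> 'r" and c \<theta> :: "nat \<Rightarrow> 'r"
  assumes two_torsion_free: "\<And>y::'r. y + y = 0 \<Longrightarrow> y = 0"
    and XX: "\<And>a b. X a * X b = X b * X a"
    and X_inverse: "\<And>a. Xi a * X a = 1" "\<And>a. X a * Xi a = 1"
    and D_inverse: "\<And>i. Di i * D i = 1" "\<And>i. D i * Di i = 1"
    and DD: "\<And>i j. D i * D j = D j * D i"
    and DX: "\<And>i a. D i * X a = X a * D i + 1"
    and \<xi>\<xi>: "\<And>a i b j. \<xi> a i * \<xi> b j = - (\<xi> b j * \<xi> a i)"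
    and \<delta>\<delta>: "\<And>a i b j. \<delta> a i * \<delta> b j = - (\<delta> b j * \<delta> a i)"
    and \<delta>\<xi>: "\<And>a i b j. \<delta> a i * \<xi> b j = (if a = b \<and> i = j then 1 else 0) - \<xi> b j * \<delta> a i"
    and X\<xi>: "\<And>a b j. X a * \<xi> b j = \<xi> b j * X a" and X\<delta>: "\<And>a b j. X a * \<delta> b j = \<delta> b j * X a"
    and Xc: "\<And>a j. X a * c j = c j * X a" and X\<theta>: "\<And>a j. X a * \<theta> j = \<theta> j * X a"
    and D\<xi>: "\<And>a b j. D a * \<xi> b j = \<xi> b j * D a" and D\<delta>: "\<And>a b j. D a * \<delta> b j = \<delta> b j * D a"
    and Dc: "\<And>a j. D a * c j = c j * D a" and D\<theta>: "\<And>a j. D a * \<theta> j = \<theta> j * D a"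
    and cc: "\<And>i j. c i * c j = - (c j * c i)"
    and c\<xi>: "\<And>i a j. c i * \<xi> a j = - (\<xi> a j * c i)" and c\<delta>: "\<And>i a j. c i * \<delta> a j = - (\<delta> a j * c i)"
    and \<theta>\<theta>: "\<And>a b. \<theta> a * \<theta> b = - (\<theta> b * \<theta> a)"
    and \<theta>\<xi>: "\<And>b a j. \<theta> b * \<xi> a j = \<xi> a j * \<theta> b" and \<theta>\<delta>: "\<And>b a j. \<theta> b * \<delta> a j = \<delta> a j * \<theta> b"
    and \<theta>c: "\<And>b j. \<theta> b * c j = c j * \<theta> b"
begin

lemma anticommuting_sq: "(\<And>i j. w i * w j = - (w j * w i)) \<Longrightarrow> w i * w i = 0" for w :: "'i \<Rightarrow> 'r"
  by (rule two_torsion_free) (metis eq_neg_iff_add_eq_0)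

section \<open>Linear forms in the \<open>c i\<close> and their commutation relations\<close>

definition \<eta> where "\<eta> a = (\<Sum>j\<in>{1..n}. \<xi> a j * c j)"
definition \<beta> where "\<beta> a = Xi a * \<eta> a"
text \<open>\<open>linear_elimination\<close> asks for its relations at all indices, hence the
  truncation here and in \<open>\<Phi>\<close>: outside {1..n} the commutator of
  \<open>D i * c i\<close> with \<open>X a\<close> would be \<open>c i\<close>, while that of
  \<open>\<delta> a i\<close> with \<open>\<eta> a\<close> is 0.\<close>

definition q where "q a i = (if i \<in> {1..n} then \<delta> a i else 0)"

text \<open>The family after a eliminations: it starts from the diagonal part
  \<open>D i * c i\<close> and ends, for a = k, with row i of \<open>M_conj\<close> applied to
  \<open>c\<close>.\<close>

fun \<Phi> where
  "\<Phi> 0 i = (if i \<in> {1..n} then D i * c i else 0)"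
| "\<Phi> (Suc a) i = \<Phi> a i + q (Suc a) i * \<beta> (Suc a)"

lemma Xi_commute:
  "Xi a * X b = X b * Xi a" "Xi a * Xi b = Xi b * Xi a"
  "Xi a * \<xi> b j = \<xi> b j * Xi a" "Xi a * \<delta> b j = \<delta> b j * Xi a"
  "Xi a * c j = c j * Xi a" "Xi a * \<theta> j = \<theta> j * Xi a"
  using inverse_commute[OF _ X_inverse] XX X\<xi> X\<delta> Xc X\<theta> by metis+

lemma Di_commute:
  "Di i * \<xi> b j = \<xi> b j * Di i" "Di i * \<delta> b j = \<delta> b j * Di i"
  "Di i * c j = c j * Di i" "Di i * \<theta> j = \<theta> j * Di i" "Di i * Di l = Di l * Di i"
  using inverse_commute[OF _ D_inverse] D\<xi> D\<delta> Dc D\<theta> DD by metis+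

lemma \<xi>c_c: "\<xi> a j * c j * c i = c i * (\<xi> a j * c j)"
  by (rule mult_anticommute_both) (simp_all add: c\<xi> cc[of j])

lemma \<xi>c_\<xi>: "\<xi> a j * c j * \<xi> b l = \<xi> b l * (\<xi> a j * c j)"
  by (rule mult_anticommute_both) (simp_all add: c\<xi> \<xi>\<xi>[of a])

lemma \<eta>_commute:
  "\<eta> a * c i = c i * \<eta> a" "\<eta> a * \<xi> b l = \<xi> b l * \<eta> a" "\<eta> a * X b = X b * \<eta> a"
  "\<eta> a * Xi b = Xi b * \<eta> a" "\<eta> a * D i = D i * \<eta> a" "\<eta> a * \<theta> b = \<theta> b * \<eta> a"
  unfolding \<eta>_def
  by (rule sum_commute[symmetric]; rule mult_commute[symmetric] \<xi>c_c[symmetric] \<xi>c_\<xi>[symmetric];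
      simp add: X\<xi> Xc Xi_commute D\<xi> Dc \<theta>\<xi> \<theta>c)+

lemma \<eta>\<eta>: "\<eta> a * \<eta> b = \<eta> b * \<eta> a"
  unfolding \<eta>_def[of b] by (rule sum_commute) (rule mult_commute[symmetric]; simp only: \<eta>_commute)

lemma q_\<eta>: "q a i * \<eta> b = \<eta> b * q a i + (if a = b \<and> i \<in> {1..n} then c i else 0)"
proof (cases "i \<in> {1..n}")
  case True
  have "\<delta> a i * (\<xi> b j * c j) = \<xi> b j * c j * \<delta> a i + (if a = b \<and> i = j then c j else 0)" for j
  proof -
    have "\<delta> a i * (\<xi> b j * c j) = ((if a = b \<and> i = j then 1 else 0) - \<xi> b j * \<delta> a i) * c j"
      by (simp only: \<delta>\<xi> mult.assoc[symmetric])
    also have "\<dots> = (if a = b \<and> i = j then c j else 0) - \<xi> b j * (\<delta> a i * c j)"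
      by (simp add: left_diff_distrib mult.assoc)
    also have "\<delta> a i * c j = - (c j * \<delta> a i)" by (simp add: c\<delta>)
    finally show ?thesis by (simp add: mult.assoc)
  qed
  then have "\<delta> a i * \<eta> b = \<eta> b * \<delta> a i + (\<Sum>j\<in>{1..n}. if a = b \<and> i = j then c j else 0)"
    by (simp only: \<eta>_def sum_distrib_left sum_distrib_right sum.distrib)
  also have "(\<Sum>j\<in>{1..n}. if a = b \<and> i = j then c j else 0) = (if a = b then c i else 0)"
    using True by (cases "a = b") simp_all
  finally show ?thesis using True by (simp add: q_def)
qed (auto simp: q_def)

lemma q_commute: "q a i * X b = X b * q a i" "q a i * Xi b = Xi b * q a i" "q a i * \<theta> b = \<theta> b * q a i"
  "D l * q a i = q a i * D l" "Di l * q a i = q a i * Di l"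
  by (simp_all add: q_def X\<delta> Xi_commute \<theta>\<delta> D\<delta> Di_commute)

lemma qq: "q a i * q b j = - (q b j * q a i)" and cq: "c l * q a i = - (q a i * c l)"
  using \<delta>\<delta>[of a i b j] c\<delta>[of l a i] by (simp_all add: q_def)

lemma \<beta>_commute:
  "\<beta> a * \<eta> b = \<eta> b * \<beta> a" "\<beta> a * X b = X b * \<beta> a" "\<beta> a * \<theta> b = \<theta> b * \<beta> a"
  unfolding \<beta>_def by (rule mult_commute; simp add: \<eta>_commute \<eta>\<eta> Xi_commute)+

lemma q_\<beta>: "a \<noteq> b \<Longrightarrow> \<beta> b * q a i = q a i * \<beta> b"
  unfolding \<beta>_def using q_\<eta>[of a i b] by (intro mult_commute) (simp_all add: q_commute)

lemma \<Phi>_q: "a < b \<Longrightarrow> \<Phi> a i * q b j = - (q b j * \<Phi> a i)"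
proof (induction a)
  case 0
  have "D i * c i * q b j = - (q b j * (D i * c i))"
    by (rule mult_anticommute_right) (simp_all add: cq q_commute)
  then show ?case by simp
next
  case (Suc a)
  have "q (Suc a) i * \<beta> (Suc a) * q b j = - (q b j * (q (Suc a) i * \<beta> (Suc a)))"
    using Suc.prems by (intro mult_anticommute_left) (simp_all add: q_\<beta> qq[of "Suc a"])
  then show ?case using Suc by (simp add: distrib_left distrib_right)
qed

lemma \<Phi>_\<eta>: "a < b \<Longrightarrow> \<Phi> a i * \<eta> b = \<eta> b * \<Phi> a i"
proof (induction a)
  case 0
  have "D i * c i * \<eta> b = \<eta> b * (D i * c i)" by (rule mult_commute) (simp_all add: \<eta>_commute)
  then show ?case by simp
next
  case (Suc a)
  then have "q (Suc a) i * \<eta> b = \<eta> b * q (Suc a) i" using q_\<eta>[of "Suc a" i b] by simp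
  then have "q (Suc a) i * \<beta> (Suc a) * \<eta> b = \<eta> b * (q (Suc a) i * \<beta> (Suc a))"
    by (rule mult_commute) (simp add: \<beta>_commute)
  then show ?case using Suc by (simp add: distrib_left distrib_right)
qed

text \<open>Here \<open>c i\<close> comes from \<open>DX\<close>. The contraction of \<delta> with
  \<xi> gives the same \<open>c i\<close> in \<open>q_\<eta>\<close>, and the agreement of the two
  is the relation \<open>\<phi>x\<close> of the elimination.\<close>

lemma \<Phi>_X: "a < b \<Longrightarrow> \<Phi> a i * X b = X b * \<Phi> a i + (if i \<in> {1..n} then c i else 0)"
proof (induction a)
  case 0
  have "D i * c i * X b = D i * X b * c i" by (simp only: mult.assoc Xc)
  also have "\<dots> = X b * (D i * c i) + c i" by (simp add: DX distrib_right mult.assoc)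
  finally show ?case by simp
next
  case (Suc a)
  have "q (Suc a) i * \<beta> (Suc a) * X b = X b * (q (Suc a) i * \<beta> (Suc a))"
    by (rule mult_commute) (simp_all add: \<beta>_commute q_commute)
  then show ?case using Suc by (simp add: distrib_left distrib_right)
qed

lemma \<Phi>_\<theta>: "\<Phi> a i * \<theta> b = \<theta> b * \<Phi> a i"
proof (induction a)
  case 0
  have "D i * c i * \<theta> b = \<theta> b * (D i * c i)" by (rule mult_commute) (simp_all add: \<theta>c D\<theta>)
  then show ?case by simp
next
  case (Suc a)
  have "q (Suc a) i * \<beta> (Suc a) * \<theta> b = \<theta> b * (q (Suc a) i * \<beta> (Suc a))"
    by (rule mult_commute) (simp_all add: \<beta>_commute q_commute)
  then show ?case using Suc by (simp add: distrib_left distrib_right)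
qed

lemma \<Phi>_0_anticommute: "\<Phi> 0 i * \<Phi> 0 j = - (\<Phi> 0 j * \<Phi> 0 i)"
proof -
  have "D i * c i * (D j * c j) = D i * D j * (c i * c j)" for i j
    using arg_cong[OF Dc[of j i], of "\<lambda>u. D i * (u * c j)"] by (simp only: mult.assoc)
  then show ?thesis using cc[of i j] DD[of i j] by simp
qed

text \<open>Only the anticommutation of the \<open>\<Phi> a i\<close> requires induction: it is the
  outcome of the preceding elimination.\<close>

lemma elimination: "linear_elimination (\<Phi> a) (q (Suc a)) (X (Suc a)) (Xi (Suc a)) (\<eta> (Suc a)) (\<beta> (Suc a))"
proof (induction a)
  have *: "linear_elimination (\<Phi> a) (q (Suc a)) (X (Suc a)) (Xi (Suc a)) (\<eta> (Suc a)) (\<beta> (Suc a))"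
    if "\<And>i j. \<Phi> a i * \<Phi> a j = - (\<Phi> a j * \<Phi> a i)" for a
  proof
    show "\<Phi> a i * q (Suc a) j = - (q (Suc a) j * \<Phi> a i)" for i j by (rule \<Phi>_q) simp
  qed (fact that two_torsion_free qq X_inverse \<beta>_def |
        simp add: \<Phi>_\<eta> \<Phi>_X q_\<eta> q_commute \<eta>_commute del: \<Phi>.simps)+
  {
    case 0
    show ?case by (rule *) (rule \<Phi>_0_anticommute)
  next
    case (Suc a)
    show ?case by (rule *, unfold \<Phi>.simps) (rule linear_elimination.eliminated_anticommute[OF Suc])
  }
qed

section \<open>Linear forms in the \<open>\<theta> a\<close>\<close>

definition \<zeta> where "\<zeta> j = (\<Sum>e\<in>{1..k}. \<theta> e * \<xi> e j)"
definition A where "A b = (\<Sum>j\<in>{1..n}. \<zeta> j * (\<delta> b j * Di j))"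
text \<open>Row b of \<open>M_dual\<close> applied to \<open>\<theta>\<close>, with the
  \<open>\<theta>\<close> of the second part moved to the left and collected in
  \<open>\<zeta>\<close>.\<close>

definition \<Psi> where "\<Psi> b = X b * \<theta> b + A b"

lemma \<zeta>_\<theta>: "\<theta> b * \<zeta> j = - (\<zeta> j * \<theta> b)"
proof -
  have "\<theta> b * (\<theta> e * \<xi> e j) = - (\<theta> e * \<xi> e j * \<theta> b)" for e
    using mult_anticommute_left[of "\<theta> e" "\<theta> b" "\<xi> e j"] by (simp add: \<theta>\<theta>[of e b] \<theta>\<xi>)
  then show ?thesis by (simp only: \<zeta>_def sum_distrib_left sum_distrib_right sum_negf)
qed

lemma \<zeta>\<zeta>: "\<zeta> i * \<zeta> j = \<zeta> j * \<zeta> i"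
proof -
  have "\<zeta> i * (\<theta> e * \<xi> e j) = \<theta> e * \<xi> e j * \<zeta> i" for e
  proof -
    have "\<zeta> i * \<xi> e j = - (\<xi> e j * \<zeta> i)"
    proof -
      have "\<theta> b * \<xi> b i * \<xi> e j = - (\<xi> e j * (\<theta> b * \<xi> b i))" for b
        by (rule mult_anticommute_right) (simp_all add: \<theta>\<xi> \<xi>\<xi>[of b])
      then show ?thesis by (simp only: \<zeta>_def sum_distrib_left sum_distrib_right sum_negf)
    qed
    then show ?thesis
      by (intro mult_anticommute_both[symmetric]) (simp_all add: \<zeta>_\<theta>)
  qed
  then show ?thesis unfolding \<zeta>_def[of j] by (simp only: sum_distrib_left sum_distrib_right)
qed

lemma \<zeta>_X: "\<zeta> j * X b = X b * \<zeta> j"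
proof -
  have "\<theta> e * \<xi> e j * X b = X b * (\<theta> e * \<xi> e j)" for e
    by (rule mult_commute) (simp_all add: X\<theta> X\<xi>)
  then show ?thesis by (simp only: \<zeta>_def sum_distrib_left sum_distrib_right)
qed

lemma \<delta>_\<zeta>: "\<delta> b j * \<zeta> l = (if j = l \<and> b \<in> {1..k} then \<theta> b else 0) - \<zeta> l * \<delta> b j"
proof -
  have "\<delta> b j * (\<theta> e * \<xi> e l) = (if e = b then (if j = l then \<theta> b else 0) else 0) - \<theta> e * \<xi> e l * \<delta> b j" for e
  proof -
    have "\<delta> b j * (\<theta> e * \<xi> e l) = \<theta> e * (\<delta> b j * \<xi> e l)" by (simp only: mult.assoc[symmetric] \<theta>\<delta>)
    then show ?thesis unfolding \<delta>\<xi> by (auto simp: right_diff_distrib mult.assoc)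
  qed
  then have "\<delta> b j * \<zeta> l = (\<Sum>e\<in>{1..k}. if e = b then (if j = l then \<theta> b else 0) else 0) - \<zeta> l * \<delta> b j"
    by (simp only: \<zeta>_def sum_distrib_left sum_distrib_right sum_subtractf)
  then show ?thesis by simp
qed

lemma Di_X: "Di j * X b = X b * Di j - Di j * Di j"
proof -
  have "Di j * (D j * X b) * Di j = Di j * (X b * D j + 1) * Di j" by (simp only: DX)
  then have "X b * Di j = Di j * X b + Di j * Di j"
    using D_inverse[of j] by (simp add: distrib_left distrib_right mult.assoc)
      (simp add: mult.assoc[symmetric])
  then show ?thesis by simp
qed

text \<open>Everything would cancel if \<open>Di j\<close> commuted with \<open>X b\<close>; what
  remains is the term \<open>Di j * Di j\<close> of \<open>Di_X\<close>.\<close>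

lemma X\<theta>_A:
  "X b * \<theta> b * A e + A e * (X b * \<theta> b) = - (\<Sum>j\<in>{1..n}. \<zeta> j * \<theta> b * (\<delta> e j * Di j * Di j))"
proof -
  have *: "X b * \<theta> b * (\<zeta> j * (\<delta> e j * Di j)) + \<zeta> j * (\<delta> e j * Di j) * (X b * \<theta> b)
     = - (\<zeta> j * \<theta> b * (\<delta> e j * Di j * Di j))" for j
  proof -
    have "X b * \<theta> b * (\<zeta> j * (\<delta> e j * Di j)) = X b * (\<theta> b * \<zeta> j) * (\<delta> e j * Di j)" by (simp only: mult.assoc)
    also have "\<dots> = - (X b * \<zeta> j * \<theta> b * (\<delta> e j * Di j))" by (simp add: \<zeta>_\<theta> mult.assoc)
    also have "X b * \<zeta> j * \<theta> b = \<zeta> j * \<theta> b * X b"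
      using mult_commute[of "\<zeta> j" "X b" "\<theta> b"] by (simp add: \<zeta>_X X\<theta> mult.assoc)
    also have "\<zeta> j * \<theta> b * X b * (\<delta> e j * Di j) = \<zeta> j * \<theta> b * (\<delta> e j * (X b * Di j))"
      using arg_cong[OF X\<delta>[of b e j], of "\<lambda>u. \<zeta> j * \<theta> b * (u * Di j)"] by (simp only: mult.assoc)
    finally have 1: "X b * \<theta> b * (\<zeta> j * (\<delta> e j * Di j)) = - (\<zeta> j * \<theta> b * (\<delta> e j * (X b * Di j)))" .
    have "\<zeta> j * (\<delta> e j * Di j) * (X b * \<theta> b) = \<zeta> j * \<delta> e j * (Di j * X b) * \<theta> b" by (simp only: mult.assoc)
    also have "\<dots> = \<zeta> j * \<delta> e j * (\<theta> b * (Di j * X b))" 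
      using mult_commute[of "Di j" "\<theta> b" "X b"] by (simp add: Di_commute X\<theta> mult.assoc)
    also have "\<dots> = \<zeta> j * \<theta> b * (\<delta> e j * (Di j * X b))"
      using arg_cong[OF \<theta>\<delta>[of b e j], of "\<lambda>u. \<zeta> j * (u * (Di j * X b))"] by (simp only: mult.assoc)
    finally show ?thesis unfolding 1 Di_X by (simp add: right_diff_distrib mult.assoc)
  qed
  show ?thesis
    unfolding A_def sum_distrib_left sum_distrib_right sum.distrib[symmetric] sum_negf[symmetric] *  ..
qed

text \<open>The right-hand side comes from contracting the inner \<delta> with
  \<open>\<zeta>\<close>; the normally ordered remainder cancels between the two products.\<close>

lemma AA:
  assumes "b \<in> {1..k}" "e \<in> {1..k}"
  shows "A b * A e + A e * A b = (\<Sum>j\<in>{1..n}. \<zeta> j * \<theta> b * (\<delta> e j * Di j * Di j))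
      + (\<Sum>j\<in>{1..n}. \<zeta> j * \<theta> e * (\<delta> b j * Di j * Di j))"
proof -
  define B where "B b e j l = \<zeta> j * \<zeta> l * (\<delta> b j * \<delta> e l * (Di j * Di l))" for b e j l
  have A: "A b * A e = (\<Sum>j\<in>{1..n}. \<zeta> j * \<theta> b * (\<delta> e j * Di j * Di j)) - (\<Sum>j\<in>{1..n}. \<Sum>l\<in>{1..n}. B b e j l)"
    if b: "b \<in> {1..k}" for b e
  proof -
    have *: "\<zeta> j * (\<delta> b j * Di j) * (\<zeta> l * (\<delta> e l * Di l))
      = (if l = j then \<zeta> j * \<theta> b * (\<delta> e j * Di j * Di j) else 0) - B b e j l" for j l
    proof -
      have Di\<zeta>: "Di j * \<zeta> l = \<zeta> l * Di j"
        unfolding \<zeta>_def 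
        by (rule sum_commute) (rule mult_commute[symmetric]; simp add: Di_commute)
      have "\<zeta> j * (\<delta> b j * Di j) * (\<zeta> l * (\<delta> e l * Di l)) = \<zeta> j * (\<delta> b j * (Di j * \<zeta> l) * (\<delta> e l * Di l))"
        by (simp only: mult.assoc)
      also have "\<dots> = \<zeta> j * ((\<delta> b j * \<zeta> l) * (Di j * \<delta> e l) * Di l)" by (simp only: Di\<zeta> mult.assoc)
      also have "\<dots> = \<zeta> j * ((\<delta> b j * \<zeta> l) * (\<delta> e l * (Di j * Di l)))" by (simp only: Di_commute mult.assoc)
      also have "\<dots> = (if l = j then \<zeta> j * \<theta> b * (\<delta> e j * Di j * Di j) else 0) - B b e j l"
        unfolding \<delta>_\<zeta> B_def using b by (auto simp: left_diff_distrib right_diff_distrib mult.assoc)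
      finally show ?thesis .
    qed
    show ?thesis unfolding A_def sum_product * sum_subtractf by simp
  qed
  \<comment> \<open>Exchanging both index pairs at once changes only the sign, through the two
    \<delta>.\<close>
  have "B b e j l = - B e b l j" for j l
    unfolding B_def \<zeta>\<zeta>[of j l] \<delta>\<delta>[of b j e l] Di_commute(5)[of j l] by simp
  then have "(\<Sum>j\<in>{1..n}. \<Sum>l\<in>{1..n}. B b e j l) = - (\<Sum>j\<in>{1..n}. \<Sum>l\<in>{1..n}. B e b l j)"
    by (simp only: sum_negf)
  also have "(\<Sum>j\<in>{1..n}. \<Sum>l\<in>{1..n}. B e b l j) = (\<Sum>j\<in>{1..n}. \<Sum>l\<in>{1..n}. B e b j l)" by (rule sum.swap)
  finally show ?thesis unfolding A[OF assms(1)] A[OF assms(2)] by simp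
qed

text \<open>The defect in \<open>X\<theta>_A\<close>, due to the commutator of \<open>Di\<close>
  with \<open>X\<close>, and the defect in \<open>AA\<close>, due to the contraction of \<delta>
  with \<xi>, are opposite.\<close>

lemma \<Psi>\<Psi>: "b \<in> {1..k} \<Longrightarrow> e \<in> {1..k} \<Longrightarrow> \<Psi> b * \<Psi> e = - (\<Psi> e * \<Psi> b)"
proof -
  assume be: "b \<in> {1..k}" "e \<in> {1..k}"
  have 0: "X b * \<theta> b * (X e * \<theta> e) + X e * \<theta> e * (X b * \<theta> b) = 0"
  proof -
    have "X b * \<theta> b * (X e * \<theta> e) = X b * X e * (\<theta> b * \<theta> e)" for b e
      using arg_cong[OF X\<theta>[of e b], of "\<lambda>u. X b * (u * \<theta> e)"] by (simp only: mult.assoc)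
    then show ?thesis using XX[of e b] \<theta>\<theta>[of e b] by simp
  qed
  have "\<Psi> b * \<Psi> e + \<Psi> e * \<Psi> b = (X b * \<theta> b * (X e * \<theta> e) + X e * \<theta> e * (X b * \<theta> b))
     + (X b * \<theta> b * A e + A e * (X b * \<theta> b)) + (X e * \<theta> e * A b + A b * (X e * \<theta> e)) + (A b * A e + A e * A b)"
    by (simp add: \<Psi>_def distrib_left distrib_right add_ac)
  also have "\<dots> = 0" unfolding 0 X\<theta>_A AA[OF be] by simp
  finally show ?thesis by (simp add: eq_neg_iff_add_eq_0)
qed

text \<open>For a central variable \<open>b\<close> the element \<open>\<Sum>j. \<zeta> j * Di j * (\<Phi> a j + q (Suc a) j * b)\<close> annihilates the
  product of the factors \<open>\<Phi> a j + q (Suc a) j * b\<close>. Its coefficients are expressed through the \<open>\<Psi>\<close>.\<close>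

lemma \<Psi>_q: "\<Psi> b = X b * \<theta> b + (\<Sum>j\<in>{1..n}. \<zeta> j * (Di j * q b j))"
  unfolding \<Psi>_def A_def q_def by (simp add: Di_commute)

lemma \<zeta>c: "(\<Sum>j\<in>{1..n}. \<zeta> j * c j) = (\<Sum>e\<in>{1..k}. \<theta> e * \<eta> e)"
  unfolding \<zeta>_def \<eta>_def sum_distrib_left sum_distrib_right mult.assoc by (rule sum.swap)

text \<open>The part \<open>X b * \<theta> b\<close> of \<open>\<Psi> b\<close> turns
  \<open>\<beta> b\<close> into \<open>\<theta> b * \<eta> b\<close>. These terms make up the
  beginning of \<open>\<Sum>e. \<theta> e * \<eta> e\<close>, which by \<open>\<zeta>c\<close> is
  \<open>\<Sum>j. \<zeta> j * c j\<close>, the contribution of \<open>\<Phi> 0\<close>. The other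
  parts build up \<open>\<Phi> a\<close> from \<open>\<Phi> 0\<close>.\<close>

lemma \<Psi>_\<beta>:
  assumes "a \<le> k"
  shows "(\<Sum>b\<in>{1..a}. \<Psi> b * \<beta> b) = (\<Sum>j\<in>{1..n}. \<zeta> j * (Di j * \<Phi> a j)) - (\<Sum>e\<in>{Suc a..k}. \<theta> e * \<eta> e)"
  using assms
proof (induction a)
  case 0
  have "(\<Sum>j\<in>{1..n}. \<zeta> j * (Di j * \<Phi> 0 j)) = (\<Sum>j\<in>{1..n}. \<zeta> j * c j)"
    by (intro sum.cong refl) (simp add: mult.assoc[of "Di _", symmetric] D_inverse)
  then show ?case using \<zeta>c by simp
next
  case (Suc a)
  have "X (Suc a) * \<theta> (Suc a) * \<beta> (Suc a) = \<theta> (Suc a) * (X (Suc a) * (Xi (Suc a) * \<eta> (Suc a)))"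
    by (simp only: X\<theta> \<beta>_def mult.assoc)
  then have "\<Psi> (Suc a) * \<beta> (Suc a) = \<theta> (Suc a) * \<eta> (Suc a) + (\<Sum>j\<in>{1..n}. \<zeta> j * (Di j * (q (Suc a) j * \<beta> (Suc a))))"
    unfolding \<Psi>_q by (simp add: X_inverse distrib_right sum_distrib_right mult.assoc[symmetric])
  moreover have "(\<Sum>e\<in>{Suc a..k}. \<theta> e * \<eta> e) = \<theta> (Suc a) * \<eta> (Suc a) + (\<Sum>e\<in>{Suc (Suc a)..k}. \<theta> e * \<eta> e)"
    using Suc.prems by (simp add: sum.atLeast_Suc_atMost)
  moreover have "(\<Sum>j\<in>{1..n}. \<zeta> j * (Di j * \<Phi> (Suc a) j)) = (\<Sum>j\<in>{1..n}. \<zeta> j * (Di j * \<Phi> a j))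
     + (\<Sum>j\<in>{1..n}. \<zeta> j * (Di j * (q (Suc a) j * \<beta> (Suc a))))"
    by (simp add: distrib_left sum.distrib)
  ultimately show ?case using Suc by simp
qed

section \<open>Trading the factors \<open>X a\<close> one at a time\<close>

definition U where "U a = prod_list (map (\<Phi> a) [1..<n+1])"
text \<open>\<open>Z a * U a\<close> interpolates: at a = 0 it involves only
  \<open>\<theta>\<close>, \<open>D\<close> and \<open>c\<close>, at a = k it contains both row
  determinants.\<close>

definition Z where "Z a = prod_list (map \<Psi> [1..<a+1]) * prod_list (map \<theta> [a+1..<k+1])"

lemma \<theta>_sq: "\<theta> a * \<theta> a = 0" and c_sq: "c i * c i = 0"
  by (rule anticommuting_sq, rule \<theta>\<theta> cc)+

lemma \<theta>_top: "e \<in> set l \<Longrightarrow> \<theta> e * prod_list (map \<theta> l) = 0"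
  using prod_list_anticommute_not_distinct[of \<theta> "e # l", OF \<theta>\<theta> \<theta>_sq] by simp

lemma \<Psi>_top:
  assumes "b \<in> {1..a}" "a \<le> k"
  shows "prod_list (map \<Psi> [1..<a+1]) * \<Psi> b = 0"
proof -
  \<comment> \<open>\<open>\<Psi>\<Psi>\<close> is restricted to indices in {1..k}; the truncation
    makes it total.\<close>
  define w where "w b = (if b \<in> {1..k} then \<Psi> b else 0)" for b
  have ww: "w i * w j = - (w j * w i)" for i j using \<Psi>\<Psi>[of i j] by (simp add: w_def)
  have "prod_list (map w ([1..<a+1] @ [b])) = 0"
    using assms by (intro prod_list_anticommute_not_distinct ww anticommuting_sq) auto
  moreover have "map w ([1..<a+1] @ [b]) = map \<Psi> ([1..<a+1] @ [b])"
    using assms by (auto simp: w_def)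
  ultimately have "prod_list (map \<Psi> ([1..<a+1] @ [b])) = 0" by (simp only:)
  then show ?thesis by (simp del: upt_Suc)
qed

text \<open>The coefficient of \<open>b ^ Suc m\<close> of the annihilating element gives
  \<open>eq\<close>. The factors \<open>\<Psi> b\<close> already present on the left kill
  \<open>S\<close>, and the \<open>\<theta>\<close> not yet replaced on the right kill
  \<open>R\<close>. So \<open>Z (Suc a) * F m = Z a * H m\<close> for every m, and summation against
  the powers of \<open>\<beta>\<close> telescopes to the factor \<open>X (Suc a)\<close>.\<close>

lemma Z_step:
  assumes "a < k"
  shows "Z (Suc a) * U (Suc a) = Z a * U a * X (Suc a)"
proof -
  interpret E: linear_elimination "\<Phi> a" "q (Suc a)" "X (Suc a)" "Xi (Suc a)" "\<eta> (Suc a)" "\<beta> (Suc a)"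
    by (rule elimination)
  let ?l = "[1..<n+1]" and ?P = "prod_list (map \<Psi> [1..<a+1])" and ?\<tau> = "prod_list (map \<theta> [a+2..<k+1])"
  let ?\<theta> = "\<theta> (Suc a)" and ?x = "X (Suc a)" and ?\<eta> = "\<eta> (Suc a)" and ?\<beta> = "\<beta> (Suc a)"
  define F where "F = E.coef ?l"
  have F_\<theta>: "F m * \<theta> b = \<theta> b * F m" for m b
    unfolding F_def by (rule E.coef_commute) (simp_all only: \<Phi>_\<theta> q_commute)
  have \<tau>: "y * ?\<tau> = ?\<tau> * y" if "\<And>b. y * \<theta> b = \<theta> b * y" for y
    by (rule prod_list_commute) (rule that)
  have F_\<tau>: "F m * ?\<tau> = ?\<tau> * F m" for m by (rule \<tau>) (rule F_\<theta>)
  have \<eta>_\<tau>: "\<eta> b * ?\<tau> = ?\<tau> * \<eta> b" for b by (rule \<tau>) (rule \<eta>_commute)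
  have x_\<tau>: "?x * ?\<tau> = ?\<tau> * ?x" by (rule \<tau>) (rule X\<theta>)
  \<comment> \<open>Two forms of \<open>H\<close> are used: the defining one telescopes under
    evaluation at \<open>?\<beta>\<close>; the other one, from \<open>coef_relation\<close>, is what
    the annihilating element produces.\<close>
  define H where "H m = F m * ?x - F (Suc m) * ?\<eta>" for m
  have H: "H m = ?x * F m - ?\<eta> * F (Suc m)" for m unfolding H_def F_def by (rule E.coef_relation)
  have H_\<tau>: "H m * ?\<tau> = ?\<tau> * H m" for m
    unfolding H_def by (rule \<tau>) (simp add: left_diff_distrib right_diff_distrib mult_commute F_\<theta> \<eta>_commute X\<theta>)
  define R where "R = (\<Sum>e\<in>{Suc (Suc a)..k}. \<theta> e * \<eta> e)"
  define S where "S = (\<Sum>b\<in>{1..a}. \<Psi> b * \<beta> b)"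
  have eq: "\<Psi> (Suc a) * F m + S * F (Suc m) = ?\<theta> * H m - R * F (Suc m)" for m
  proof -
    have kill: "\<Phi> a j * F (Suc m) + q (Suc a) j * F m = 0" if "j \<in> {1..n}" for j
      using E.coef_annihilated[of j ?l "Suc m"] that unfolding F_def by (simp del: upt_Suc)
    have "R + ?\<theta> * ?\<eta> = (\<Sum>e\<in>{Suc a..k}. \<theta> e * \<eta> e)"
      unfolding R_def using assms by (simp add: sum.atLeast_Suc_atMost)
    then have "S = (\<Sum>j\<in>{1..n}. \<zeta> j * (Di j * \<Phi> a j)) - (R + ?\<theta> * ?\<eta>)"
      unfolding S_def using \<Psi>_\<beta>[of a] assms by simp
    then have "\<Psi> (Suc a) * F m + S * F (Suc m) = ?x * ?\<theta> * F m - ?\<theta> * ?\<eta> * F (Suc m) - R * F (Suc m)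
       + (\<Sum>j\<in>{1..n}. \<zeta> j * (Di j * (\<Phi> a j * F (Suc m) + q (Suc a) j * F m)))"
      unfolding \<Psi>_q by (simp add: distrib_left distrib_right left_diff_distrib sum_distrib_right sum.distrib mult.assoc)
    also have "(\<Sum>j\<in>{1..n}. \<zeta> j * (Di j * (\<Phi> a j * F (Suc m) + q (Suc a) j * F m))) = 0"
      by (rule sum.neutral) (simp add: kill)
    also have "?x * ?\<theta> * F m - ?\<theta> * ?\<eta> * F (Suc m) = ?\<theta> * H m"
      unfolding H X\<theta> by (simp add: right_diff_distrib mult.assoc)
    finally show ?thesis by simp
  qed
  have main: "?P * \<Psi> (Suc a) * ?\<tau> * F m = ?P * ?\<theta> * ?\<tau> * H m" for m
  proof -
    have R: "R * F (Suc m) * ?\<tau> = 0"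
    proof -
      have "\<theta> e * \<eta> e * F (Suc m) * ?\<tau> = 0" if "e \<in> {Suc (Suc a)..k}" for e
      proof -
        have "\<theta> e * \<eta> e * F (Suc m) * ?\<tau> = \<theta> e * (\<eta> e * (F (Suc m) * ?\<tau>))" by (simp only: mult.assoc)
        also have "\<dots> = \<theta> e * (\<eta> e * ?\<tau>) * F (Suc m)" by (simp only: F_\<tau> mult.assoc)
        also have "\<dots> = \<theta> e * ?\<tau> * (\<eta> e * F (Suc m))" by (simp only: \<eta>_\<tau> mult.assoc)
        also have "\<theta> e * ?\<tau> = 0" using that by (intro \<theta>_top) auto
        finally show ?thesis by simp
      qed
      then show ?thesis unfolding R_def sum_distrib_right by (simp del: upt_Suc)
    qed
    have S: "?P * S = 0"
    proof -
      have "?P * (\<Psi> b * \<beta> b) = 0" if "b \<in> {1..a}" for b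
        using \<Psi>_top[OF that] assms by (simp add: mult.assoc[symmetric] del: upt_Suc)
      then show ?thesis unfolding S_def sum_distrib_left by (simp del: upt_Suc)
    qed
    have "?P * \<Psi> (Suc a) * ?\<tau> * F m = ?P * (\<Psi> (Suc a) * F m) * ?\<tau>"
      by (simp only: mult.assoc F_\<tau>)
    also have "\<dots> = ?P * (\<Psi> (Suc a) * F m) * ?\<tau> + ?P * S * F (Suc m) * ?\<tau>" by (simp only: S) simp
    also have "\<dots> = ?P * (\<Psi> (Suc a) * F m + S * F (Suc m)) * ?\<tau>"
      by (simp add: distrib_left distrib_right mult.assoc)
    also have "\<dots> = ?P * (?\<theta> * H m) * ?\<tau> - ?P * (R * F (Suc m) * ?\<tau>)"
      unfolding eq by (simp add: right_diff_distrib left_diff_distrib mult.assoc)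
    also have "\<dots> = ?P * ?\<theta> * ?\<tau> * H m" unfolding R by (simp only: mult.assoc H_\<tau> mult_zero_right diff_zero)
    finally show ?thesis .
  qed
  have Z1: "Z (Suc a) = ?P * \<Psi> (Suc a) * ?\<tau>" unfolding Z_def by (simp add: mult.assoc)
  have Z0: "Z a = ?P * ?\<theta> * ?\<tau>"
  proof -
    have "[a+1..<k+1] = Suc a # [a+2..<k+1]" using assms by (simp add: upt_conv_Cons del: upt_Suc)
    then show ?thesis unfolding Z_def by (simp add: mult.assoc del: upt_Suc)
  qed
  have U1: "U (Suc a) = (\<Sum>m\<le>n. F m * ?\<beta> ^ m)"
  proof -
    have "\<Phi> (Suc a) = (\<lambda>i. \<Phi> a i + q (Suc a) i * ?\<beta>)" by (rule ext) simp
    then show ?thesis using E.coef_eval[of ?l] unfolding U_def F_def by (simp del: upt_Suc)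
  qed
  have U0: "(\<Sum>m\<le>n. H m * ?\<beta> ^ m) = U a * ?x"
    using E.coef_telescope[of ?l] unfolding U_def F_def H_def E.coef_0 by (simp del: upt_Suc)
  have "Z (Suc a) * U (Suc a) = (\<Sum>m\<le>n. Z (Suc a) * F m * ?\<beta> ^ m)"
    unfolding U1 by (simp add: sum_distrib_left mult.assoc)
  also have "\<dots> = (\<Sum>m\<le>n. Z a * H m * ?\<beta> ^ m)" unfolding Z1 main Z0 ..
  also have "\<dots> = Z a * (U a * ?x)" unfolding U0[symmetric] by (simp add: sum_distrib_left mult.assoc)
  finally show ?thesis by (simp add: mult.assoc)
qed

lemma Z_all: "a \<le> k \<Longrightarrow> Z a * U a = Z 0 * U 0 * prod_list (map X [1..<a+1])"
  by (induction a) (simp_all add: Z_step mult.assoc[symmetric])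

section \<open>From linear forms to row determinants\<close>

definition M_dual where
  "M_dual a b = (if a = b then X a else 0) + (\<Sum>i\<in>{1..n}. \<xi> b i * \<delta> a i * Di i)"
text \<open>The elimination leaves \<delta> to the left of \<xi>. Restoring the order of the
  universal operator adds \<open>\<Sum>a. Xi a\<close> to the diagonal, so \<open>M\<close> is
  reached only by a conjugation.\<close>

definition M_conj where
  "M_conj i j = (if i = j then D i else 0) + (\<Sum>a\<in>{1..k}. \<delta> a i * \<xi> a j * Xi a)"
definition M where
  "M i j = (if i = j then D i else 0) - (\<Sum>a\<in>{1..k}. \<xi> a j * \<delta> a i * Xi a)"

lemma M_dual_\<theta>: "\<theta> e * M_dual a b = M_dual a b * \<theta> e"
proof -
  have "\<theta> e * (\<xi> b i * \<delta> a i * Di i) = \<xi> b i * \<delta> a i * Di i * \<theta> e" for i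
    by (rule mult_commute[symmetric])+ (simp_all add: Di_commute \<theta>\<xi> \<theta>\<delta> mult_commute)
  then show ?thesis unfolding M_dual_def
    by (simp add: distrib_left distrib_right sum_distrib_left sum_distrib_right X\<theta> cong: sum.cong)
qed

lemma M_conj_c: "c l * M_conj i j = M_conj i j * c l"
proof -
  have "c l * (\<delta> a i * \<xi> a j * Xi a) = \<delta> a i * \<xi> a j * Xi a * c l" for a
    by (rule mult_commute[symmetric], rule mult_anticommute_both) (simp_all add: Xi_commute c\<xi> c\<delta>)
  then show ?thesis unfolding M_conj_def
    by (simp add: distrib_left distrib_right sum_distrib_left sum_distrib_right Dc cong: sum.cong)
qed

lemma \<Psi>_M_dual: "b \<in> {1..k} \<Longrightarrow> \<Psi> b = (\<Sum>e\<in>{1..k}. M_dual b e * \<theta> e)"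
proof -
  assume b: "b \<in> {1..k}"
  have "\<xi> e i * \<delta> b i * Di i * \<theta> e = \<theta> e * \<xi> e i * (\<delta> b i * Di i)" for e i
    using arg_cong[OF \<theta>\<xi>[of e e i], of "\<lambda>u. u * (\<delta> b i * Di i)"]
      arg_cong[OF \<theta>\<delta>[of e b i], of "\<lambda>u. \<xi> e i * (u * Di i)"]
    by (simp add: mult.assoc Di_commute)
  then have "(\<Sum>e\<in>{1..k}. (\<Sum>i\<in>{1..n}. \<xi> e i * \<delta> b i * Di i) * \<theta> e) = A b"
    unfolding A_def \<zeta>_def sum_distrib_right by (subst sum.swap) simp
  moreover have "(\<Sum>e\<in>{1..k}. (if b = e then X b else 0) * \<theta> e) = X b * \<theta> b"
    using b by (simp add: if_distrib[of "\<lambda>u. u * _"] cong: if_cong)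
  ultimately show ?thesis unfolding M_dual_def distrib_right sum.distrib \<Psi>_def by simp
qed

lemma \<Phi>_sum: "i \<in> {1..n} \<Longrightarrow> \<Phi> a i = D i * c i + (\<Sum>b\<in>{1..a}. \<delta> b i * \<beta> b)"
  by (induction a) (auto simp: q_def add.assoc)

lemma \<Phi>_M_conj: "i \<in> {1..n} \<Longrightarrow> \<Phi> k i = (\<Sum>j\<in>{1..n}. M_conj i j * c j)"
proof -
  assume i: "i \<in> {1..n}"
  have "(\<Sum>j\<in>{1..n}. (\<Sum>a\<in>{1..k}. \<delta> a i * \<xi> a j * Xi a) * c j) = (\<Sum>a\<in>{1..k}. \<delta> a i * \<beta> a)"
    unfolding sum_distrib_right \<beta>_def \<eta>_def sum_distrib_left
    by (subst sum.swap, intro sum.cong refl) (simp add: mult.assoc[symmetric], simp add: mult.assoc Xi_commute)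
  moreover have "(\<Sum>j\<in>{1..n}. (if i = j then D i else 0) * c j) = D i * c i"
    using i by (simp add: if_distrib[of "\<lambda>u. u * _"] cong: if_cong)
  ultimately show ?thesis unfolding M_conj_def distrib_right sum.distrib \<Phi>_sum[OF i] by simp
qed

abbreviation \<theta>_all where "\<theta>_all \<equiv> prod_list (map \<theta> [1..<k+1])"
abbreviation c_all where "c_all \<equiv> prod_list (map c [1..<n+1])"
abbreviation X_all where "X_all \<equiv> prod_list (map X [1..<k+1])"
abbreviation D_all where "D_all \<equiv> prod_list (map D [1..<n+1])"

lemma U_0: "U 0 = D_all * c_all"
proof -
  have "prod_list (map (\<lambda>i. D i * c i) l) = prod_list (map D l) * prod_list (map c l)" for l
  proof (induction l)
    case (Cons i l)
    have "c i * prod_list (map D l) = prod_list (map D l) * c i" by (rule prod_list_commute) (simp add: Dc)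
    then have "D i * (c i * prod_list (map D l)) * prod_list (map c l)
      = D i * (prod_list (map D l) * c i) * prod_list (map c l)" by (simp only:)
    then show ?case by (simp add: Cons mult.assoc)
  qed simp
  moreover have "map (\<Phi> 0) [1..<n+1] = map (\<lambda>i. D i * c i) [1..<n+1]" by auto
  ultimately show ?thesis unfolding U_def by (simp only:)
qed

text \<open>The endpoint a = k of \<open>Z_all\<close>, with a row determinant recognized in both
  products by \<open>prod_list_row_det\<close>. The rest moves the auxiliary variables to the
  right.\<close>

lemma duality_conj:
  "row_det k M_dual * row_det n M_conj * (\<theta>_all * c_all) = D_all * X_all * (\<theta>_all * c_all)"
proof -
  have Z: "Z k = row_det k M_dual * \<theta>_all"
  proof -
    have eq: "map \<Psi> [1..<k+1] = map (\<lambda>b. \<Sum>e\<in>{1..k}. M_dual b e * \<theta> e) [1..<k+1]"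
      using \<Psi>_M_dual by auto
    have "prod_list (map \<Psi> [1..<k+1]) = row_det k M_dual * \<theta>_all"
      unfolding eq by (rule prod_list_row_det) (rule \<theta>\<theta> \<theta>_sq M_dual_\<theta>)+
    then show ?thesis by (simp add: Z_def)
  qed
  have U: "U k = row_det n M_conj * c_all"
  proof -
    have eq: "map (\<Phi> k) [1..<n+1] = map (\<lambda>b. \<Sum>e\<in>{1..n}. M_conj b e * c e) [1..<n+1]"
      using \<Phi>_M_conj by auto
    show ?thesis unfolding U_def eq by (rule prod_list_row_det) (rule cc c_sq M_conj_c)+
  qed
  have Z0: "Z 0 = \<theta>_all" by (simp add: Z_def)
  have 1: "y * \<theta>_all = \<theta>_all * y" if "\<And>b. y * \<theta> b = \<theta> b * y" for y
    by (rule prod_list_commute) (rule that)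
  have 2: "y * c_all = c_all * y" if "\<And>b. y * c b = c b * y" for y
    by (rule prod_list_commute) (rule that)
  have c\<theta>: "c_all * \<theta>_all = \<theta>_all * c_all"
    by (rule 1) (rule prod_list_commute[symmetric]; simp add: \<theta>c)
  have "row_det n M_conj * c_all * \<theta> b = \<theta> b * (row_det n M_conj * c_all)" for b
    unfolding U[symmetric] U_def by (rule prod_list_commute[symmetric]) (simp only: \<Phi>_\<theta>)
  then have "row_det n M_conj * c_all * \<theta>_all = \<theta>_all * (row_det n M_conj * c_all)" by (rule 1)
  then have "row_det n M_conj * (\<theta>_all * c_all) = \<theta>_all * (row_det n M_conj * c_all)"
    unfolding c\<theta>[symmetric] by (simp only: mult.assoc)
  then have "row_det k M_dual * row_det n M_conj * (\<theta>_all * c_all) = Z k * U k"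
    unfolding Z U by (simp only: mult.assoc)
  also have "\<dots> = \<theta>_all * D_all * c_all * X_all"
    unfolding Z_all[OF order_refl] Z0 U_0 by (simp only: mult.assoc)
  also have "\<theta>_all * D_all = D_all * \<theta>_all"
    by (rule prod_list_commute) (rule 1[symmetric]; simp add: D\<theta>)
  also have "D_all * \<theta>_all * c_all * X_all = D_all * (\<theta>_all * c_all * X_all)" by (simp only: mult.assoc)
  also have "\<theta>_all * c_all * X_all = X_all * (\<theta>_all * c_all)"
  proof (rule mult_commute)
    show "\<theta>_all * X_all = X_all * \<theta>_all" by (rule prod_list_commute) (rule 1[symmetric]; simp add: X\<theta>)
    show "c_all * X_all = X_all * c_all" by (rule prod_list_commute) (rule 2[symmetric]; simp add: Xc)
  qed
  finally show ?thesis by (simp only: mult.assoc)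
qed

section \<open>Conjugation by the product of the \<open>X a\<close>\<close>

abbreviation Xi_all where "Xi_all \<equiv> prod_list (map Xi [1..<k+1])"

lemma X_all_inverse: "X_all * Xi_all = 1" "Xi_all * X_all = 1"
proof -
  have *: "prod_list (map u l) * prod_list (map v l) = 1"
    if uv: "\<And>a. u a * v a = 1" and comm: "\<And>a b. v a * u b = u b * v a" for u v :: "nat \<Rightarrow> 'r" and l
  proof (induction l)
    case (Cons a l)
    have "u a * prod_list (map u l) * (v a * prod_list (map v l))
      = u a * (prod_list (map u l) * v a) * prod_list (map v l)" by (simp only: mult.assoc)
    also have "\<dots> = u a * v a * (prod_list (map u l) * prod_list (map v l))"
      by (simp only: prod_list_commute[of l "v a" u, OF comm, symmetric] mult.assoc)
    finally show ?case by (simp add: uv Cons)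
  qed simp
  show "X_all * Xi_all = 1" by (rule *) (simp_all add: X_inverse Xi_commute)
  show "Xi_all * X_all = 1" by (rule *) (simp_all add: X_inverse Xi_commute)
qed

lemma D_Xi: "D i * Xi a = Xi a * D i - Xi a * Xi a"
proof -
  have "Xi a * (D i * X a) * Xi a = Xi a * (X a * D i + 1) * Xi a" by (simp only: DX)
  then have "Xi a * D i = D i * Xi a + Xi a * Xi a"
    using X_inverse[of a] by (simp add: distrib_left distrib_right mult.assoc)
      (simp add: mult.assoc[symmetric])
  then show ?thesis by simp
qed

text \<open>Conjugating a derivation by a function subtracts the logarithmic derivative, which is
  exactly the surplus on the diagonal of \<open>M_conj\<close>.\<close>

lemma X_all_D: "X_all * D i * Xi_all = D i - (\<Sum>a\<in>{1..k}. Xi a)"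
proof -
  have *: "D i * prod_list (map Xi l) = prod_list (map Xi l) * (D i - sum_list (map Xi l))" for l
  proof (induction l)
    case (Cons a l)
    let ?P = "prod_list (map Xi l)"
    have "Xi a * ?P = ?P * Xi a" by (rule prod_list_commute) (simp add: Xi_commute)
    then have "Xi a * (Xi a * ?P) = Xi a * ?P * Xi a" by (metis mult.assoc)
    moreover have "D i * (Xi a * ?P) = Xi a * (D i * ?P) - Xi a * (Xi a * ?P)"
      using arg_cong[OF D_Xi[of i a], of "\<lambda>u. u * ?P"] by (simp add: left_diff_distrib mult.assoc)
    ultimately show ?case by (simp add: Cons right_diff_distrib distrib_left mult.assoc)
  qed simp
  have "X_all * D i * Xi_all = X_all * Xi_all * (D i - sum_list (map Xi [1..<k+1]))"
    using *[of "[1..<k+1]"] by (simp only: mult.assoc)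
  also have "sum_list (map Xi [1..<k+1]) = (\<Sum>a\<in>{1..k}. Xi a)"
    by (simp add: sum_list_distinct_conv_sum_set atLeastLessThanSuc_atLeastAtMost del: upt_Suc)
  finally show ?thesis by (simp only: X_all_inverse) simp
qed

lemma M_conj: "X_all * M_conj i j * Xi_all = M i j"
proof -
  have *: "X_all * (\<delta> a i * \<xi> a j * Xi a) * Xi_all = (if i = j then Xi a else 0) - \<xi> a j * \<delta> a i * Xi a" for a
  proof -
    have "\<delta> a i * \<xi> a j * Xi a * Xi_all = Xi_all * (\<delta> a i * \<xi> a j * Xi a)"
    proof (rule prod_list_commute)
      fix b show "\<delta> a i * \<xi> a j * Xi a * Xi b = Xi b * (\<delta> a i * \<xi> a j * Xi a)"
        by (rule mult_commute, rule mult_commute) (simp_all add: Xi_commute)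
    qed
    then have "X_all * (\<delta> a i * \<xi> a j * Xi a) * Xi_all = X_all * Xi_all * (\<delta> a i * \<xi> a j * Xi a)"
      by (simp only: mult.assoc)
    then show ?thesis unfolding X_all_inverse \<delta>\<xi> by (simp add: left_diff_distrib)
  qed
  have "X_all * M_conj i j * Xi_all = (if i = j then X_all * D i * Xi_all else 0)
     + (\<Sum>a\<in>{1..k}. X_all * (\<delta> a i * \<xi> a j * Xi a) * Xi_all)"
    unfolding M_conj_def by (simp add: distrib_left distrib_right sum_distrib_left sum_distrib_right mult.assoc del: upt_Suc)
  then show ?thesis unfolding X_all_D * M_def by (simp add: sum_subtractf)
qed

text \<open>The inserted \<open>Xi_all\<close> cancels the left half of the conjugation in
  \<open>M\<close>; the right half commutes with the auxiliary variables and cancels the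
  \<open>X_all\<close> of \<open>duality_conj\<close>.\<close>

theorem duality_identity:
  "row_det k M_dual * Xi_all * row_det n M * (\<theta>_all * c_all) = D_all * (\<theta>_all * c_all)"
proof -
  let ?w = "\<theta>_all * c_all"
  have M: "row_det n M = X_all * row_det n M_conj * Xi_all"
    using row_det_conj[of Xi_all X_all n M_conj] X_all_inverse unfolding M_conj by simp
  have w: "?w * Xi_all = Xi_all * ?w"
  proof (rule mult_commute)
    show "\<theta>_all * Xi_all = Xi_all * \<theta>_all"
      by (rule prod_list_commute) (rule prod_list_commute[symmetric]; simp add: Xi_commute)
    show "c_all * Xi_all = Xi_all * c_all"
      by (rule prod_list_commute) (rule prod_list_commute[symmetric]; simp add: Xi_commute)
  qed
  have "row_det k M_dual * Xi_all * row_det n M * ?w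
      = row_det k M_dual * (Xi_all * X_all) * row_det n M_conj * (Xi_all * ?w)"
    unfolding M by (simp only: mult.assoc)
  also have "\<dots> = row_det k M_dual * row_det n M_conj * ?w * Xi_all"
    unfolding X_all_inverse w[symmetric] by (simp add: mult.assoc del: upt_Suc)
  also have "\<dots> = D_all * X_all * (?w * Xi_all)" unfolding duality_conj by (simp only: mult.assoc)
  also have "\<dots> = D_all * (X_all * Xi_all) * ?w" unfolding w by (simp only: mult.assoc)
  finally show ?thesis unfolding X_all_inverse by simp
qed

end

section \<open>Symbols of differential operators\<close>

unbundle fps_syntax

text \<open>A bound instead of the exact \<open>fls_subdegree\<close>, whose value 0 at the zero
  series would force case distinctions; bounds also pass easily through sums and
  derivations.\<close>

definition vanishes_below :: "'a::zero fls \<Rightarrow> int \<Rightarrow> bool" where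
  "vanishes_below f a \<longleftrightarrow> (\<forall>n<a. f $$ n = 0)"

lemma vanishes_below_mono: "vanishes_below f a \<Longrightarrow> b \<le> a \<Longrightarrow> vanishes_below f b"
  by (auto simp: vanishes_below_def)

lemma vanishes_below_subdegree: "vanishes_below f (fls_subdegree f)"
  by (simp add: vanishes_below_def)

lemma vanishes_below_iff: "vanishes_below f a \<longleftrightarrow> f = 0 \<or> a \<le> fls_subdegree f"
  unfolding vanishes_below_def
  by (metis fls_eq0_below_subdegree fls_subdegree_geI fls_zero_nth less_le_trans)

lemma vanishes_below_mult:
  fixes f g :: "'a::{comm_ring_1, semiring_no_zero_divisors} fls"
  assumes "vanishes_below f a" "vanishes_below g b"
  shows "vanishes_below (f * g) (a + b)"
  unfolding vanishes_below_def
  using assms fls_times_nth_eq0[of _ f g] by (fastforce simp: vanishes_below_iff)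

lemma fls_mult_nth:
  fixes f g :: "'a::comm_ring_1 fls"
  assumes "vanishes_below f a" "vanishes_below g b"
  shows "(f * g) $$ n = (\<Sum>i=a..n - b. f $$ i * g $$ (n - i))"
proof (cases "f = 0 \<or> g = 0")
  case False
  then have "a \<le> fls_subdegree f" "b \<le> fls_subdegree g" using assms by (auto simp: vanishes_below_iff)
  then show ?thesis unfolding fls_times_nth(2)
    by (intro sum.mono_neutral_left) auto
qed auto

text \<open>For series in \<open>1/x\<close> this is the derivative with respect to \<open>x\<close>.\<close>
definition dX :: "'a::comm_ring_1 fls \<Rightarrow> 'a fls" where
  "dX f = - (fls_X\<^sup>2 * fls_deriv f)"

lemma dX_nth: "dX f $$ n = of_int (1 - n) * f $$ (n - 1)"
  by (simp add: dX_def fls_X_power_times_conv_shift algebra_simps)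

lemma dX_add: "dX (f + g) = dX f + dX g" and dX_mult: "dX (f * g) = dX f * g + f * dX g"
  by (simp_all add: dX_def algebra_simps)

lemma dX_zero [simp]: "dX 0 = 0" and dX_one [simp]: "dX 1 = 0" and dX_const [simp]: "dX (fls_const c) = 0"
  by (simp_all add: dX_def)

text \<open>The coefficients are series in 1/y, so on them \<open>dX\<close> is the derivative with
  respect to y.\<close>

definition dY :: "complex fls fls \<Rightarrow> complex fls fls" where
  "dY f = Abs_fls (\<lambda>n. dX (f $$ n))"

lemma dY_nth: "dY f $$ n = dX (f $$ n)"
  unfolding dY_def by (rule nth_Abs_fls_lower_bound[of "fls_subdegree f"]) simp

lemma dY_add: "dY (f + g) = dY f + dY g"
  by (simp add: fls_eq_iff dY_nth dX_add)

lemma dX_sum: "dX (sum f A) = (\<Sum>i\<in>A. dX (f i))"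
  by (induction A rule: infinite_finite_induct) (simp_all add: dX_add)

lemma dY_sum: "dY (sum f A) = (\<Sum>i\<in>A. dY (f i))"
  by (induction A rule: infinite_finite_induct) (simp_all add: dY_add fls_eq_iff dY_nth)

lemma vanishes_below_dX: "vanishes_below f a \<Longrightarrow> vanishes_below (dX f) (a + 1)"
  by (simp add: vanishes_below_def dX_nth)

lemma vanishes_below_dY: "vanishes_below f a \<Longrightarrow> vanishes_below (dY f) a"
  by (simp add: vanishes_below_def dY_nth)

lemma dY_mult: "dY (f * g) = dY f * g + f * dY g"
proof (rule fls_eqI)
  fix n
  let ?a = "fls_subdegree f" and ?b = "fls_subdegree g"
  note v = vanishes_below_subdegree[of f] vanishes_below_subdegree[of g]
  have "dY (f * g) $$ n = (\<Sum>i=?a..n - ?b. dX (f $$ i * g $$ (n - i)))"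
    by (simp add: dY_nth fls_mult_nth[OF v] dX_sum)
  also have "\<dots> = (dY f * g + f * dY g) $$ n"
    unfolding fls_plus_nth fls_mult_nth[OF vanishes_below_dY[OF v(1)] v(2)]
      fls_mult_nth[OF v(1) vanishes_below_dY[OF v(2)]]
    by (simp add: dX_mult sum.distrib dY_nth)
  finally show "dY (f * g) $$ n = (dY f * g + f * dY g) $$ n" .
qed

lemma dY_zero [simp]: "dY 0 = 0" and dY_one [simp]: "dY 1 = 0" by (auto simp: fls_eq_iff dY_nth)

lemma dX_dY: "dX (dY f) = dY (dX f)"
proof (rule fls_eqI)
  fix n
  have "dX (of_int z * g) = of_int z * dX g" for z :: int and g :: "complex fls"
    using dX_mult[of "of_int z" g] by (simp add: dX_def)
  then show "dX (dY f) $$ n = dY (dX f) $$ n" by (simp only: dX_nth[of _ n] dY_nth)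
qed

lemma funpow_derivation:
  fixes d :: "'a::comm_ring_1 \<Rightarrow> 'a"
  assumes add: "\<And>f g. d (f + g) = d f + d g" and mult: "\<And>f g. d (f * g) = d f * g + f * d g"
  shows "(d ^^ m) (f * g) = (\<Sum>r\<le>m. of_nat (m choose r) * ((d ^^ r) f * (d ^^ (m - r)) g))"
proof (induction m)
  case (Suc m)
  have zero: "d 0 = 0" using add[of 0 0] by simp
  have sum: "d (sum h A) = (\<Sum>i\<in>A. d (h i))" for h :: "nat \<Rightarrow> 'a" and A
    by (induction A rule: infinite_finite_induct) (simp_all add: add zero)
  have nat: "d (of_nat j * u) = of_nat j * d u" for j u
    by (induction j) (simp_all add: zero add algebra_simps)
  have nat': "d (of_nat j) = 0" for j using nat[of j 1] mult[of 1 1] by simp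
  let ?t = "\<lambda>r s. (d ^^ r) f * (d ^^ s) g"
  have "(d ^^ Suc m) (f * g) = (\<Sum>r\<le>m. of_nat (m choose r) * (?t (Suc r) (m - r) + ?t r (Suc (m - r))))"
    by (simp add: Suc sum nat' mult)
  also have "\<dots> = (\<Sum>r\<le>m. of_nat (m choose r) * ?t (Suc r) (m - r)) + (\<Sum>r\<le>m. of_nat (m choose r) * ?t r (Suc m - r))"
    by (simp add: distrib_left sum.distrib Suc_diff_le)
  also have "(\<Sum>r\<le>m. of_nat (m choose r) * ?t r (Suc m - r)) = (\<Sum>r\<le>Suc m. of_nat (m choose r) * ?t r (Suc m - r))"
    by (simp add: binomial_eq_0)
  also have "\<dots> = ?t 0 (Suc m) + (\<Sum>r\<le>m. of_nat (m choose Suc r) * ?t (Suc r) (m - r))"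
    by (subst sum.atMost_Suc_shift) simp
  finally show ?case
    by (subst sum.atMost_Suc_shift) (simp add: distrib_right sum.distrib add_ac binomial_eq_0)
qed simp

lemmas dX_funpow_mult = funpow_derivation[of dX, OF dX_add dX_mult]
lemmas dY_funpow_mult = funpow_derivation[of dY, OF dY_add dY_mult]

lemma dX_funpow_add: "(dX ^^ m) (f + g) = (dX ^^ m) f + (dX ^^ m) g"
  and dX_funpow_zero: "(dX ^^ m) 0 = 0"
  by (induction m) (simp_all add: dX_add)

lemma dY_funpow_add: "(dY ^^ m) (f + g) = (dY ^^ m) f + (dY ^^ m) g"
  and dY_funpow_zero: "(dY ^^ m) 0 = 0"
  by (induction m) (simp_all add: dY_add)

lemma dX_funpow_sum: "(dX ^^ m) (sum f A) = (\<Sum>i\<in>A. (dX ^^ m) (f i))"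
  by (induction m) (simp_all add: dX_sum)

lemma dY_funpow_sum: "(dY ^^ m) (sum f A) = (\<Sum>i\<in>A. (dY ^^ m) (f i))"
  by (induction m) (simp_all add: dY_sum)

lemma dX_dY_funpow: "(dX ^^ m) ((dY ^^ l) f) = (dY ^^ l) ((dX ^^ m) f)"
proof -
  have "dX ((dY ^^ l) f) = (dY ^^ l) (dX f)" for f by (induction l) (simp_all add: dX_dY)
  then show ?thesis by (induction m) simp_all
qed

lemma vanishes_below_dX_funpow: "vanishes_below f a \<Longrightarrow> vanishes_below ((dX ^^ m) f) (a + int m)"
proof (induction m)
  case (Suc m)
  then show ?case using vanishes_below_dX[OF Suc.IH[OF Suc.prems]] by (simp add: algebra_simps)
qed simp

lemma vanishes_below_dY_funpow: "vanishes_below f a \<Longrightarrow> vanishes_below ((dY ^^ m) f) a"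
  by (induction m) (simp_all add: vanishes_below_dY)

text \<open>Composition of symbols: \<open>f\<close> stands for the operator whose normal form, with all powers of
  \<open>y = d/dx\<close> on the right, is \<open>f(x, y)\<close>. The outer series variable is \<open>1/x\<close>, the inner one \<open>1/y\<close>.\<close>

definition star_term :: "nat \<Rightarrow> complex fls fls \<Rightarrow> complex fls fls \<Rightarrow> complex fls fls" where
  "star_term m f g = inverse (fact m) * ((dY ^^ m) f * (dX ^^ m) g)"

definition star_sum :: "nat \<Rightarrow> complex fls fls \<Rightarrow> complex fls fls \<Rightarrow> complex fls fls" where
  "star_sum M f g = (\<Sum>m\<le>M. star_term m f g)"

text \<open>Each \<open>dX\<close> raises the order in 1/x by one while \<open>dY\<close> does not
  lower it, so the order of term m is at least m plus the orders of both factors. Hence the infinite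
  sum can be cut off separately at each coefficient.\<close>

definition star :: "complex fls fls \<Rightarrow> complex fls fls \<Rightarrow> complex fls fls" where
  "star f g = Abs_fls (\<lambda>N. star_sum (nat (N - fls_subdegree f - fls_subdegree g)) f g $$ N)"

lemma vanishes_below_const: "vanishes_below (fls_const c) 0"
  by (simp add: vanishes_below_def)

lemma inverse_fact_fls: "inverse (fact m) = (fls_const (inverse (fact m)) :: 'a::field_char_0 fls)"
proof -
  have "(fact m :: 'a fls) = fls_const (fact m)" by (metis fls_of_nat of_nat_fact)
  then have "fls_const (inverse (fact m)) * (fact m :: 'a fls) = 1" by simp
  then show ?thesis by (simp add: field_simps)
qed

lemma fls_sum_nth: "sum f A $$ N = (\<Sum>i\<in>A. f i $$ N)" for f :: "'i \<Rightarrow> 'a::comm_monoid_add fls"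
  by (induction A rule: infinite_finite_induct) simp_all

lemma vanishes_below_star_term:
  assumes "vanishes_below f a" "vanishes_below g b"
  shows "vanishes_below (star_term m f g) (a + b + int m)"
  using vanishes_below_mult[OF vanishes_below_const
      vanishes_below_mult[OF vanishes_below_dY_funpow[OF assms(1)] vanishes_below_dX_funpow[OF assms(2)]]]
  unfolding star_term_def inverse_fact_fls by (simp only: add.assoc add_0_left)

lemma star_sum_nth:
  assumes "vanishes_below f a" "vanishes_below g b" "N \<le> a + b + int M" "M \<le> M'"
  shows "star_sum M f g $$ N = star_sum M' f g $$ N"
proof -
  have "star_sum M' f g $$ N = (\<Sum>m\<le>M'. star_term m f g $$ N)" by (simp add: star_sum_def fls_sum_nth)
  also have "\<dots> = (\<Sum>m\<le>M. star_term m f g $$ N)"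
    using vanishes_below_star_term[OF assms(1,2)] assms(3,4)
    by (intro sum.mono_neutral_right) (auto simp: vanishes_below_def)
  finally show ?thesis by (simp add: star_sum_def fls_sum_nth)
qed

lemma star_nth:
  assumes "vanishes_below f a" "vanishes_below g b" "N \<le> a + b + int M"
  shows "star f g $$ N = star_sum M f g $$ N"
proof -
  let ?a = "fls_subdegree f" and ?b = "fls_subdegree g"
  note v = vanishes_below_subdegree[of f] vanishes_below_subdegree[of g]
  let ?M = "\<lambda>N. nat (N - ?a - ?b)"
  have "star_sum (?M N) f g $$ N = 0" if "N < ?a + ?b" for N
    using vanishes_below_star_term[OF v] that by (simp add: star_sum_def fls_sum_nth vanishes_below_def)
  then have "star f g $$ N = star_sum (?M N) f g $$ N"
    unfolding star_def by (intro nth_Abs_fls_lower_bound[of "?a + ?b"]) simp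
  also have "\<dots> = star_sum (max (?M N) M) f g $$ N"
    by (rule star_sum_nth[OF v]) auto
  also have "\<dots> = star_sum M f g $$ N" using star_sum_nth[OF assms, of "max (?M N) M"] by simp
  finally show ?thesis .
qed

lemma star_diff:
  assumes "vanishes_below f a" "vanishes_below g b"
  shows "vanishes_below (star f g - star_sum M f g) (a + b + int M)"
    and "vanishes_below (star f g) (a + b)"
  using star_nth[OF assms, of _ M] star_nth[OF assms, of _ 0] vanishes_below_star_term[OF assms, of 0]
  by (auto simp: vanishes_below_def star_sum_def)

lemma star_sum_add:
  "star_sum M (f + f') g = star_sum M f g + star_sum M f' g"
  "star_sum M f (g + g') = star_sum M f g + star_sum M f g'"
  by (simp_all add: star_sum_def star_term_def dX_funpow_add dY_funpow_add algebra_simps sum.distrib)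

lemma star_add:
  "star (f + f') g = star f g + star f' g" "star f (g + g') = star f g + star f g'"
proof -
  define a where "a = Min {fls_subdegree f, fls_subdegree f', fls_subdegree g, fls_subdegree g'}"
  have v: "vanishes_below f a" "vanishes_below f' a" "vanishes_below g a" "vanishes_below g' a"
    by (auto intro: vanishes_below_mono[OF vanishes_below_subdegree] simp: a_def)
  then have v': "vanishes_below (f + f') a" "vanishes_below (g + g') a"
    by (simp_all add: vanishes_below_def)
  note v = v v'
  show "star (f + f') g = star f g + star f' g"
  proof (rule fls_eqI)
    fix N
    have "N \<le> a + a + int (nat (N - a - a))" by simp
    then show "star (f + f') g $$ N = (star f g + star f' g) $$ N"
      by (simp only: fls_plus_nth star_sum_add star_nth[OF v(5) v(3)] star_nth[OF v(1) v(3)] star_nth[OF v(2) v(3)])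
  qed
  show "star f (g + g') = star f g + star f g'"
  proof (rule fls_eqI)
    fix N
    have "N \<le> a + a + int (nat (N - a - a))" by simp
    then show "star f (g + g') $$ N = (star f g + star f g') $$ N"
      by (simp only: fls_plus_nth star_sum_add star_nth[OF v(1) v(6)] star_nth[OF v(1) v(3)] star_nth[OF v(1) v(4)])
  qed
qed

lemma star_sum_y_free: "dY f = 0 \<Longrightarrow> star_sum M f g = f * g"
proof -
  assume "dY f = 0"
  then have "(dY ^^ m) f = 0" if "m > 0" for m
    using that by (cases m) (simp_all add: funpow_Suc_right dY_funpow_zero del: funpow.simps)
  then have "star_sum M f g = (\<Sum>m\<le>M. if m = 0 then f * g else 0)"
    unfolding star_sum_def by (intro sum.cong) (auto simp: star_term_def)
  then show ?thesis by simp
qed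

lemma star_sum_x_free: "dX g = 0 \<Longrightarrow> star_sum M f g = f * g"
proof -
  assume "dX g = 0"
  then have "(dX ^^ m) g = 0" if "m > 0" for m
    using that by (cases m) (simp_all add: funpow_Suc_right dX_funpow_zero del: funpow.simps)
  then have "star_sum M f g = (\<Sum>m\<le>M. if m = 0 then f * g else 0)"
    unfolding star_sum_def by (intro sum.cong) (auto simp: star_term_def)
  then show ?thesis by simp
qed

lemma star_eqI:
  assumes "\<And>M. star_sum (Suc M) f g = h"
  shows "star f g = h"
proof (rule fls_eqI)
  fix N
  have "N \<le> fls_subdegree f + fls_subdegree g + int (Suc (nat (N - fls_subdegree f - fls_subdegree g)))" by simp
  then show "star f g $$ N = h $$ N"
    by (subst star_nth[OF vanishes_below_subdegree vanishes_below_subdegree]) (assumption, simp only: assms)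
qed

lemma star_y_free: "dY f = 0 \<Longrightarrow> star f g = f * g" and star_x_free: "dX g = 0 \<Longrightarrow> star f g = f * g"
  by (rule star_eqI, simp only: star_sum_y_free star_sum_x_free)+

lemma star_y_linear: "dY f = 1 \<Longrightarrow> star f g = f * g + dX g"
proof (rule star_eqI)
  fix M
  assume 1: "dY f = 1"
  then have "(dY ^^ Suc (Suc m)) f = 0" for m
    by (simp add: funpow_Suc_right dY_funpow_zero del: funpow.simps)
  then have "star_sum (Suc M) f g = (\<Sum>m\<le>Suc M. if m = 0 then f * g else if m = 1 then dX g else 0)"
    unfolding star_sum_def
  proof (intro sum.cong refl)
    fix m assume z: "\<And>m. (dY ^^ Suc (Suc m)) f = 0"
    consider "m = 0" | "m = 1" | m' where "m = Suc (Suc m')" by (metis One_nat_def not0_implies_Suc)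
    then show "star_term m f g = (if m = 0 then f * g else if m = 1 then dX g else 0)"
    proof cases
      case 3 then show ?thesis using z[of m'] unfolding star_term_def by (simp del: funpow.simps)
    qed (simp_all add: star_term_def 1)
  qed
  also have "\<dots> = f * g + dX g" by (subst sum.atMost_Suc_shift) (simp add: sum.delta)
  finally show "star_sum (Suc M) f g = f * g + dX g" .
qed

text \<open>A term of a triple composition: r, b and c count the derivatives passed from f to h,
  from f to g and from g to h.\<close>

definition star3 where
  "star3 f g h = (\<lambda>(r, b, c). inverse (fact r * fact b * fact c)
     * ((dY ^^ (r + b)) f * ((dX ^^ b) ((dY ^^ c) g) * (dX ^^ (r + c)) h)))"

lemma binomial_inverse_fact:
  "r \<le> m \<Longrightarrow> inverse (fact m) * of_nat (m choose r) = (inverse (fact r * fact (m - r)) :: 'a::field_char_0)"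
  by (simp add: binomial_fact field_simps)

lemma dX_inverse_fact: "(dX ^^ m) (inverse (fact l) * f) = inverse (fact l) * (dX ^^ m) f" for f :: "complex fls fls"
proof -
  have "dX (inverse (fact l) * f) = inverse (fact l) * dX f" for f :: "complex fls fls"
    unfolding inverse_fact_fls by (simp add: dX_mult)
  then show ?thesis by (induction m) simp_all
qed

lemma dY_inverse_fact: "(dY ^^ m) (inverse (fact l) * f) = inverse (fact l) * (dY ^^ m) f" for f :: "complex fls fls"
proof -
  have "dY (fls_const (fls_const c)) = 0" for c :: complex by (auto simp: fls_eq_iff dY_nth)
  then have "dY (inverse (fact l) * f) = inverse (fact l) * dY f" for f :: "complex fls fls"
    unfolding inverse_fact_fls by (simp add: dY_mult)
  then show ?thesis by (induction m) simp_all
qed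

lemma sum_triangle: "(\<Sum>m\<le>M. \<Sum>r\<le>m. t r (m - r)) = (\<Sum>(r, c) | r + c \<le> M. t r c)"
  for t :: "nat \<Rightarrow> nat \<Rightarrow> 'a::comm_monoid_add"
proof -
  have "(\<Sum>m\<le>M. \<Sum>r\<le>m. t r (m - r)) = (\<Sum>(m, r)\<in>Sigma {..M} (\<lambda>m. {..m}). t r (m - r))"
    by (subst sum.Sigma) auto
  also have "\<dots> = (\<Sum>(r, c) | r + c \<le> M. t r c)"
    by (rule sum.reindex_bij_witness[of _ "\<lambda>(r, c). (r + c, r)" "\<lambda>(m, r). (r, m - r)"]) auto
  finally show ?thesis .
qed

text \<open>The Leibniz rule distributes the m derivatives in y, and \<open>1 / m!\<close> combines
  with the binomial coefficient to factorials of \<open>star3\<close>. Only the truncation region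
  distinguishes the result from \<open>star_sum_right\<close>.\<close>

lemma star_sum_left:
  "star_sum M (star_sum M f g) h = sum (star3 f g h) {(r, b, c). r + c \<le> M \<and> b \<le> M}"
proof -
  have "star_sum M (star_sum M f g) h
     = (\<Sum>m\<le>M. \<Sum>b\<le>M. \<Sum>r\<le>m. star3 f g h (r, b, m - r))"
    unfolding star_sum_def star_term_def dY_funpow_sum dY_inverse_fact
    unfolding dY_funpow_mult sum_distrib_left sum_distrib_right
  proof (intro sum.cong refl)
    fix m b r :: nat assume "r \<in> {..m}"
    then have *: "inverse (fact m) * of_nat (m choose r) = (inverse (fact r * fact (m - r)) :: complex fls fls)"
      by (intro binomial_inverse_fact) simp
    have eq: "inverse (fact m) * (inverse (fact b) * (of_nat (m choose r) * ((dY ^^ r) ((dY ^^ b) f) * (dY ^^ (m - r)) ((dX ^^ b) g))) * (dX ^^ m) h)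
      = (inverse (fact m) * of_nat (m choose r)) * inverse (fact b) * ((dY ^^ r) ((dY ^^ b) f) * ((dY ^^ (m - r)) ((dX ^^ b) g) * (dX ^^ m) h))"
      (is "?l = _")
      by (simp only: mult_ac)
    show "?l
      = star3 f g h (r, b, m - r)"
    proof -
      have "(dY ^^ (r + b)) f = (dY ^^ r) ((dY ^^ b) f)" "r + (m - r) = m"
        using \<open>r \<in> {..m}\<close> by (simp_all add: funpow_add)
      then show ?thesis unfolding eq * star3_def prod.case dX_dY_funpow
        by (simp only: inverse_mult_distrib mult_ac)
    qed
  qed
  also have "\<dots> = (\<Sum>b\<le>M. \<Sum>(r, c) | r + c \<le> M. star3 f g h (r, b, c))"
    by (subst sum_triangle[symmetric]) (rule sum.swap)
  also have "\<dots> = (\<Sum>(b, r, c)\<in>{..M} \<times> {(r, c). r + c \<le> M}. star3 f g h (r, b, c))"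
    by (subst sum.cartesian_product) (simp add: case_prod_unfold)
  also have "\<dots> = sum (star3 f g h) {(r, b, c). r + c \<le> M \<and> b \<le> M}"
    by (rule sum.reindex_bij_witness[of _ "\<lambda>(r, b, c). (b, r, c)" "\<lambda>(b, r, c). (r, b, c)"]) auto
  finally show ?thesis .
qed

lemma star_sum_right:
  "star_sum M f (star_sum M g h) = sum (star3 f g h) {(r, b, c). r + b \<le> M \<and> c \<le> M}"
proof -
  have "star_sum M f (star_sum M g h)
     = (\<Sum>m\<le>M. \<Sum>c\<le>M. \<Sum>b\<le>m. star3 f g h (m - b, b, c))"
    unfolding star_sum_def star_term_def dX_funpow_sum dX_inverse_fact
    unfolding dX_funpow_mult sum_distrib_left sum_distrib_right
  proof (intro sum.cong refl)
    fix m c b :: nat assume "b \<in> {..m}"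
    then have *: "inverse (fact m) * of_nat (m choose b) = (inverse (fact b * fact (m - b)) :: complex fls fls)"
      by (intro binomial_inverse_fact) simp
    have eq: "inverse (fact m) * ((dY ^^ m) f * (inverse (fact c) * (of_nat (m choose b) * ((dX ^^ b) ((dY ^^ c) g) * (dX ^^ (m - b)) ((dX ^^ c) h)))))
      = (inverse (fact m) * of_nat (m choose b)) * inverse (fact c) * ((dY ^^ m) f * ((dX ^^ b) ((dY ^^ c) g) * (dX ^^ (m - b)) ((dX ^^ c) h)))"
      (is "?l = _")
      by (simp only: mult_ac)
    show "?l
      = star3 f g h (m - b, b, c)"
    proof -
      have "(dX ^^ (m - b + c)) h = (dX ^^ (m - b)) ((dX ^^ c) h)" "m - b + b = m"
        using \<open>b \<in> {..m}\<close> by (simp_all only: funpow_add comp_apply) simp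
      then show ?thesis unfolding eq * star3_def prod.case by (simp only: inverse_mult_distrib mult_ac)
    qed
  qed
  also have "\<dots> = (\<Sum>c\<le>M. \<Sum>(b, r) | b + r \<le> M. star3 f g h (r, b, c))"
    by (subst sum_triangle[symmetric]) (rule sum.swap)
  also have "\<dots> = (\<Sum>(c, b, r)\<in>{..M} \<times> {(b, r). b + r \<le> M}. star3 f g h (r, b, c))"
    by (subst sum.cartesian_product) (simp add: case_prod_unfold)
  also have "\<dots> = sum (star3 f g h) {(r, b, c). r + b \<le> M \<and> c \<le> M}"
    by (rule sum.reindex_bij_witness[of _ "\<lambda>(r, b, c). (c, b, r)" "\<lambda>(c, b, r). (r, b, c)"]) auto
  finally show ?thesis .
qed

text \<open>Both nested truncations contain all terms with r + u + v \<le> M, and their other terms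
  vanish at the coefficient \<open>N\<close>.\<close>

lemma star_assoc: "star (star f g) h = star f (star g h)"
proof (rule fls_eqI)
  fix N
  define a b c where "a = fls_subdegree f" and "b = fls_subdegree g" and "c = fls_subdegree h"
  have f: "vanishes_below f a" and g: "vanishes_below g b" and h: "vanishes_below h c"
    by (simp_all add: a_def b_def c_def vanishes_below_subdegree)
  \<comment> \<open>The extra \<open>Suc\<close> makes the inequality for \<open>N\<close> strict,
    so that the remainders from \<open>star_diff\<close> vanish at \<open>N\<close>.\<close>
  define M where "M = Suc (nat (N - a - b - c))"
  have N: "N < a + b + c + int M" by (simp add: M_def)
  have van: "star3 f g h (r, u, v) $$ N = 0" if "r + u + v > M" for r u v
  proof -
    have "vanishes_below (star3 f g h (r, u, v)) (0 + (a + ((b + int u) + (c + int (r + v)))))"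
      unfolding star3_def prod.case inverse_mult_distrib
      using f g h by (intro vanishes_below_mult vanishes_below_dY_funpow vanishes_below_dX_funpow)
        (auto simp: inverse_fact_fls fls_const_mult_const vanishes_below_const)
    then show ?thesis using that N by (simp add: vanishes_below_def)
  qed
  have fin: "finite {(r, u, v). r + v \<le> M \<and> u \<le> M}" "finite {(r, u, v). r + u \<le> M \<and> v \<le> M}"
    by (rule finite_subset[of _ "{..M} \<times> {..M} \<times> {..M}"], force, simp)+
  have "star (star f g) h $$ N = star_sum M (star f g) h $$ N"
    by (rule star_nth[OF star_diff(2)[OF f g] h]) (use N in simp)
  also have "\<dots> = star_sum M (star_sum M f g) h $$ N + star_sum M (star f g - star_sum M f g) h $$ N"
    using star_sum_add(1)[of M "star_sum M f g" "star f g - star_sum M f g" h] by (simp flip: fls_plus_nth)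
  also have "star_sum M (star f g - star_sum M f g) h $$ N = 0"
    using vanishes_below_star_term[OF star_diff(1)[OF f g, of M] h] N
    by (auto simp: star_sum_def fls_sum_nth vanishes_below_def intro!: sum.neutral)
  also have "star_sum M (star_sum M f g) h $$ N = (\<Sum>t\<in>{(r, u, v). r + v \<le> M \<and> u \<le> M}. star3 f g h t $$ N)"
    by (simp add: star_sum_left fls_sum_nth)
  also have "\<dots> = (\<Sum>t\<in>{(r, u, v). r + u + v \<le> M}. star3 f g h t $$ N)"
    using fin by (intro sum.mono_neutral_right) (auto, meson van not_le_imp_less)
  also have "\<dots> = (\<Sum>t\<in>{(r, u, v). r + u \<le> M \<and> v \<le> M}. star3 f g h t $$ N)"
    using fin by (intro sum.mono_neutral_left) (auto, meson van not_le_imp_less)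
  also have "\<dots> = star_sum M f (star_sum M g h) $$ N" by (simp add: star_sum_right fls_sum_nth)
  also have "\<dots> + 0 = star_sum M f (star_sum M g h) $$ N + star_sum M f (star g h - star_sum M g h) $$ N"
    using vanishes_below_star_term[OF f star_diff(1)[OF g h, of M]] N
    by (auto simp: star_sum_def fls_sum_nth vanishes_below_def intro!: sum.neutral)
  also have "\<dots> = star_sum M f (star g h) $$ N"
    using star_sum_add(2)[of M f "star_sum M g h" "star g h - star_sum M g h"] by (simp flip: fls_plus_nth)
  also have "\<dots> = star f (star g h) $$ N"
    by (rule star_nth[OF f star_diff(2)[OF g h], symmetric]) (use N in simp)
  finally show "star (star f g) h $$ N = star f (star g h) $$ N" .
qed

section \<open>The ring of symbols\<close>

typedef symbol = "UNIV :: complex fls fls set" by simp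

setup_lifting type_definition_symbol

text \<open>The separate type is due to \<open>complex fls fls\<close> already carrying the
  commutative product.\<close>

instantiation symbol :: ring_1
begin
lift_definition zero_symbol :: symbol is 0 .
lift_definition one_symbol :: symbol is 1 .
lift_definition plus_symbol :: "symbol \<Rightarrow> symbol \<Rightarrow> symbol" is "(+)" .
lift_definition minus_symbol :: "symbol \<Rightarrow> symbol \<Rightarrow> symbol" is "(-)" .
lift_definition uminus_symbol :: "symbol \<Rightarrow> symbol" is uminus .
lift_definition times_symbol :: "symbol \<Rightarrow> symbol \<Rightarrow> symbol" is star .
instance
  by standard (transfer; simp add: star_assoc star_add star_y_free star_x_free)+
end

text \<open>\<open>sc f i j\<close> is the coefficient of \<open>x ^ i * y ^ j\<close>.\<close>
lift_definition sc :: "symbol \<Rightarrow> int \<Rightarrow> int \<Rightarrow> complex" is "\<lambda>f i j. f $$ (- i) $$ (- j)" .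

lemma symbol_eqI: "(\<And>i j. sc f i j = sc g i j) \<Longrightarrow> f = g"
proof (transfer, intro fls_eqI)
  fix f g :: "complex fls fls" and m n assume "\<And>i j. f $$ - i $$ - j = g $$ - i $$ - j"
  from this[of "- m" "- n"] show "f $$ m $$ n = g $$ m $$ n" by simp
qed

lemma sc_add [simp]: "sc (f + g) i j = sc f i j + sc g i j"
  and sc_diff [simp]: "sc (f - g) i j = sc f i j - sc g i j"
  and sc_uminus [simp]: "sc (- f) i j = - sc f i j"
  and sc_zero [simp]: "sc 0 i j = 0"
  and sc_one: "sc 1 i j = (if i = 0 \<and> j = 0 then 1 else 0)"
  by (transfer; simp)+

lemma sc_sum: "sc (sum f A) i j = (\<Sum>a\<in>A. sc (f a) i j)"
  by (induction A rule: infinite_finite_induct) simp_all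

lemma symbol_two_torsion_free: "f + f = 0 \<Longrightarrow> f = 0" for f :: symbol
proof (rule symbol_eqI)
  fix i j assume "f + f = 0"
  then have "sc (f + f) i j = 0" by simp
  then show "sc f i j = sc 0 i j" by simp
qed

text \<open>\<open>fls_X_inv\<close> is x at the outer level and y below \<open>fls_const\<close>.
  Ordinary inverses serve, since composition is the ordinary product as soon as the left factor is
  free of y or the right factor free of x.\<close>

lift_definition sX :: "complex \<Rightarrow> symbol" is "\<lambda>z. fls_X_inv - fls_const (fls_const z)" .
lift_definition sXi :: "complex \<Rightarrow> symbol" is "\<lambda>z. inverse (fls_X_inv - fls_const (fls_const z))" .
lift_definition sD :: "complex \<Rightarrow> symbol" is "\<lambda>\<alpha>. fls_const (fls_X_inv - fls_const \<alpha>)" .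
lift_definition sDi :: "complex \<Rightarrow> symbol" is "\<lambda>\<alpha>. fls_const (inverse (fls_X_inv - fls_const \<alpha>))" .

lemma X_inv_neq: "fls_X_inv - fls_const c \<noteq> (0 :: 'a::field fls)"
proof
  assume "fls_X_inv - fls_const c = (0 :: 'a fls)"
  then have "(fls_X_inv - fls_const c) $$ (-1) = (0 :: 'a)" by simp
  then show False by simp
qed

lemma dY_const: "dY (fls_const c) = fls_const (dX c)"
  by (auto simp: fls_eq_iff dY_nth)

lemma dY_X_inv: "dY (fls_X_inv - fls_const (fls_const z)) = 0"
proof (rule fls_eqI)
  fix n
  have "(fls_X_inv - fls_const (fls_const z)) $$ n = (fls_const ((if n = -1 then 1 else 0) - (if n = 0 then z else 0)) :: complex fls)"
    by (auto simp: fls_eq_iff)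
  then show "dY (fls_X_inv - fls_const (fls_const z)) $$ n = 0 $$ n" by (simp add: dY_nth)
qed

lemma dX_X_inv: "dX (fls_X_inv - fls_const c) = (1 :: 'a::comm_ring_1 fls)"
  by (rule fls_eqI) (auto simp: dX_nth)

lemma dY_inverse:
  assumes "dY f = 0" "f \<noteq> 0" shows "dY (inverse f) = 0"
proof -
  have "f * dY (inverse f) = dY (f * inverse f)" by (simp only: dY_mult assms) simp
  also have "f * inverse f = 1" using assms by (simp only: right_inverse not_False_eq_True)
  finally have "f * dY (inverse f) = 0" by simp
  then show ?thesis using assms(2) mult_eq_0_iff by blast
qed

lemma sX_inverse: "sXi z * sX z = 1" "sX z * sXi z = 1"
  by (transfer, simp only: star_y_free[OF dY_inverse[OF dY_X_inv X_inv_neq]] left_inverse[OF X_inv_neq])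
    (transfer, simp only: star_y_free[OF dY_X_inv] right_inverse[OF X_inv_neq])

lemma sD_inverse: "sDi \<alpha> * sD \<alpha> = 1" "sD \<alpha> * sDi \<alpha> = 1"
  by (transfer, simp only: star_x_free[OF dX_const] fls_const_mult_const left_inverse[OF X_inv_neq] fls_const_1)
    (transfer, simp only: star_x_free[OF dX_const] fls_const_mult_const right_inverse[OF X_inv_neq] fls_const_1)

lemma sX_commute: "sX z * sX w = sX w * sX z"
  by transfer (simp only: star_y_free dY_X_inv mult.commute)

lemma sD_commute: "sD a * sD b = sD b * sD a"
  by transfer (simp only: star_x_free dX_const mult.commute)

lemma sD_sX: "sD \<alpha> * sX z = sX z * sD \<alpha> + 1"
proof transfer
  fix \<alpha> z :: complex
  have "dY (fls_const (fls_X_inv - fls_const \<alpha>)) = 1" unfolding dY_const dX_X_inv by simp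
  then show "star (fls_const (fls_X_inv - fls_const \<alpha>)) (fls_X_inv - fls_const (fls_const z)) =
    star (fls_X_inv - fls_const (fls_const z)) (fls_const (fls_X_inv - fls_const \<alpha>)) + 1"
    by (simp only: star_y_linear star_y_free dY_X_inv dX_X_inv mult.commute)
qed

lemma sc_sX: "sc (sX z * f) i j = sc f (i - 1) j - z * sc f i j"
  by transfer (simp add: star_y_free dY_X_inv left_diff_distrib fls_X_inv_times_conv_shift)

lemma sc_sD: "sc (sD \<alpha> * f) i j = sc f i (j - 1) - \<alpha> * sc f i j + of_int (i + 1) * sc f (i + 1) j"
proof transfer
  fix \<alpha> :: complex and f :: "complex fls fls" and i j
  have "dY (fls_const (fls_X_inv - fls_const \<alpha>)) = 1" unfolding dY_const dX_X_inv by simp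
  then have "star (fls_const (fls_X_inv - fls_const \<alpha>)) f $$ - i $$ - j
    = (fls_X_inv * f $$ (-i) - fls_const \<alpha> * f $$ (-i)) $$ (- j) + dX f $$ (- i) $$ (- j)"
    by (simp add: star_y_linear left_diff_distrib)
  also have "dX f $$ (- i) $$ (- j) = of_int (i + 1) * f $$ (- (i + 1)) $$ (- j)"
  proof -
    have "- i - 1 = - (i + 1)" by simp
    then show ?thesis by (simp only: dX_nth fls_of_int) simp
  qed
  finally show "star (fls_const (fls_X_inv - fls_const \<alpha>)) f $$ - i $$ - j
    = f $$ - i $$ - (j - 1) - \<alpha> * f $$ - i $$ - j + of_int (i + 1) * f $$ - (i + 1) $$ - j"
    by (simp add: fls_X_inv_times_conv_shift)
qed

section \<open>Coefficients of a composition\<close>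

definition bounded_by :: "(int \<Rightarrow> int \<Rightarrow> complex) \<Rightarrow> int \<Rightarrow> int \<Rightarrow> bool" where
  "bounded_by \<phi> K L \<longleftrightarrow> (\<forall>i j. i > K \<or> j > L \<longrightarrow> \<phi> i j = 0)"

lemma dX_funpow_nth: "(dX ^^ m) f $$ n = pochhammer (of_int (1 - n)) m * f $$ (n - int m)"
proof (induction m arbitrary: n)
  case (Suc m)
  have "1 - (n - 1) = (1 - n) + 1" by simp
  then show ?case by (simp add: dX_nth Suc pochhammer_rec algebra_simps)
qed simp

lemma dY_funpow_nth: "(dY ^^ m) f $$ n = (dX ^^ m) (f $$ n)"
  by (induction m) (simp_all add: dY_nth)

lemma pochhammer_fls_const: "pochhammer (fls_const c) m = fls_const (pochhammer c m)"
  by (induction m) (simp_all add: pochhammer_Suc fls_of_nat fls_plus_const)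

text \<open>The Pochhammer symbols come from m-fold differentiation: the coefficient of x^i in the
  m-th x-derivative is \<open>pochhammer (i + 1) m\<close> times that of x^(i + m), and likewise in
  y.\<close>

definition star_coeff :: "nat \<Rightarrow> int \<Rightarrow> int \<Rightarrow> complex" where
  "star_coeff m i j = inverse (fact m) * pochhammer (of_int (i + 1)) m * pochhammer (of_int (j + 1)) m"

lemma star_coeff_0 [simp]: "star_coeff 0 i j = 1" by (simp add: star_coeff_def)

text \<open>Upper bounds on all exponents make both Cauchy products finite; m stops where the
  exponents of x in \<open>g\<close> would exceed \<open>K'\<close>.\<close>

lemma sc_mult:
  assumes "bounded_by (sc f) K L" "bounded_by (sc g) K' L'"
  shows "sc (f * g) I J = (\<Sum>m\<le>nat (K + K' - I). \<Sum>a=I - K'..K. \<Sum>b=J - L'..L.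
     star_coeff m (I - a) b * sc f a (b + int m) * sc g (I - a + int m) (J - b))"
  using assms
proof transfer
  fix f g :: "complex fls fls" and K L K' L' I J
  assume bf: "bounded_by (\<lambda>i j. f $$ - i $$ - j) K L" and bg: "bounded_by (\<lambda>i j. g $$ - i $$ - j) K' L'"
  have inner: "vanishes_below (h $$ a) (- L)" if "bounded_by (\<lambda>i j. h $$ - i $$ - j) K L" for h :: "complex fls fls" and K L a
    unfolding vanishes_below_def
  proof (intro allI impI)
    fix n assume "n < - L"
    then show "h $$ a $$ n = 0" using that[unfolded bounded_by_def, rule_format, of "- a" "- n"] by simp
  qed
  have outer: "vanishes_below h (- K)" if "bounded_by (\<lambda>i j. h $$ - i $$ - j) K L" for h :: "complex fls fls" and K L
    unfolding vanishes_below_def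
  proof (intro allI impI fls_eqI)
    fix n m assume "n < - K"
    then show "h $$ n $$ m = 0 $$ m" using that[unfolded bounded_by_def, rule_format, of "- n" "- m"] by simp
  qed
  have const: "(u * (fls_const c * v)) $$ n = c * ((u * v) $$ n)" for u v :: "complex fls" and c n
    by (simp add: mult.left_commute[of u])
  let ?M = "nat (K + K' - I)"
  have "star f g $$ (- I) = star_sum ?M f g $$ (- I)"
    by (rule star_nth[OF outer[OF bf] outer[OF bg]]) simp
  also have "\<dots> $$ (- J) = (\<Sum>m\<le>?M. inverse (fact m) * (((dY ^^ m) f * (dX ^^ m) g) $$ (- I) $$ (- J)))"
    by (simp add: star_sum_def star_term_def fls_sum_nth inverse_fact_fls)
  also have "\<dots> = (\<Sum>m\<le>?M. \<Sum>a=I - K'..K. \<Sum>b=J - L'..L.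
      star_coeff m (I - a) b * f $$ - a $$ - (b + int m) * g $$ - (I - a + int m) $$ - (J - b))"
  proof (rule sum.cong[OF refl])
    fix m
    have "((dY ^^ m) f * (dX ^^ m) g) $$ (- I) = (\<Sum>i=- K..- I - (- K'). (dY ^^ m) f $$ i * (dX ^^ m) g $$ (- I - i))"
      by (rule fls_mult_nth[OF vanishes_below_dY_funpow[OF outer[OF bf]]
          vanishes_below_mono[OF vanishes_below_dX_funpow[OF outer[OF bg]]]]) simp
    also have "\<dots> = (\<Sum>i=- K..- I - (- K'). (dX ^^ m) (f $$ i) * (fls_const (pochhammer (of_int (I - (- i) + 1)) m) * g $$ - (I - (- i) + int m)))"
    proof (rule sum.cong[OF refl])
      fix i
      have "- I - i - int m = - (I - (- i) + int m)" "1 - (- I - i) = I - (- i) + 1" by simp_all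
      then show "(dY ^^ m) f $$ i * (dX ^^ m) g $$ (- I - i)
        = (dX ^^ m) (f $$ i) * (fls_const (pochhammer (of_int (I - (- i) + 1)) m) * g $$ - (I - (- i) + int m))"
        by (simp only: dY_funpow_nth dX_funpow_nth fls_of_int pochhammer_fls_const)
    qed
    also have "\<dots> = (\<Sum>a=I - K'..K. (dX ^^ m) (f $$ - a) * (fls_const (pochhammer (of_int (I - a + 1)) m) * g $$ - (I - a + int m)))"
      by (rule sum.reindex_bij_witness[of _ uminus uminus])
        auto
    finally have "((dY ^^ m) f * (dX ^^ m) g) $$ (- I) $$ (- J)
      = (\<Sum>a=I - K'..K. pochhammer (of_int (I - a + 1)) m * (((dX ^^ m) (f $$ - a) * g $$ - (I - a + int m)) $$ (- J)))"
      by (simp add: fls_sum_nth const)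
    also have "\<dots> = (\<Sum>a=I - K'..K. \<Sum>b=J - L'..L. pochhammer (of_int (I - a + 1)) m *
        (pochhammer (of_int (b + 1)) m * f $$ - a $$ - (b + int m) * g $$ - (I - a + int m) $$ - (J - b)))"
    proof (rule sum.cong[OF refl])
      fix a
      have "((dX ^^ m) (f $$ - a) * g $$ - (I - a + int m)) $$ (- J)
        = (\<Sum>i=- L..- J - (- L'). (dX ^^ m) (f $$ - a) $$ i * g $$ - (I - a + int m) $$ (- J - i))"
        by (rule fls_mult_nth[OF vanishes_below_mono[OF vanishes_below_dX_funpow[OF inner[OF bf]]] inner[OF bg]]) simp
      also have "\<dots> = (\<Sum>i=- L..- J - (- L'). pochhammer (of_int ((- i) + 1)) m * f $$ - a $$ - ((- i) + int m) * g $$ - (I - a + int m) $$ - (J - (- i)))"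
      proof (rule sum.cong[OF refl])
        fix i
        have "- J - i = - (J - (- i))" "1 - i = (- i) + 1" "i - int m = - ((- i) + int m)" by simp_all
        then show "(dX ^^ m) (f $$ - a) $$ i * g $$ - (I - a + int m) $$ (- J - i)
          = pochhammer (of_int ((- i) + 1)) m * f $$ - a $$ - ((- i) + int m) * g $$ - (I - a + int m) $$ - (J - (- i))"
          by (simp only: dX_funpow_nth)
      qed
      also have "\<dots> = (\<Sum>b=J - L'..L. pochhammer (of_int (b + 1)) m * f $$ - a $$ - (b + int m) * g $$ - (I - a + int m) $$ - (J - b))"
        by (rule sum.reindex_bij_witness[of _ uminus uminus]) auto
      finally show "pochhammer (of_int (I - a + 1)) m * (((dX ^^ m) (f $$ - a) * g $$ - (I - a + int m)) $$ (- J))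
        = (\<Sum>b=J - L'..L. pochhammer (of_int (I - a + 1)) m *
        (pochhammer (of_int (b + 1)) m * f $$ - a $$ - (b + int m) * g $$ - (I - a + int m) $$ - (J - b)))"
        by (simp only: sum_distrib_left)
    qed
    finally show "inverse (fact m) * (((dY ^^ m) f * (dX ^^ m) g) $$ (- I) $$ (- J)) = (\<Sum>a=I - K'..K. \<Sum>b=J - L'..L.
      star_coeff m (I - a) b * f $$ - a $$ - (b + int m) * g $$ - (I - a + int m) $$ - (J - b))"
      by (simp add: star_coeff_def sum_distrib_left mult.assoc)
  qed
  finally show "star f g $$ - I $$ - J = (\<Sum>m\<le>?M. \<Sum>a=I - K'..K. \<Sum>b=J - L'..L.
      star_coeff m (I - a) b * f $$ - a $$ - (b + int m) * g $$ - (I - a + int m) $$ - (J - b))" .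
qed

section \<open>Fock space\<close>

text \<open>Symbols do not commute, so operators are taken linear over scalars acting on the right.
  One ring then contains the left multiplications \<open>lmul\<close> as well as the odd operators
  \<open>fop\<close>.\<close>

typedef (overloaded) ('s, 'e::ring_1) rlin =
  "{A :: ('s \<Rightarrow> 'e) \<Rightarrow> ('s \<Rightarrow> 'e). (\<forall>u v. A (\<lambda>s. u s + v s) = (\<lambda>s. A u s + A v s))
      \<and> (\<forall>v r. A (\<lambda>s. v s * r) = (\<lambda>s. A v s * r))}"
  morphisms app Abs_rlin
  by (rule exI[of _ "\<lambda>v. v"]) simp

setup_lifting type_definition_rlin

lemma app_add: "app A (\<lambda>s. u s + v s) = (\<lambda>s. app A u s + app A v s)"
  and app_mult: "app A (\<lambda>s. v s * r) = (\<lambda>s. app A v s * r)"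
  using app[of A] by blast+

lemma app_zero: "app A (\<lambda>s. 0) = (\<lambda>s. 0)"
  using app_mult[of A "\<lambda>s. 0" 0] by simp

lemma app_sum: "app A (\<lambda>s. \<Sum>i\<in>I. f i s) = (\<lambda>s. \<Sum>i\<in>I. app A (f i) s)"
  by (induction I rule: infinite_finite_induct) (simp_all add: app_zero app_add)

lemma app_uminus: "app A (\<lambda>s. - v s) = (\<lambda>s. - app A v s)"
  using app_mult[of A v "- 1"] by simp

instantiation rlin :: (type, ring_1) ring_1
begin
lift_definition zero_rlin :: "('a, 'b) rlin" is "\<lambda>v s. 0" by simp
lift_definition one_rlin :: "('a, 'b) rlin" is "\<lambda>v. v" by simp
lift_definition plus_rlin :: "('a, 'b) rlin \<Rightarrow> ('a, 'b) rlin \<Rightarrow> ('a, 'b) rlin" is "\<lambda>A B v s. A v s + B v s"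
  by (simp add: algebra_simps)
lift_definition minus_rlin :: "('a, 'b) rlin \<Rightarrow> ('a, 'b) rlin \<Rightarrow> ('a, 'b) rlin" is "\<lambda>A B v s. A v s - B v s"
  by (simp add: algebra_simps)
lift_definition uminus_rlin :: "('a, 'b) rlin \<Rightarrow> ('a, 'b) rlin" is "\<lambda>A v s. - A v s"
  by (simp add: algebra_simps)
lift_definition times_rlin :: "('a, 'b) rlin \<Rightarrow> ('a, 'b) rlin \<Rightarrow> ('a, 'b) rlin" is "\<lambda>A B v. A (B v)"
  by simp
instance
proof
  fix a b c :: "('a, 'b) rlin"
  show "a * b * c = a * (b * c)" by transfer simp
  show "1 * a = a" "a * 1 = a" by (transfer; simp)+
  show "(a + b) * c = a * c + b * c" by transfer simp
  show "a * (b + c) = a * b + a * c" by transfer auto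
  show "a + b + c = a + (b + c)" "a + b = b + a" "0 + a = a" "- a + a = 0" "a - b = a + - b"
    by (transfer; simp add: fun_eq_iff add.assoc add.commute)+
  show "(0 :: ('a, 'b) rlin) \<noteq> 1"
  proof transfer
    have "(\<lambda>s. 0) \<noteq> (\<lambda>s::'a. (1::'b))" by (simp add: fun_eq_iff)
    then show "(\<lambda>v s. 0) \<noteq> (\<lambda>v :: 'a \<Rightarrow> 'b. v)" by metis
  qed
qed
end

lemma rlin_eqI: "(\<And>v s. app A v s = app B v s) \<Longrightarrow> A = B"
  by (metis app_inject ext)

lemma app_simps [simp]:
  "app 0 v s = 0" "app 1 v = v" "app (A + B) v s = app A v s + app B v s"
  "app (A - B) v s = app A v s - app B v s" "app (- A) v s = - app A v s"
  "app (A * B) v = app A (app B v)"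
  by (simp_all add: zero_rlin.rep_eq one_rlin.rep_eq plus_rlin.rep_eq minus_rlin.rep_eq
      uminus_rlin.rep_eq times_rlin.rep_eq)

lemma app_sum_left: "app (sum A I) v s = (\<Sum>i\<in>I. app (A i) v s)"
  by (induction I rule: infinite_finite_induct) simp_all

lift_definition lmul :: "'e::ring_1 \<Rightarrow> ('s, 'e) rlin" is "\<lambda>r v s. r * v s"
  by (simp add: algebra_simps)

lemma app_lmul [simp]: "app (lmul r) v s = r * v s"
  by (simp add: lmul.rep_eq)

lemma lmul_mult: "lmul r * lmul t = lmul (r * t)"
  and lmul_add: "lmul r + lmul t = lmul (r + t)"
  and lmul_one: "lmul 1 = 1"
  by (rule rlin_eqI; simp add: mult.assoc distrib_right)+

text \<open>The generators of the Fock space: the variables \<open>\<xi>\<close> and two families of auxiliary odd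
  variables. \<open>before\<close> governs the signs; two generators anticommute iff exactly one
  of them is before the other.\<close>

datatype gen = Xi "nat \<times> nat" | Cc nat | Th nat

fun before :: "gen \<Rightarrow> gen \<Rightarrow> bool" where
  "before (Xi p) (Xi q) = idx_less p q"
| "before (Xi p) (Cc i) = True"
| "before (Cc i) (Cc j) = (i < j)"
| "before (Th a) (Th b) = (a < b)"
| "before _ _ = False"

definition toggle :: "gen \<Rightarrow> gen fset \<Rightarrow> gen fset" where
  "toggle c S = (if c |\<in>| S then S |-| {|c|} else finsert c S)"

definition preceding :: "gen \<Rightarrow> gen fset \<Rightarrow> nat" where
  "preceding c S = card {e. e |\<in>| S \<and> before e c}"

definition signed :: "nat \<Rightarrow> 'e::ring_1 \<Rightarrow> 'e" where
  "signed m v = (if even m then v else - v)"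

text \<open>The action is on coefficient functions: the value at \<open>S\<close> is read from the
  toggled set. So \<open>b\<close> records whether \<open>c\<close> is occupied in the result: True
  is multiplication by the variable, False the left derivation.\<close>

lift_definition fop :: "bool \<Rightarrow> gen \<Rightarrow> (gen fset, 'e::ring_1) rlin" is
  "\<lambda>b c v S. if (c |\<in>| S) = b then signed (preceding c S) (v (toggle c S)) else 0"
  by (auto simp: signed_def)

type_synonym fock_op = "(gen fset, symbol) rlin"

lemma app_fop: "app (fop b c) v S = (if (c |\<in>| S) = b then signed (preceding c S) (v (toggle c S)) else 0)"
  by (simp add: fop.rep_eq)

lemma not_before_self: "\<not> before c c"
  by (cases c) (auto simp: idx_less_def)

lemma finite_preceding: "finite {e. e |\<in>| S \<and> before e c}"
  by (rule finite_subset[of _ "fset S"]) auto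

lemma preceding_finsert: "d |\<notin>| S \<Longrightarrow> preceding c (finsert d S) = preceding c S + (if before d c then 1 else 0)"
proof -
  assume d: "d |\<notin>| S"
  have "{e. e |\<in>| finsert d S \<and> before e c} = (if before d c then insert d {e. e |\<in>| S \<and> before e c} else {e. e |\<in>| S \<and> before e c})"
    by auto
  then show ?thesis using d finite_preceding[of S c] by (simp add: preceding_def)
qed

lemma even_preceding_toggle: "even (preceding c (toggle d S)) \<longleftrightarrow> (even (preceding c S) \<longleftrightarrow> \<not> before d c)"
proof (cases "d |\<in>| S")
  case True
  then have "finsert d (S |-| {|d|}) = S" by auto
  then have "preceding c S = preceding c (S |-| {|d|}) + (if before d c then 1 else 0)"
    using preceding_finsert[of d "S |-| {|d|}" c] by simp
  then show ?thesis using True by (auto simp: toggle_def)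
qed (auto simp: toggle_def preceding_finsert)

lemma toggle_commute: "toggle c (toggle d S) = toggle d (toggle c S)"
  by (auto simp: toggle_def)

lemma toggle_toggle: "toggle c (toggle c S) = S"
  by (auto simp: toggle_def)

lemma mem_toggle: "c |\<in>| toggle d S \<longleftrightarrow> (if c = d then c |\<notin>| S else c |\<in>| S)"
  by (auto simp: toggle_def)

lemma fop_commute:
  assumes "c \<noteq> d" "before c d = before d c"
  shows "fop b c * fop b' d = (fop b' d * fop b c :: (gen fset, 'e::ring_1) rlin)"
  by (rule rlin_eqI) (use assms in \<open>auto simp: app_fop mem_toggle toggle_commute[of d c] signed_def even_preceding_toggle\<close>)

lemma fop_anticommute:
  assumes "c \<noteq> d" "before c d = (\<not> before d c)"
  shows "fop b c * fop b' d = - (fop b' d * fop b c :: (gen fset, 'e::ring_1) rlin)"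
  by (rule rlin_eqI) (use assms in \<open>auto simp: app_fop mem_toggle toggle_commute[of d c] signed_def even_preceding_toggle\<close>)

lemma fop_square: "fop b c * fop b c = (0 :: (gen fset, 'e::ring_1) rlin)"
  by (rule rlin_eqI) (auto simp: app_fop mem_toggle signed_def)

lemma fop_pair: "fop False c * fop True c + fop True c * fop False c = (1 :: (gen fset, 'e::ring_1) rlin)"
  by (rule rlin_eqI) (auto simp: app_fop mem_toggle toggle_toggle signed_def even_preceding_toggle not_before_self)

lemma lmul_fop: "lmul r * fop b c = fop b c * lmul r"
  by (rule rlin_eqI) (auto simp: app_fop signed_def)

lemma rlin_two_torsion_free: "A + A = 0 \<Longrightarrow> A = 0" for A :: "('s, symbol) rlin"
proof (rule rlin_eqI)
  fix v s assume "A + A = 0"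
  then have "app (A + A) v s = 0" by simp
  then show "app A v s = app 0 v s" using symbol_two_torsion_free[of "app A v s"] by simp
qed

lemma idx_less_linear: "p \<noteq> q \<Longrightarrow> idx_less p q = (\<not> idx_less q p)"
  by (cases p; cases q) (auto simp: idx_less_def)

definition ket :: "'s \<Rightarrow> 's \<Rightarrow> symbol" where "ket R = (\<lambda>S. if S = R then 1 else 0)"

lemma ket_expand:
  assumes "finite B" "inj_on g B" "\<And>s. s \<notin> g ` B \<Longrightarrow> v s = 0"
  shows "app A v s = (\<Sum>R\<in>B. app A (ket (g R)) s * v (g R))"
proof -
  have "v = (\<lambda>s. \<Sum>R\<in>B. ket (g R) s * v (g R))"
  proof
    fix s
    have "(\<Sum>R\<in>B. ket (g R) s * v (g R)) = (\<Sum>r\<in>g ` B. if r = s then v r else 0)"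
      by (subst sum.reindex[OF assms(2)]) (auto simp: ket_def intro!: sum.cong)
    also have "\<dots> = v s" using assms by (auto simp: sum.delta)
    finally show "v s = (\<Sum>R\<in>B. ket (g R) s * v (g R))" by simp
  qed
  then have "app A v s = app A (\<lambda>s. \<Sum>R\<in>B. ket (g R) s * v (g R)) s" by simp
  then show ?thesis by (simp add: app_sum app_mult)
qed

lemma app_signed: "app A (\<lambda>s. signed m (v s)) = (\<lambda>s. signed m (app A v s))"
  by (cases "even m") (simp_all add: signed_def app_uminus)

lemma fop_ket: "c |\<notin>| R \<Longrightarrow> app (fop True c) (ket R) = (\<lambda>s. signed (preceding c R) (ket (finsert c R) s))"
proof
  fix S assume c: "c |\<notin>| R"
  then have "toggle c S = R \<longleftrightarrow> S = finsert c R" if "c |\<in>| S" using that by (auto simp: toggle_def)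
  then show "app (fop True c) (ket R) S = signed (preceding c R) (ket (finsert c R) S)"
    using c by (auto simp: app_fop ket_def signed_def preceding_finsert not_before_self)
qed

lemma prod_fop_ket:
  assumes "distinct (map g l)" "\<And>i. i \<in> set l \<Longrightarrow> g i |\<notin>| R"
  shows "\<exists>m. app (prod_list (map (\<lambda>i. fop True (g i)) l)) (ket R) = (\<lambda>s. signed m (ket (fset_of_list (map g l) |\<union>| R) s))"
  using assms
proof (induction l)
  case Nil
  then show ?case by (intro exI[of _ 0]) (simp add: signed_def)
next
  case (Cons i l)
  then obtain m where m: "app (prod_list (map (\<lambda>i. fop True (g i)) l)) (ket R)
     = (\<lambda>s. signed m (ket (fset_of_list (map g l) |\<union>| R) s))" by auto
  have "g i |\<notin>| fset_of_list (map g l) |\<union>| R" using Cons.prems by (auto simp: fset_of_list_elem)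
  note ket = fop_ket[OF this]
  have "app (prod_list (map (\<lambda>i. fop True (g i)) (i # l))) (ket R)
     = app (fop True (g i)) (\<lambda>s. signed m (ket (fset_of_list (map g l) |\<union>| R) s))" by (simp add: m)
  also have "\<dots> = (\<lambda>s. signed (m + preceding (g i) (fset_of_list (map g l) |\<union>| R))
      (ket (fset_of_list (map g (i # l)) |\<union>| R) s))"
    unfolding app_signed ket by (auto simp: signed_def fun_eq_iff)
  finally show ?case by blast
qed

lemma signed_eq_iff: "signed m u = signed m v \<longleftrightarrow> u = v"
  by (simp add: signed_def)

lemma idxs_finite: "T \<in> idxs k n \<Longrightarrow> finite T"
  unfolding idxs_def by (meson Pow_iff finite_SigmaI finite_atLeastAtMost finite_subset)

lemma finite_idxs: "finite (idxs k n)" by (simp add: idxs_def)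

text \<open>All auxiliary generators are occupied in a base state: the duality identity only holds after
  multiplication by \<open>\<theta>_all * c_all\<close> on the right, and these states are in the range of that element.\<close>

definition base_state :: "nat \<Rightarrow> nat \<Rightarrow> (nat \<times> nat) set \<Rightarrow> gen fset" where
  "base_state k n T = Abs_fset (Xi ` T \<union> Cc ` {1..n} \<union> Th ` {1..k})"

lemma mem_base_state:
  assumes "finite T"
  shows "e |\<in>| base_state k n T \<longleftrightarrow> e \<in> Xi ` T \<union> Cc ` {1..n} \<union> Th ` {1..k}"
  unfolding base_state_def using assms by (subst Abs_fset_inverse) auto

lemma base_state_inj: "inj_on (base_state k n) (idxs k n)"
proof (rule inj_onI)
  fix S T assume "S \<in> idxs k n" "T \<in> idxs k n" "base_state k n S = base_state k n T"
  then have "e \<in> Xi ` S \<union> Cc ` {1..n} \<union> Th ` {1..k} \<longleftrightarrow> e \<in> Xi ` T \<union> Cc ` {1..n} \<union> Th ` {1..k}" for e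
    using mem_base_state idxs_finite by metis
  then have "p \<in> S \<longleftrightarrow> p \<in> T" for p by (drule_tac x = "Xi p" in meta_spec) (simp add: image_iff)
  then show "S = T" by blast
qed

section \<open>Base states as a copy of P_kn\<close>

locale fock =
  fixes k n :: nat and z \<alpha> :: "nat \<Rightarrow> complex"
begin

sublocale duality k n "\<lambda>a. lmul (sX (z a))" "\<lambda>a. lmul (sXi (z a))" "\<lambda>i. lmul (sD (\<alpha> i))"
  "\<lambda>i. lmul (sDi (\<alpha> i))" "\<lambda>a i. fop True (Xi (a, i))" "\<lambda>a i. fop False (Xi (a, i))"
  "\<lambda>i. fop True (Cc i)" "\<lambda>a. fop True (Th a) :: fock_op"
proof
  fix a b i j :: nat
  show "A = 0" if "A + A = 0" for A :: "fock_op" using that by (rule rlin_two_torsion_free)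
  show "lmul (sX (z a)) * lmul (sX (z b)) = (lmul (sX (z b)) * lmul (sX (z a)) :: fock_op)"
    by (simp only: lmul_mult sX_commute)
  show "lmul (sXi (z a)) * lmul (sX (z a)) = (1 :: fock_op)"
    "lmul (sX (z a)) * lmul (sXi (z a)) = (1 :: fock_op)"
    by (simp_all only: lmul_mult sX_inverse lmul_one)
  show "lmul (sDi (\<alpha> a)) * lmul (sD (\<alpha> a)) = (1 :: fock_op)"
    "lmul (sD (\<alpha> a)) * lmul (sDi (\<alpha> a)) = (1 :: fock_op)"
    by (simp_all only: lmul_mult sD_inverse lmul_one)
  show "lmul (sD (\<alpha> a)) * lmul (sD (\<alpha> b)) = (lmul (sD (\<alpha> b)) * lmul (sD (\<alpha> a)) :: fock_op)"
    by (simp only: lmul_mult sD_commute)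
  show "lmul (sD (\<alpha> i)) * lmul (sX (z a)) = (lmul (sX (z a)) * lmul (sD (\<alpha> i)) + 1 :: fock_op)"
    by (simp only: lmul_mult sD_sX lmul_add lmul_one[symmetric])
  have anti: "fop x c * fop y d = - (fop y d * fop x c :: fock_op)"
    if "(c = d \<and> x = y) \<or> (c \<noteq> d \<and> before c d = (\<not> before d c))" for x y c d
    using that fop_anticommute[of c d x y] by (auto simp: fop_square)
  show "fop True (Xi (a, i)) * fop True (Xi (b, j)) = - (fop True (Xi (b, j)) * fop True (Xi (a, i)) :: fock_op)"
    and "fop False (Xi (a, i)) * fop False (Xi (b, j)) = - (fop False (Xi (b, j)) * fop False (Xi (a, i)) :: fock_op)"
    by (rule anti, use idx_less_linear[of "(a, i)" "(b, j)"] in auto)+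
  show "fop False (Xi (a, i)) * fop True (Xi (b, j))
    = (if a = b \<and> i = j then 1 else 0) - (fop True (Xi (b, j)) * fop False (Xi (a, i)) :: fock_op)"
  proof (cases "a = b \<and> i = j")
    case True
    then show ?thesis using fop_pair[of "Xi (a, i)"] by (simp add: eq_diff_eq)
  next
    case False
    then show ?thesis using anti[of "Xi (a, i)" "Xi (b, j)" False True] idx_less_linear[of "(a, i)" "(b, j)"] by auto
  qed
  show "fop True (Cc i) * fop True (Cc j) = - (fop True (Cc j) * fop True (Cc i) :: fock_op)"
    and "fop True (Th i) * fop True (Th j) = - (fop True (Th j) * fop True (Th i) :: fock_op)"
    and "fop True (Cc i) * fop True (Xi (a, j)) = - (fop True (Xi (a, j)) * fop True (Cc i) :: fock_op)"
    and "fop True (Cc i) * fop False (Xi (a, j)) = - (fop False (Xi (a, j)) * fop True (Cc i) :: fock_op)"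
    by (rule anti, force)+
qed (simp_all add: lmul_fop fop_commute)

abbreviation st where "st \<equiv> base_state k n"

text \<open>Up to sign, a base state is \<open>\<theta>_all * c_all\<close> applied to a state
  without auxiliary generators. There \<open>duality_identity\<close> can be used, and the sign
  cancels.\<close>

lemma state_identity:
  assumes "finite T"
  shows "app (row_det k M_dual) (app (Xi_all * row_det n M) (ket (st T))) = app D_all (ket (st T))"
proof -
  let ?R = "Abs_fset (Xi ` T)"
  have R: "e |\<in>| ?R \<longleftrightarrow> e \<in> Xi ` T" for e using assms by (subst Abs_fset_inverse) auto
  obtain m where m: "app c_all (ket ?R) = (\<lambda>s. signed m (ket (fset_of_list (map Cc [1..<n+1]) |\<union>| ?R) s))"
    using prod_fop_ket[of Cc "[1..<n+1]" ?R] R by (auto simp: distinct_map inj_on_def simp del: upt_Suc)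
  let ?R' = "fset_of_list (map Cc [1..<n+1]) |\<union>| ?R"
  have "Th a |\<notin>| ?R'" for a using R by (auto simp: fset_of_list_elem)
  then obtain m' where m': "app \<theta>_all (ket ?R') = (\<lambda>s. signed m' (ket (fset_of_list (map Th [1..<k+1]) |\<union>| ?R') s))"
    using prod_fop_ket[of Th "[1..<k+1]" ?R'] by (auto simp: distinct_map inj_on_def simp del: upt_Suc)
  have "fset_of_list (map Th [1..<k+1]) |\<union>| ?R' = st T"
    by (rule fset_eqI) (auto simp: mem_base_state[OF assms] R fset_of_list_elem)
  then have w: "app (\<theta>_all * c_all) (ket ?R) = (\<lambda>s. signed (m + m') (ket (st T) s))"
    unfolding app_simps(6) m app_signed m' by (auto simp: signed_def fun_eq_iff)
  have "app (row_det k M_dual * Xi_all * row_det n M * (\<theta>_all * c_all)) (ket ?R) = app (D_all * (\<theta>_all * c_all)) (ket ?R)"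
    by (simp only: duality_identity)
  then have "app (row_det k M_dual * Xi_all * row_det n M) (\<lambda>s. signed (m + m') (ket (st T) s))
    = app D_all (\<lambda>s. signed (m + m') (ket (st T) s))"
    by (simp only: app_simps(6)[of _ "\<theta>_all * c_all"] w)
  then have "signed (m + m') (app (row_det k M_dual * Xi_all * row_det n M) (ket (st T)) s)
    = signed (m + m') (app D_all (ket (st T)) s)" for s
    by (simp only: app_signed fun_eq_iff)
  then have "app (row_det k M_dual * Xi_all * row_det n M) (ket (st T)) = app D_all (ket (st T))"
    unfolding signed_eq_iff by (rule ext)
  then show ?thesis by (simp only: app_simps(6) mult.assoc)
qed

definition supported where "supported v \<longleftrightarrow> (\<forall>s. s \<notin> st ` idxs k n \<longrightarrow> v s = (0::symbol))"

lemma sc_signed: "sc (signed m f) i j = (-1) ^ m * sc f i j"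
  by (simp add: signed_def)

lemma toggle_base_state:
  assumes "S \<in> idxs k n" "c \<in> {1..k} \<times> {1..n}"
  shows "toggle (Xi c) (st S) = st (if c \<in> S then S - {c} else insert c S)"
    "(if c \<in> S then S - {c} else insert c S) \<in> idxs k n"
proof -
  show *: "(if c \<in> S then S - {c} else insert c S) \<in> idxs k n" using assms by (auto simp: idxs_def)
  show "toggle (Xi c) (st S) = st (if c \<in> S then S - {c} else insert c S)"
    by (rule fset_eqI) (use idxs_finite[OF assms(1)] in \<open>auto simp: mem_base_state mem_toggle split: if_splits\<close>)
qed

lemma preceding_base_state: "finite S \<Longrightarrow> preceding (Xi c) (st S) = card {e \<in> S. idx_less e c}"
proof -
  assume S: "finite S"
  have "{e. e |\<in>| st S \<and> before e (Xi c)} = Xi ` {e \<in> S. idx_less e c}"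
    using S by (auto simp: mem_base_state)
  then show ?thesis unfolding preceding_def by (simp add: card_image inj_on_def)
qed

text \<open>No auxiliary generator is \<open>before\<close> an \<open>Xi\<close>, so the occupied
  ones leave the signs alone, and the pair acts on base states as \<open>xi_d\<close> does on
  monomials. At most one term of the sum over \<open>R\<close> is nonzero.\<close>

lemma sc_pair:
  assumes S: "S \<in> idxs k n" and c: "c \<in> {1..k} \<times> {1..n}" and d: "d \<in> {1..k} \<times> {1..n}"
  shows "sc (app (fop True (Xi c) * fop False (Xi d)) v (st S)) i j
    = (\<Sum>R\<in>idxs k n. xi_d k n c d S R * sc (v (st R)) i j)"
proof (cases "c \<in> S \<and> d \<notin> S - {c}")
  case True
  let ?U = "S - {c}" and ?R = "insert d (S - {c})"
  have fin: "finite S" by (rule idxs_finite[OF S])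
  have U: "toggle (Xi c) (st S) = st ?U" "?U \<in> idxs k n"
    using toggle_base_state[OF S c] True by simp_all
  have R: "toggle (Xi d) (st ?U) = st ?R" "?R \<in> idxs k n"
    using toggle_base_state[OF U(2) d] unfolding if_not_P[OF conjunct2[OF True]] by this
  have less: "\<not> idx_less e e" for e by (simp add: idx_less_def)
  have "sc (app (fop True (Xi c) * fop False (Xi d)) v (st S)) i j
    = (-1) ^ (card {e \<in> S. idx_less e c} + card {e \<in> ?U. idx_less e d}) * sc (v (st ?R)) i j"
    using True fin by (simp add: app_fop U R mem_base_state sc_signed preceding_base_state power_add image_iff)
  also have "\<dots> = xi_d k n c d S ?R * sc (v (st ?R)) i j"
  proof -
    have 1: "?R - {d} = ?U" "S = insert c ?U" "c \<notin> ?U" using True by auto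
    \<comment> \<open>\<open>xi_d\<close> counts from the source \<open>?R\<close>,
      \<open>fop\<close> from the target \<open>S\<close>; irreflexivity of the order makes the
      counts agree.\<close>
    have 2: "{e \<in> ?R. idx_less e d} = {e \<in> ?U. idx_less e d}" using less by auto
    have 3: "{e \<in> ?U. idx_less e c} = {e \<in> S. idx_less e c}" using less by auto
    show ?thesis unfolding xi_d_def 1(1) 2 3 using R(2) 1 by (simp add: add.commute)
  qed
  also have "\<dots> = (\<Sum>R\<in>idxs k n. xi_d k n c d S R * sc (v (st R)) i j)"
  proof -
    have "xi_d k n c d S R = 0" if "R \<noteq> ?R" for R
    proof -
      have "\<not> (d \<in> R \<and> c \<notin> R - {d} \<and> S = insert c (R - {d}))" using that by blast
      then show ?thesis by (auto simp: xi_d_def)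
    qed
    then have "(\<Sum>R\<in>idxs k n. xi_d k n c d S R * sc (v (st R)) i j)
      = (\<Sum>R\<in>{?R}. xi_d k n c d S R * sc (v (st R)) i j)"
      using R(2) by (intro sum.mono_neutral_right) (auto simp: finite_idxs)
    then show ?thesis by simp
  qed
  finally show ?thesis .
next
  case False
  then have "xi_d k n c d S R = 0" for R by (auto simp: xi_d_def)
  moreover have "app (fop True (Xi c) * fop False (Xi d)) v (st S) = 0"
    using False idxs_finite[OF S] toggle_base_state[OF S c]
    by (auto simp: app_fop mem_base_state signed_def mem_toggle)
  ultimately show ?thesis by simp
qed

lemma supported_pair:
  assumes "supported v" "c \<in> {1..k} \<times> {1..n}" "d \<in> {1..k} \<times> {1..n}"
  shows "supported (app (fop True (Xi c) * fop False (Xi d)) v)"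
  unfolding supported_def
proof (intro allI impI)
  fix s assume s: "s \<notin> st ` idxs k n"
  have "toggle (Xi c) t \<notin> st ` idxs k n" if t: "t \<notin> st ` idxs k n" and c: "c \<in> {1..k} \<times> {1..n}" for t c
  proof
    assume "toggle (Xi c) t \<in> st ` idxs k n"
    then obtain S where S: "S \<in> idxs k n" "toggle (Xi c) t = st S" by auto
    then have "t = toggle (Xi c) (st S)" by (metis toggle_toggle)
    then have "t \<in> st ` idxs k n"
      unfolding toggle_base_state(1)[OF S(1) c] by (rule image_eqI) (rule toggle_base_state(2)[OF S(1) c])
    then show False using t by simp
  qed
  then have "toggle (Xi d) (toggle (Xi c) s) \<notin> st ` idxs k n" using assms s by blast
  then show "app (fop True (Xi c) * fop False (Xi d)) v s = 0"
    using assms(1) by (auto simp: app_fop supported_def signed_def)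
qed

lemma supported_simps:
  "supported v \<Longrightarrow> supported (app (lmul r) v)"
  "supported (app P v) \<Longrightarrow> supported (app Q v) \<Longrightarrow> supported (app (P + Q) v)"
  "supported (app P v) \<Longrightarrow> supported (app Q v) \<Longrightarrow> supported (app (P - Q) v)"
  "supported (app 0 v)"
  by (simp_all add: supported_def)

lemma supported_sum: "(\<And>a. a \<in> I \<Longrightarrow> supported (app (f a) v)) \<Longrightarrow> supported (app (sum f I) v)"
  by (simp add: supported_def app_sum_left)

lemma supported_ket: "T \<in> idxs k n \<Longrightarrow> supported (ket (st T))"
  by (auto simp: supported_def ket_def)

lemma sc_ket: "S \<in> idxs k n \<Longrightarrow> T \<in> idxs k n \<Longrightarrow> sc (ket (st T) (st S)) i j = (if S = T \<and> i = 0 \<and> j = 0 then 1 else 0)"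
  using inj_onD[OF base_state_inj] by (auto simp: ket_def sc_one)

end

section \<open>Coefficients of the universal operators\<close>

text \<open>Left multiplication by d/dx on the coefficients of x^(-q) (d/dx)^r; differentiating
  x^(-(q-1)) gives the factor -(q-1).\<close>

definition ddx :: "(nat \<Rightarrow> nat \<Rightarrow> complex) \<Rightarrow> nat \<Rightarrow> nat \<Rightarrow> complex" where
  "ddx h r q = (if r \<ge> 1 then h (r - 1) q else 0) - (if q \<ge> 1 then of_nat (q - 1) * h r (q - 1) else 0)"

text \<open>Left multiplication by 1/(x - w), expanded as the sum of the w^s x^(-s-1).\<close>

definition resolvent :: "complex \<Rightarrow> (nat \<Rightarrow> nat \<Rightarrow> complex) \<Rightarrow> nat \<Rightarrow> nat \<Rightarrow> complex" where
  "resolvent w h r q = (\<Sum>s<q. w ^ s * h r (q - 1 - s))"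

lemma resolvent_0 [simp]: "resolvent w h r 0 = 0" by (simp add: resolvent_def)

lemma resolvent_Suc: "resolvent w h r (Suc q) = h r q + w * resolvent w h r q"
proof -
  have "resolvent w h r (Suc q) = h r q + (\<Sum>s<q. w ^ Suc s * h r (q - Suc s))"
    unfolding resolvent_def by (subst sum.lessThan_Suc_shift) simp
  then show ?thesis by (simp add: resolvent_def sum_distrib_left mult.assoc)
qed

definition endo_supported :: "nat \<Rightarrow> nat \<Rightarrow> endo \<Rightarrow> bool" where
  "endo_supported k n B \<longleftrightarrow> (\<forall>S T. S \<notin> idxs k n \<or> T \<notin> idxs k n \<longrightarrow> B S T = 0)"

lemma emul_eone: "endo_supported k n B \<Longrightarrow> emul k n (eone k n) B S T = B S T"
proof (cases "S \<in> idxs k n")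
  case True
  have "emul k n (eone k n) B S T = (\<Sum>R\<in>idxs k n. if R = S then B R T else 0)"
    unfolding emul_def eone_def by (intro sum.cong) auto
  then show ?thesis using True by (simp add: finite_idxs)
next
  case False
  assume "endo_supported k n B"
  then show ?thesis using False by (auto simp: emul_def eone_def endo_supported_def intro!: sum.neutral)
qed

text \<open>A matrix entry has order at most one in d/dx and its generators form geometric series,
  so the general product formula collapses to \<open>ddx\<close> and resolvents.\<close>

lemma dop_mul_univ_entry:
  assumes f: "\<And>p q. endo_supported k n (f p q)" and A: "finite A"
    and g: "\<And>s. g j i s = esum A (\<lambda>a. escale (w a ^ s) (E a))"
  shows "dop_mul k n (univ_entry k n \<beta> g i j) f r q S T
    = (if i = j then ddx (\<lambda>p q. f p q S T) r q - \<beta> i * f r q S T else 0)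
      - (\<Sum>a\<in>A. \<Sum>R\<in>idxs k n. E a S R * resolvent (w a) (\<lambda>p q. f p q R T) r q)"
proof -
  let ?P = "univ_entry k n \<beta> g i j"
  define t where "t = (\<lambda>(m, b, q1). (of_nat ((r + m - b) choose m) * (-1) ^ m * pochhammer (of_nat (q - m - q1)) m)
     * emul k n (?P (r + m - b) q1) (f b (q - m - q1)) S T)"
  let ?I = "{(m, b, q1). m \<le> q \<and> b \<le> r \<and> q1 \<le> q - m}"
  \<comment> \<open>The triples at which the entry can be nonzero: in \<open>?J1\<close> its part of
    order zero acts, in \<open>?J2\<close> the derivative d/dx passes through the right factor, in
    \<open>?J3\<close> it differentiates it.\<close>
  let ?J1 = "(\<lambda>q1. (0, r, q1)) ` {..q}"
  let ?J2 = "if r \<ge> 1 then {(0, r - 1, 0)} else {}"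
  let ?J3 = "if q \<ge> 1 then {(1, r, 0)} else {}"
  have finI: "finite ?I"
    by (rule finite_subset[of _ "{..q} \<times> {..r} \<times> {..q}"]) auto
  have zero: "emul k n ezero B S T = 0" for B by (simp add: emul_def ezero_def)
  have "dop_mul k n ?P f r q S T = sum t ?I"
    unfolding dop_mul_def esum_def t_def by (intro sum.cong) (auto simp: escale_def)
  also have "\<dots> = sum t (?J1 \<union> (?J2 \<union> ?J3))"
  proof (rule sum.mono_neutral_right[OF finI])
    show "?J1 \<union> (?J2 \<union> ?J3) \<subseteq> ?I" by auto
    show "\<forall>x\<in>?I - (?J1 \<union> (?J2 \<union> ?J3)). t x = 0"
    proof
      fix x assume x: "x \<in> ?I - (?J1 \<union> (?J2 \<union> ?J3))"
      obtain m b q1 where [simp]: "x = (m, b, q1)" by (cases x)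
      have le: "m \<le> q" "b \<le> r" "q1 \<le> q - m" using x by auto
      have "?P (r + m - b) q1 = ezero"
      proof (rule ccontr)
        assume "?P (r + m - b) q1 \<noteq> ezero"
        then have "r + m - b = 0 \<or> (r + m - b = 1 \<and> q1 = 0)" by (auto simp: univ_entry_def split: if_splits)
        then consider "m = 0" "b = r" | "m = 0" "b = r - 1" "r \<ge> 1" "q1 = 0" | "m = 1" "b = r" "q1 = 0"
          using le by linarith
        then show False using x le by cases (auto split: if_splits)
      qed
      then show "t x = 0" by (simp add: t_def zero)
    qed
  qed
  also have "\<dots> = sum t ?J1 + (sum t ?J2 + sum t ?J3)"
    by (subst sum.union_disjoint; (subst sum.union_disjoint)?) auto
  also have "sum t ?J2 + sum t ?J3 = (if i = j then ddx (\<lambda>p q. f p q S T) r q else 0)"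
    by (cases q) (auto simp: t_def ddx_def univ_entry_def emul_eone[OF f] zero)
  also have "sum t ?J1 = (\<Sum>q1\<le>q. emul k n (?P 0 q1) (f r (q - q1)) S T)"
    by (subst sum.reindex) (auto simp: inj_on_def t_def)
  also have "\<dots> = emul k n (?P 0 0) (f r q) S T + (\<Sum>s<q. emul k n (?P 0 (Suc s)) (f r (q - Suc s)) S T)"
  proof (cases q)
    case (Suc q')
    show ?thesis unfolding Suc lessThan_Suc_atMost by (subst sum.atMost_Suc_shift) simp
  qed simp
  also have "emul k n (?P 0 0) (f r q) S T = (if i = j then - \<beta> i * f r q S T else 0)"
  proof -
    have "emul k n (escale c B) D S T = c * emul k n B D S T" for c B D
      by (simp add: emul_def escale_def sum_distrib_left mult.assoc)
    then show ?thesis by (simp add: univ_entry_def zero emul_eone[OF f])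
  qed
  also have "(\<Sum>s<q. emul k n (?P 0 (Suc s)) (f r (q - Suc s)) S T)
    = - (\<Sum>a\<in>A. \<Sum>R\<in>idxs k n. E a S R * resolvent (w a) (\<lambda>p q. f p q R T) r q)"
  proof -
    have "emul k n (?P 0 (Suc s)) (f r (q - Suc s)) S T
      = - (\<Sum>a\<in>A. \<Sum>R\<in>idxs k n. E a S R * (w a ^ s * f r (q - 1 - s) R T))" for s
      by (subst sum.swap)
        (simp add: univ_entry_def emul_def escale_def g esum_def sum_distrib_left sum_distrib_right sum_negf mult_ac)
    then have "(\<Sum>s<q. emul k n (?P 0 (Suc s)) (f r (q - Suc s)) S T)
      = - (\<Sum>s<q. \<Sum>a\<in>A. \<Sum>R\<in>idxs k n. E a S R * (w a ^ s * f r (q - 1 - s) R T))" by (simp only: sum_negf)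
    also have "(\<Sum>s<q. \<Sum>a\<in>A. \<Sum>R\<in>idxs k n. E a S R * (w a ^ s * f r (q - 1 - s) R T))
      = (\<Sum>a\<in>A. \<Sum>R\<in>idxs k n. \<Sum>s<q. E a S R * (w a ^ s * f r (q - 1 - s) R T))"
      by (subst sum.swap, intro sum.cong refl, rule sum.swap)
    finally show ?thesis by (simp only: resolvent_def sum_distrib_left)
  qed
  finally show ?thesis by (simp add: algebra_simps)
qed

section \<open>Symbols of the two universal operators\<close>

definition series_n :: "(nat \<Rightarrow> nat \<Rightarrow> complex) \<Rightarrow> int \<Rightarrow> int \<Rightarrow> complex" where
  "series_n h i j = (if i \<le> 0 \<and> j \<ge> 0 then h (nat j) (nat (- i)) else 0)"

text \<open>The coefficients of \<open>\<Sum>p q. h p q * (- y) ^ (- q) * x ^ p\<close> in normal order: the gl(k) operator,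
  in the variable \<open>x'\<close>, is moved by the Fourier transform \<open>x' = - d/dx, d/dx' = x\<close>.\<close>
definition series_k :: "(nat \<Rightarrow> nat \<Rightarrow> complex) \<Rightarrow> int \<Rightarrow> int \<Rightarrow> complex" where
  "series_k h i j = (if i \<ge> 0 \<and> j \<le> 0 then (-1) ^ nat (- j) * (\<Sum>m\<le>nat (- j).
      of_nat ((nat (- j) - 1) choose m) * pochhammer (of_int (i + 1)) m * h (nat i + m) (nat (- j) - m)) else 0)"

lemma series_n_diff: "series_n (\<lambda>p q. h p q - h' p q) i j = series_n h i j - series_n h' i j"
  and series_n_cmult: "series_n (\<lambda>p q. c * h p q) i j = c * series_n h i j"
  and series_n_sum: "series_n (\<lambda>p q. \<Sum>a\<in>B. g a p q) i j = (\<Sum>a\<in>B. series_n (g a) i j)"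
  and series_n_zero: "series_n (\<lambda>p q. 0) i j = 0"
  by (auto simp: series_n_def intro!: sum.neutral)

lemma series_k_diff: "series_k (\<lambda>p q. h p q - h' p q) i j = series_k h i j - series_k h' i j"
  and series_k_cmult: "series_k (\<lambda>p q. c * h p q) i j = c * series_k h i j"
  and series_k_zero: "series_k (\<lambda>p q. 0) i j = 0"
  by (simp_all add: series_k_def right_diff_distrib sum_subtractf sum_distrib_left mult_ac)

lemma series_k_add: "series_k (\<lambda>p q. h p q + h' p q) i j = series_k h i j + series_k h' i j"
  by (simp add: series_k_def distrib_left sum.distrib)

lemma series_k_sum: "series_k (\<lambda>p q. \<Sum>a\<in>B. g a p q) i j = (\<Sum>a\<in>B. series_k (g a) i j)"
  by (induction B rule: infinite_finite_induct) (simp_all add: series_k_zero series_k_add)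

lemma series_n_D:
  assumes "\<And>i j. sc u i j = series_n h i j"
  shows "sc (sD \<alpha> * u) i j = series_n (\<lambda>r q. ddx h r q - \<alpha> * h r q) i j"
proof -
  consider "i > 0 \<or> j < 0" | "i = 0" "j \<ge> 0" | q where "i = - int (Suc q)" "j \<ge> 0"
  proof -
    have "i \<le> 0 \<Longrightarrow> i \<noteq> 0 \<Longrightarrow> \<exists>q. i = - int (Suc q)"
      by (rule exI[of _ "nat (- i) - 1"]) simp
    then show ?thesis using that by (meson not_le)
  qed
  then show ?thesis
  proof cases
    case 1
    then show ?thesis by (auto simp: sc_sD assms series_n_def)
  next
    case 2
    then have "nat (j - 1) = nat j - 1" by simp
    then show ?thesis using 2 by (cases "j = 0") (auto simp: sc_sD assms series_n_def ddx_def)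
  next
    case 3
    have "nat (j - 1) = nat j - 1" "nat (int q + 1) = Suc q" "nat (- (- int (Suc q) + 1)) = q" "- int (Suc q) + 1 = - int q" by simp_all
    then show ?thesis using 3 by (cases "j = 0") (auto simp: sc_sD assms series_n_def ddx_def)
  qed
qed

lemma symbol_outer_bound: "\<exists>K. \<forall>i>K. \<forall>j. sc u i j = 0"
proof transfer
  fix u :: "complex fls fls"
  show "\<exists>K. \<forall>i>K. \<forall>j. u $$ - i $$ - j = 0"
    by (rule exI[of _ "- fls_subdegree u"]) simp
qed

lemma symbol_inner_bound: "\<exists>L. \<forall>j>L. sc u i j = 0"
proof transfer
  fix u :: "complex fls fls" and i
  show "\<exists>L. \<forall>j>L. u $$ - i $$ - j = 0"
    by (rule exI[of _ "- fls_subdegree (u $$ - i)"]) simp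
qed

lemma int_downward_induct:
  assumes "\<And>i::int. i > K \<Longrightarrow> P i" "\<And>i. P (i + 1) \<Longrightarrow> P i"
  shows "P i"
proof (induction "nat (K + 1 - i)" arbitrary: i)
  case 0
  then show ?case by (intro assms(1)) simp
next
  case (Suc m)
  have "P (i + 1)" using Suc by (intro Suc.hyps(1)) simp
  then show ?case by (rule assms(2))
qed

text \<open>Multiplying by \<open>sX a\<close> gives a recursion from each power of x to the next
  lower one. The resolvent satisfies it too, and both sides vanish at large powers of x.\<close>

lemma series_n_Xi:
  assumes u: "\<And>i j. sc u i j = series_n h i j"
  shows "sc (sXi a * u) i j = series_n (resolvent a h) i j"
proof -
  define v where "v = sXi a * u"
  have "sX a * v = u" unfolding v_def by (simp add: mult.assoc[symmetric] sX_inverse)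
  then have rec: "sc v (i - 1) j = series_n h i j + a * sc v i j" for i j
    using sc_sX[of a v i j] u[of i j] by simp
  have resolvent_rec: "series_n (resolvent a h) (i - 1) j = series_n h i j + a * series_n (resolvent a h) i j" for i j
  proof -
    consider "i > 1 \<or> j < 0" | "i = 1" "j \<ge> 0" | "i \<le> 0" "j \<ge> 0" by linarith
    then show ?thesis
    proof cases
      case 3
      then have "nat (- (i - 1)) = Suc (nat (- i))" by simp
      then show ?thesis using 3 by (simp only: series_n_def resolvent_Suc) simp
    qed (auto simp: series_n_def)
  qed
  obtain K where K: "\<forall>i>K. \<forall>j. sc v i j = 0" using symbol_outer_bound by blast
  have "\<forall>j. sc v i j - series_n (resolvent a h) i j = 0" for i
  proof (rule int_downward_induct[of "max K 0"])
    fix i assume "max K 0 < i"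
    then show "\<forall>j. sc v i j - series_n (resolvent a h) i j = 0" using K by (simp add: series_n_def)
  next
    fix i assume "\<forall>j. sc v (i + 1) j - series_n (resolvent a h) (i + 1) j = 0"
    then show "\<forall>j. sc v i j - series_n (resolvent a h) i j = 0"
      using rec[of "i + 1"] resolvent_rec[of "i + 1"] by (auto simp: algebra_simps)
  qed
  then show ?thesis by (simp add: v_def)
qed

lemma pochhammer_shift: "pochhammer (a + 1) m - of_nat m * pochhammer (a + 1) (m - 1) = pochhammer (a :: 'a::comm_ring_1) m"
proof (cases m)
  case (Suc l)
  show ?thesis unfolding Suc pochhammer_rec[of a] pochhammer_Suc[of "a + 1"] by (simp add: algebra_simps)
qed simp

text \<open>The formula for \<open>series_k\<close> is (-y)^(-q) x^p = \<Sum>m. (-1)^(q+m)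
  binomial(q+m-1, m) p(p-1)...(p-m+1) x^(p-m) y^(-q-m), sorted by the resulting exponents. As x
  (-y)^(-q) = (-y)^(-q) x - q (-y)^(-q-1), multiplication by x acts as d/dx'. On coefficients this
  amounts to absorption of binomials together with \<open>pochhammer_shift\<close>.\<close>

lemma series_k_X:
  assumes u: "\<And>i j. sc u i j = series_k h i j"
  shows "sc (sX a * u) i j = series_k (\<lambda>r q. ddx h r q - a * h r q) i j"
proof -
  have "series_k h (i - 1) j = series_k (ddx h) i j"
  proof (cases "i \<ge> 0 \<and> j \<le> 0")
    case True
    define q p where "q = nat (- j)" and "p = nat i"
    have ij: "i = int p" "j = - int q" using True by (simp_all add: q_def p_def)
    have q: "nat (- (- int q)) = q" by simp
    have poch: "pochhammer (of_int (int p + 1)) m = pochhammer (of_nat p + 1 :: complex) m" for m by simp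
    have "(\<Sum>m\<le>q. of_nat ((q - 1) choose m) * pochhammer (of_nat p + 1) m * ddx h (p + m) (q - m))
      = (\<Sum>m\<le>q. of_nat ((q - 1) choose m) * pochhammer (of_nat p + 1) m * (if p + m \<ge> 1 then h (p + m - 1) (q - m) else 0))
       - (\<Sum>m\<le>q. of_nat ((q - 1) choose m) * pochhammer (of_nat p + 1) m * (if q - m \<ge> 1 then of_nat (q - m - 1) * h (p + m) (q - m - 1) else 0))"
      unfolding ddx_def by (simp only: right_diff_distrib sum_subtractf)
    also have "(\<Sum>m\<le>q. of_nat ((q - 1) choose m) * pochhammer (of_nat p + 1 :: complex) m * (if q - m \<ge> 1 then of_nat (q - m - 1) * h (p + m) (q - m - 1) else 0))
      = (\<Sum>m\<le>q. of_nat ((q - 1) choose m) * (of_nat m * pochhammer (of_nat p + 1) (m - 1)) * (if p + m \<ge> 1 then h (p + m - 1) (q - m) else 0))"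
    proof (cases q)
      case (Suc q')
      have abs: "(of_nat (q' - m) :: complex) * of_nat (q' choose m) = of_nat (Suc m) * of_nat (q' choose Suc m)" for m
      proof -
        have "Suc m * (q' choose Suc m) = (q' - m) * (q' choose m)"
          by (simp only: binomial_absorb_comp binomial_absorption)
        then show ?thesis by (metis of_nat_mult)
      qed
      have "(\<Sum>m\<le>q. of_nat ((q - 1) choose m) * pochhammer (of_nat p + 1 :: complex) m * (if q - m \<ge> 1 then of_nat (q - m - 1) * h (p + m) (q - m - 1) else 0))
        = (\<Sum>m\<le>q'. of_nat (q' choose m) * pochhammer (of_nat p + 1) m * (of_nat (q' - m) * h (p + m) (q' - m)))"
        unfolding Suc by simp (intro sum.cong, auto simp: Suc_diff_le)
      also have "\<dots> = (\<Sum>m\<le>q'. of_nat (q' choose Suc m) * (of_nat (Suc m) * pochhammer (of_nat p + 1) m) * h (p + m) (q' - m))"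
      proof (intro sum.cong refl)
        fix m
        have "of_nat (q' choose m) * pochhammer (of_nat p + 1) m * (of_nat (q' - m) * h (p + m) (q' - m))
          = (of_nat (q' - m) * of_nat (q' choose m)) * (pochhammer (of_nat p + 1) m * h (p + m) (q' - m))"
          by (simp only: mult_ac)
        then show "of_nat (q' choose m) * pochhammer (of_nat p + 1) m * (of_nat (q' - m) * h (p + m) (q' - m))
          = of_nat (q' choose Suc m) * (of_nat (Suc m) * pochhammer (of_nat p + 1) m) * h (p + m) (q' - m)"
          unfolding abs by (simp only: mult_ac)
      qed
      also have "\<dots> = (\<Sum>m\<le>q. of_nat ((q - 1) choose m) * (of_nat m * pochhammer (of_nat p + 1) (m - 1)) * (if p + m \<ge> 1 then h (p + m - 1) (q - m) else 0))"
        unfolding Suc by (subst sum.atMost_Suc_shift) simp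
      finally show ?thesis .
    qed simp
    also have "(\<Sum>m\<le>q. of_nat ((q - 1) choose m) * pochhammer (of_nat p + 1 :: complex) m * (if p + m \<ge> 1 then h (p + m - 1) (q - m) else 0)) - \<dots>
      = (\<Sum>m\<le>q. of_nat ((q - 1) choose m) * pochhammer (of_nat p) m * (if p + m \<ge> 1 then h (p + m - 1) (q - m) else 0))"
      unfolding sum_subtractf[symmetric] pochhammer_shift[of "of_nat p :: complex", symmetric]
      by (intro sum.cong refl) (simp only: right_diff_distrib left_diff_distrib)
    finally have *: "series_k (ddx h) i j = (-1) ^ q * (\<Sum>m\<le>q. of_nat ((q - 1) choose m) * pochhammer (of_nat p) m * (if p + m \<ge> 1 then h (p + m - 1) (q - m) else 0))"
      unfolding series_k_def ij q poch by simp
    show ?thesis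
    proof (cases p)
      case 0
      have zero: "pochhammer (of_nat p :: complex) m * (if p + m \<ge> 1 then h (p + m - 1) (q - m) else 0) = 0" for m
        using 0 by (cases m) (simp_all add: pochhammer_0_left)
      have "series_k (ddx h) i j = 0" unfolding * mult.assoc zero by simp
      then show ?thesis using ij 0 by (simp add: series_k_def)
    next
      case (Suc p')
      have "int p - 1 = int p'" using Suc by simp
      then show ?thesis unfolding * unfolding ij unfolding series_k_def q using Suc by (simp add: add.commute)
    qed
  qed (auto simp: series_k_def)
  then show ?thesis by (simp add: sc_sX u series_k_diff series_k_cmult)
qed

definition shift_q :: "(nat \<Rightarrow> nat \<Rightarrow> complex) \<Rightarrow> nat \<Rightarrow> nat \<Rightarrow> complex" where
  "shift_q h p q = (if q = 0 then 0 else h p (q - 1))"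

text \<open>\<open>shift_q\<close> supplies one more factor (-y)^(-1), which left multiplication by
  y turns into -1.\<close>

lemma series_k_shift_q: "series_k (shift_q h) i (j - 1) + of_int (i + 1) * series_k (shift_q h) (i + 1) j = - series_k h i j"
proof -
  consider "i < -1 \<or> j > 1" | "i = -1" | "j = 1" | "i \<ge> 0" "j \<le> 0" by linarith
  then show ?thesis
  proof cases
    case 4
    define q p where "q = nat (- j)" and "p = nat i"
    have ij: "i = int p" "j = - int q" using 4 by (simp_all add: q_def p_def)
    have q1: "nat (- (- int q)) = q" "nat (- (- int q - 1)) = Suc q" "nat (int p + 1) = Suc p" by simp_all
    let ?h = "\<lambda>m. h (p + m) (q - m)" and ?p = "\<lambda>m. pochhammer (of_nat p + 1 :: complex) m"
    have 1: "series_k (shift_q h) i (j - 1) = - ((-1) ^ q * (\<Sum>m\<le>q. of_nat (q choose m) * ?p m * ?h m))"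
    proof -
      have "(\<Sum>m\<le>Suc q. of_nat (q choose m) * ?p m * shift_q h (p + m) (Suc q - m))
        = (\<Sum>m\<le>q. of_nat (q choose m) * ?p m * ?h m)"
        unfolding sum.atMost_Suc by (simp add: shift_q_def Suc_diff_le)
      then show ?thesis unfolding ij series_k_def q1 by simp
    qed
    have 2: "of_int (i + 1) * series_k (shift_q h) (i + 1) j
      = (-1) ^ q * (\<Sum>m\<le>q. of_nat (q choose m) * ?p m * ?h m) - series_k h i j"
    proof (cases q)
      case 0
      then show ?thesis unfolding ij series_k_def q1 by (simp add: shift_q_def)
    next
      case (Suc q')
      have p2: "(of_nat p + 1) * pochhammer (of_nat p + 2 :: complex) m = ?p (Suc m)" for m
        by (simp add: pochhammer_rec add.assoc)
      have "of_int (i + 1) * series_k (shift_q h) (i + 1) j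
        = (-1) ^ q * (\<Sum>m\<le>q. of_nat (q' choose m) * ((of_nat p + 1) * pochhammer (of_nat p + 2) m) * shift_q h (Suc p + m) (q - m))"
        unfolding ij series_k_def q1 using Suc
        by (simp add: sum_distrib_left mult_ac add.commute[of _ 2] del: sum.atMost_Suc)
      also have "(\<Sum>m\<le>q. of_nat (q' choose m) * ((of_nat p + 1) * pochhammer (of_nat p + 2) m) * shift_q h (Suc p + m) (q - m))
        = (\<Sum>m\<le>q'. of_nat (q' choose m) * ?p (Suc m) * ?h (Suc m))"
        unfolding p2 Suc sum.atMost_Suc by (simp add: shift_q_def)
      also have "\<dots> = (\<Sum>m\<le>q'. (of_nat (q choose Suc m) - of_nat ((q - 1) choose Suc m)) * ?p (Suc m) * ?h (Suc m))"
        using Suc by simp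
      also have "\<dots> = (\<Sum>m\<le>q. (of_nat (q choose m) - of_nat ((q - 1) choose m)) * ?p m * ?h m)"
        unfolding Suc by (subst sum.atMost_Suc_shift) simp
      finally show ?thesis
        unfolding ij series_k_def q1 by (simp add: left_diff_distrib right_diff_distrib sum_subtractf)
    qed
    show ?thesis unfolding 1 2 by simp
  qed (auto simp: series_k_def shift_q_def)
qed

lemma series_k_order: "(\<And>p q. p > P \<Longrightarrow> h p q = 0) \<Longrightarrow> i > int P \<Longrightarrow> series_k h i j = 0"
  by (auto simp: series_k_def intro!: sum.neutral)

text \<open>Multiplying by \<open>sD \<alpha>\<close> gives a recursion that lowers the power of y
  but also involves the next higher power of x. Hence two downward inductions, in x outside and in y
  inside; the bound \<open>P\<close> helps to start the outer one. The sign reflects x' + \<alpha> =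
  -(d/dx - \<alpha>).\<close>

lemma series_k_Di:
  assumes u: "\<And>i j. sc u i j = series_k h i j" and P: "\<And>p q. p > P \<Longrightarrow> h p q = 0"
  shows "sc (sDi \<alpha> * u) i j = - series_k (resolvent (- \<alpha>) h) i j"
proof -
  define v where "v = sDi \<alpha> * u"
  define G where "G = series_k (resolvent (- \<alpha>) h)"
  have "sD \<alpha> * v = u" unfolding v_def by (simp add: mult.assoc[symmetric] sD_inverse)
  then have rec: "sc v i (j - 1) - \<alpha> * sc v i j + of_int (i + 1) * sc v (i + 1) j = series_k h i j" for i j
    using sc_sD[of \<alpha> v i j] u[of i j] by simp
  have G: "G i (j - 1) - \<alpha> * G i j + of_int (i + 1) * G (i + 1) j = - series_k h i j" for i j
  proof -
    have "resolvent (- \<alpha>) h = shift_q (\<lambda>p q. h p q - \<alpha> * resolvent (- \<alpha>) h p q)"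
    proof (intro ext)
      fix p q show "resolvent (- \<alpha>) h p q = shift_q (\<lambda>p q. h p q - \<alpha> * resolvent (- \<alpha>) h p q) p q"
        by (cases q) (simp_all add: shift_q_def resolvent_Suc)
    qed
    then have "G i (j - 1) + of_int (i + 1) * G (i + 1) j = - series_k (\<lambda>p q. h p q - \<alpha> * resolvent (- \<alpha>) h p q) i j"
      unfolding G_def by (metis series_k_shift_q)
    also have "\<dots> = - series_k h i j + \<alpha> * G i j" by (simp add: series_k_diff series_k_cmult G_def)
    finally show ?thesis by (simp add: algebra_simps)
  qed
  have Gp: "G i j = 0" if "i > int P" for i j
    unfolding G_def by (rule series_k_order[OF _ that]) (simp add: resolvent_def P)
  obtain K where K: "\<forall>i>K. \<forall>j. sc v i j = 0" using symbol_outer_bound by blast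
  have "\<forall>j. sc v i j + G i j = 0" for i
  proof (rule int_downward_induct[of "max K (int P)"])
    fix i assume "max K (int P) < i"
    then show "\<forall>j. sc v i j + G i j = 0" using K Gp by simp
  next
    fix i assume IH: "\<forall>j. sc v (i + 1) j + G (i + 1) j = 0"
    have step: "sc v i (j - 1) + G i (j - 1) = \<alpha> * (sc v i j + G i j)" for j
    proof -
      have "sc v i (j - 1) + G i (j - 1) - \<alpha> * (sc v i j + G i j) + of_int (i + 1) * (sc v (i + 1) j + G (i + 1) j) = 0"
      proof -
        have "sc v i (j - 1) + G i (j - 1) - \<alpha> * (sc v i j + G i j) + of_int (i + 1) * (sc v (i + 1) j + G (i + 1) j)
          = (sc v i (j - 1) - \<alpha> * sc v i j + of_int (i + 1) * sc v (i + 1) j)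
          + (G i (j - 1) - \<alpha> * G i j + of_int (i + 1) * G (i + 1) j)"
          by (simp add: algebra_simps)
        then show ?thesis unfolding rec G by simp
      qed
      then show ?thesis using IH by simp
    qed
    obtain L where L: "\<forall>j>L. sc v i j = 0" using symbol_inner_bound by blast
    have "sc v i j + G i j = 0" for j
    proof (rule int_downward_induct[of "max L 0"])
      fix j assume "max L 0 < j"
      then show "sc v i j + G i j = 0" using L by (simp add: G_def series_k_def)
    next
      fix j assume "sc v i (j + 1) + G i (j + 1) = 0"
      then show "sc v i j + G i j = 0" using step[of "j + 1"] by simp
    qed
    then show "\<forall>j. sc v i j + G i j = 0" by blast
  qed
  then show ?thesis by (simp add: v_def G_def eq_neg_iff_add_eq_0)
qed

lemma xi_d_supported: "c \<in> {1..k} \<times> {1..n} \<Longrightarrow> endo_supported k n (xi_d k n c d)"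
  unfolding endo_supported_def xi_d_def idxs_def by auto

definition dop_order :: "dop \<Rightarrow> nat \<Rightarrow> bool" where
  "dop_order f P \<longleftrightarrow> (\<forall>p q. p > P \<longrightarrow> f p q = ezero)"

lemma ezero_apply [simp]: "ezero S T = 0" by (simp add: ezero_def)

text \<open>Additivity is listed once per index type, as a predicate cannot quantify over
  types.\<close>

definition sc_linear :: "((nat \<Rightarrow> nat \<Rightarrow> complex) \<Rightarrow> int \<Rightarrow> int \<Rightarrow> complex) \<Rightarrow> bool" where
  "sc_linear \<Phi> \<longleftrightarrow> (\<forall>c h i j. \<Phi> (\<lambda>p q. c * h p q) i j = c * \<Phi> h i j)
     \<and> (\<forall>h h' i j. \<Phi> (\<lambda>p q. h p q - h' p q) i j = \<Phi> h i j - \<Phi> h' i j)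
     \<and> (\<forall>(B :: nat set) g i j. \<Phi> (\<lambda>p q. \<Sum>a\<in>B. g a p q) i j = (\<Sum>a\<in>B. \<Phi> (g a) i j))
     \<and> (\<forall>(B :: (nat \<times> nat) set set) g i j. \<Phi> (\<lambda>p q. \<Sum>a\<in>B. g a p q) i j = (\<Sum>a\<in>B. \<Phi> (g a) i j))
     \<and> (\<forall>(B :: (nat \<Rightarrow> nat) set) g i j. \<Phi> (\<lambda>p q. \<Sum>a\<in>B. g a p q) i j = (\<Sum>a\<in>B. \<Phi> (g a) i j))"

lemma sc_linear_series_n: "sc_linear series_n" and sc_linear_series_k: "sc_linear series_k"
  by (simp_all add: sc_linear_def series_n_diff series_n_cmult series_n_sum series_k_diff series_k_cmult series_k_sum)

lemma of_int_sc: "sc (of_int a * u) i j = of_int a * sc u i j"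
proof -
  have nat: "sc (of_nat m * u) i j = of_nat m * sc u i j" for m
    by (induction m) (simp_all add: distrib_right)
  show ?thesis
  proof (cases "a \<ge> 0")
    case True
    then show ?thesis using nat[of "nat a"] by (simp add: of_nat_nat)
  next
    case False
    then have "(of_int a :: symbol) = - of_nat (nat (- a))" "(of_int a :: complex) = - of_nat (nat (- a))"
      by (simp_all add: of_nat_nat)
    then show ?thesis using nat[of "nat (- a)"] by simp
  qed
qed

lemma app_of_int: "app (of_int a * B) v s = of_int a * app B v s"
proof -
  have nat: "app (of_nat m * B) v s = of_nat m * app B v s" for m
    by (induction m) (simp_all add: distrib_right)
  show ?thesis
  proof (cases "a \<ge> 0")
    case True
    then show ?thesis using nat[of "nat a"] by (simp only: of_nat_nat)
  next
    case False
    then have "of_int a * B = - (of_nat (nat (- a)) * B)" "of_int a * app B v s = - (of_nat (nat (- a)) * app B v s)"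
      by (simp_all add: of_nat_nat)
    then show ?thesis using nat[of "nat (- a)"] by simp
  qed
qed

lemma endo_supported_dop_mul:
  assumes f: "\<And>p q. endo_supported k n (f p q)" and A: "finite A"
    and g: "\<And>s. g j i s = esum A (\<lambda>a. escale (w a ^ s) (E a))"
    and E: "\<And>a. a \<in> A \<Longrightarrow> endo_supported k n (E a)"
  shows "endo_supported k n (dop_mul k n (univ_entry k n \<beta> g i j) f p q)"
  unfolding endo_supported_def dop_mul_univ_entry[of k n f A g j i w E, OF f A g]
  using f E by (auto simp: endo_supported_def ddx_def resolvent_def intro!: sum.neutral)

lemma dop_order_dop_mul:
  assumes f: "\<And>p q. endo_supported k n (f p q)" and A: "finite A"
    and g: "\<And>s. g j i s = esum A (\<lambda>a. escale (w a ^ s) (E a))"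
    and P: "dop_order f P"
  shows "dop_order (dop_mul k n (univ_entry k n \<beta> g i j) f) (Suc P)"
  unfolding dop_order_def fun_eq_iff dop_mul_univ_entry[of k n f A g j i w E, OF f A g]
  using P by (auto simp: dop_order_def ddx_def resolvent_def intro!: sum.neutral)

lemma endo_supported_dop_one: "endo_supported k n (dop_one k n p q)"
  by (auto simp: endo_supported_def dop_one_def eone_def)

lemma dop_order_dop_one: "dop_order (dop_one k n) 0"
  by (auto simp: dop_order_def dop_one_def)

section \<open>Universal operators as row determinants on the Fock space\<close>

context fock
begin

lemma supported_triple:
  assumes "supported v" "c \<in> {1..k} \<times> {1..n}" "d \<in> {1..k} \<times> {1..n}"
  shows "supported (app (fop True (Xi c) * fop False (Xi d) * lmul r) v)"
  unfolding app_simps(6)[of _ "lmul r"] by (rule supported_pair[OF supported_simps(1)[OF assms(1)] assms(2,3)])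

text \<open>The vector \<open>v\<close> stands for column \<open>T\<close> of the family
  \<open>f\<close>. The map \<open>F\<close> turns families into symbols: \<open>series_n\<close>
  directly, \<open>series_k\<close> through the Fourier transform.\<close>

definition rep where
  "rep F v f T \<longleftrightarrow> supported v \<and> (\<forall>S\<in>idxs k n. \<forall>i j. sc (v (st S)) i j = F (\<lambda>p q. f p q S T) i j)"

lemma rep_one_series_n: "T \<in> idxs k n \<Longrightarrow> rep series_n (ket (st T)) (dop_one k n) T"
  by (auto simp: rep_def supported_ket sc_ket series_n_def dop_one_def eone_def)

lemma rep_one_series_k: "T \<in> idxs k n \<Longrightarrow> rep series_k (ket (st T)) (dop_one k n) T"
proof -
  assume T: "T \<in> idxs k n"
  have "series_k (\<lambda>p q. dop_one k n p q S T) i j = (if S = T \<and> i = 0 \<and> j = 0 then 1 else 0)" for S i j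
  proof (cases "i \<ge> 0 \<and> j \<le> 0")
    case True
    have "of_nat ((nat (- j) - 1) choose m) * pochhammer (of_int (i + 1)) m * dop_one k n (nat i + m) (nat (- j) - m) S T
      = (if m = 0 then if S = T \<and> i = 0 \<and> j = 0 then 1 else 0 else (0::complex))" if "m \<le> nat (- j)" for m
      using True T that by (cases "m = nat (- j)") (auto simp: dop_one_def eone_def binomial_eq_0)
    then have "(\<Sum>m\<le>nat (- j). of_nat ((nat (- j) - 1) choose m) * pochhammer (of_int (i + 1)) m * dop_one k n (nat i + m) (nat (- j) - m) S T)
      = (\<Sum>m\<le>nat (- j). if m = 0 then if S = T \<and> i = 0 \<and> j = 0 then 1 else 0 else (0::complex))"
      by (intro sum.cong) auto
    then show ?thesis using True by (auto simp: series_k_def)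
  qed (auto simp: series_k_def)
  then show ?thesis using T by (simp add: rep_def supported_ket sc_ket)
qed

lemma rep_M:
  assumes ij: "i \<in> {1..n}" "j \<in> {1..n}" and f: "\<And>p q. endo_supported k n (f p q)" and v: "rep series_n v f T"
  shows "rep series_n (app (M i j) v) (dop_mul k n (univ_entry k n \<alpha> (pi_n k n z) i j) f) T"
proof -
  have g: "pi_n k n z j i s = esum {1..k} (\<lambda>a. escale (z a ^ s) (xi_d k n (a, j) (a, i)))" for s
    by (simp add: pi_n_def)
  have sup: "supported (app (M i j) v)"
    unfolding M_def using ij v
    by (intro supported_simps supported_sum) (auto intro!: supported_simps supported_triple simp: rep_def simp del: app_simps(6))
  have "sc (app (M i j) v (st S)) x y = series_n (\<lambda>p q. dop_mul k n (univ_entry k n \<alpha> (pi_n k n z) i j) f p q S T) x y"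
    if S: "S \<in> idxs k n" for S x y
  proof -
    let ?h = "\<lambda>R p q. f p q R T"
    have h: "sc (v (st R)) x y = series_n (?h R) x y" if "R \<in> idxs k n" for R x y
      using v that by (simp add: rep_def)
    have pair: "sc (app (fop True (Xi (a, j)) * fop False (Xi (a, i)) * lmul (sXi (z a))) v (st S)) x y
      = (\<Sum>R\<in>idxs k n. xi_d k n (a, j) (a, i) S R * series_n (resolvent (z a) (?h R)) x y)" if "a \<in> {1..k}" for a
      using sc_pair[OF S, of "(a, j)" "(a, i)" "app (lmul (sXi (z a))) v"] that ij series_n_Xi[OF h]
      by (simp cong: sum.cong)
    have sumpair: "(\<Sum>a\<in>{1..k}. sc (app (fop True (Xi (a, j)) * fop False (Xi (a, i)) * lmul (sXi (z a))) v (st S)) x y)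
      = (\<Sum>a\<in>{1..k}. \<Sum>R\<in>idxs k n. xi_d k n (a, j) (a, i) S R * series_n (resolvent (z a) (?h R)) x y)"
      by (rule sum.cong[OF refl]) (rule pair)
    have "sc (app (M i j) v (st S)) x y = (if i = j then series_n (\<lambda>r q. ddx (?h S) r q - \<alpha> i * ?h S r q) x y else 0)
      - (\<Sum>a\<in>{1..k}. \<Sum>R\<in>idxs k n. xi_d k n (a, j) (a, i) S R * series_n (resolvent (z a) (?h R)) x y)"
      unfolding M_def app_simps(4) sc_diff app_sum_left sc_sum sumpair using series_n_D[OF h[OF S]] by simp
    also have "\<dots> = series_n (\<lambda>r q. (if i = j then ddx (?h S) r q - \<alpha> i * ?h S r q else 0)
      - (\<Sum>a\<in>{1..k}. \<Sum>R\<in>idxs k n. xi_d k n (a, j) (a, i) S R * resolvent (z a) (?h R) r q)) x y"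
      unfolding series_n_diff series_n_sum series_n_cmult by (simp add: series_n_zero series_n_diff series_n_cmult)
    finally show ?thesis
      unfolding dop_mul_univ_entry[of k n f "{1..k}" "pi_n k n z" j i z, OF f finite_atLeastAtMost g] .
  qed
  then show ?thesis using sup by (simp add: rep_def)
qed

text \<open>The order \<open>P\<close> in d/dx' becomes a bound on the power of x for
  \<open>series_k_Di\<close>. The sign in \<open>series_k_Di\<close> turns the minus before the
  generators in \<open>univ_entry\<close> into the plus in \<open>M_dual\<close>.\<close>

lemma rep_M_dual:
  assumes ij: "i \<in> {1..k}" "j \<in> {1..k}" and f: "\<And>p q. endo_supported k n (f p q)" and P: "dop_order f P"
    and v: "rep series_k v f T"
  shows "rep series_k (app (M_dual i j) v) (dop_mul k n (univ_entry k n z (pi_k k n \<alpha>) i j) f) T"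
proof -
  have g: "pi_k k n \<alpha> j i s = esum {1..n} (\<lambda>a. escale ((- \<alpha> a) ^ s) (xi_d k n (j, a) (i, a)))" for s
    by (simp add: pi_k_def)
  have sup: "supported (app (M_dual i j) v)"
    unfolding M_dual_def using ij v
    by (intro supported_simps supported_sum) (auto intro!: supported_simps supported_triple simp: rep_def simp del: app_simps(6))
  have "sc (app (M_dual i j) v (st S)) x y = series_k (\<lambda>p q. dop_mul k n (univ_entry k n z (pi_k k n \<alpha>) i j) f p q S T) x y"
    if S: "S \<in> idxs k n" for S x y
  proof -
    let ?h = "\<lambda>R p q. f p q R T"
    have h: "sc (v (st R)) x y = series_k (?h R) x y" if "R \<in> idxs k n" for R x y
      using v that by (simp add: rep_def)
    have Di: "sc (sDi b * v (st R)) x y = - series_k (resolvent (- b) (?h R)) x y" if "R \<in> idxs k n" for R x y b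
      by (rule series_k_Di[of _ _ P]) (use h that P in \<open>auto simp: dop_order_def\<close>)
    have pair: "sc (app (fop True (Xi (j, a)) * fop False (Xi (i, a)) * lmul (sDi (\<alpha> a))) v (st S)) x y
      = - (\<Sum>R\<in>idxs k n. xi_d k n (j, a) (i, a) S R * series_k (resolvent (- \<alpha> a) (?h R)) x y)" if "a \<in> {1..n}" for a
      using sc_pair[OF S, of "(j, a)" "(i, a)" "app (lmul (sDi (\<alpha> a))) v"] that ij Di
      by (simp add: sum_negf cong: sum.cong)
    have sumpair: "(\<Sum>a\<in>{1..n}. sc (app (fop True (Xi (j, a)) * fop False (Xi (i, a)) * lmul (sDi (\<alpha> a))) v (st S)) x y)
      = (\<Sum>a\<in>{1..n}. - (\<Sum>R\<in>idxs k n. xi_d k n (j, a) (i, a) S R * series_k (resolvent (- \<alpha> a) (?h R)) x y))"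
      by (rule sum.cong[OF refl]) (rule pair)
    have "sc (app (M_dual i j) v (st S)) x y = (if i = j then series_k (\<lambda>r q. ddx (?h S) r q - z i * ?h S r q) x y else 0)
      - (\<Sum>a\<in>{1..n}. \<Sum>R\<in>idxs k n. xi_d k n (j, a) (i, a) S R * series_k (resolvent (- \<alpha> a) (?h R)) x y)"
      unfolding M_dual_def app_simps(3) sc_add app_sum_left sc_sum sumpair using series_k_X[OF h[OF S]]
      by (simp add: sum_negf)
    also have "\<dots> = series_k (\<lambda>r q. (if i = j then ddx (?h S) r q - z i * ?h S r q else 0)
      - (\<Sum>a\<in>{1..n}. \<Sum>R\<in>idxs k n. xi_d k n (j, a) (i, a) S R * resolvent (- \<alpha> a) (?h R) r q)) x y"
      unfolding series_k_diff series_k_sum series_k_cmult by (simp add: series_k_zero series_k_diff series_k_cmult)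
    finally show ?thesis
      unfolding dop_mul_univ_entry[of k n f "{1..n}" "pi_k k n \<alpha>" j i "\<lambda>a. - \<alpha> a", OF f finite_atLeastAtMost g] .
  qed
  then show ?thesis using sup by (simp add: rep_def)
qed

text \<open>\<open>dop_prod\<close> folds from the right, just as operators are applied to a vector,
  so \<open>step\<close> can be used factor by factor. Support and order of the partial products are
  carried along because \<open>step\<close> asks for them.\<close>

lemma rep_dop_rdet:
  assumes lin: "sc_linear F" and T: "T \<in> idxs k n"
    and one: "rep F (ket (st T)) (dop_one k n) T"
    and step: "\<And>i j v f P. i \<in> {1..L} \<Longrightarrow> j \<in> {1..L} \<Longrightarrow> (\<And>p q. endo_supported k n (f p q)) \<Longrightarrow> dop_order f P
      \<Longrightarrow> rep F v f T \<Longrightarrow> rep F (app (W i j) v) (dop_mul k n (univ_entry k n b g i j) f) T"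
    and B: "finite B" and g: "\<And>i j s. g j i s = esum B (\<lambda>a. escale (w a ^ s) (E i j a))"
    and E: "\<And>i j a. i \<in> {1..L} \<Longrightarrow> j \<in> {1..L} \<Longrightarrow> a \<in> B \<Longrightarrow> endo_supported k n (E i j a)"
  shows "rep F (app (row_det L W) (ket (st T))) (univ_op k n L b g) T"
proof -
  let ?ent = "univ_entry k n b g"
  let ?f = "\<lambda>\<sigma> l. dop_prod k n (map (\<lambda>i. ?ent i (\<sigma> i)) l)"
  let ?v = "\<lambda>\<sigma> l. app (prod_list (map (\<lambda>i. W i (\<sigma> i)) l)) (ket (st T))"
  have all: "rep F (?v \<sigma> l) (?f \<sigma> l) T \<and> (\<forall>p q. endo_supported k n (?f \<sigma> l p q)) \<and> dop_order (?f \<sigma> l) (length l)"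
    if \<sigma>: "\<sigma> permutes {1..L}" and l: "set l \<subseteq> {1..L}" for \<sigma> l
    using l
  proof (induction l)
    case Nil
    then show ?case using one by (simp add: dop_prod_def endo_supported_dop_one dop_order_dop_one)
  next
    case (Cons i l)
    then have i: "i \<in> {1..L}" "\<sigma> i \<in> {1..L}" using permutes_in_image[OF \<sigma>] by auto
    have f: "?f \<sigma> (i # l) = dop_mul k n (?ent i (\<sigma> i)) (?f \<sigma> l)" by (simp add: dop_prod_def)
    have IH: "rep F (?v \<sigma> l) (?f \<sigma> l) T" "\<And>p q. endo_supported k n (?f \<sigma> l p q)" "dop_order (?f \<sigma> l) (length l)"
      using Cons by auto
    show ?case unfolding f
      using step[OF i IH(2,3,1)]
        endo_supported_dop_mul[of k n "?f \<sigma> l" B g "\<sigma> i" i w "E i (\<sigma> i)", OF IH(2) B g E[OF i]]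
        dop_order_dop_mul[of k n "?f \<sigma> l" B g "\<sigma> i" i w "E i (\<sigma> i)", OF IH(2) B g IH(3)]
      by simp
  qed
  have rep: "rep F (?v \<sigma> [1..<L+1]) (?f \<sigma> [1..<L+1]) T" if "\<sigma> permutes {1..L}" for \<sigma>
    by (rule conjunct1[OF all[OF that]]) auto
  have app: "app (row_det L W) (ket (st T)) s = (\<Sum>\<sigma> | \<sigma> permutes {1..L}. of_int (sign \<sigma>) * ?v \<sigma> [1..<L+1] s)" for s
    unfolding row_det_def app_sum_left app_of_int ..
  show ?thesis
    unfolding rep_def
  proof (intro conjI ballI allI)
    show "supported (app (row_det L W) (ket (st T)))"
      unfolding supported_def app using rep by (auto simp: rep_def supported_def intro!: sum.neutral)
    fix S i j assume S: "S \<in> idxs k n"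
    have "sc (app (row_det L W) (ket (st T)) (st S)) i j
      = (\<Sum>\<sigma> | \<sigma> permutes {1..L}. of_int (sign \<sigma>) * F (\<lambda>p q. ?f \<sigma> [1..<L+1] p q S T) i j)"
      unfolding app sc_sum of_int_sc using rep S by (simp add: rep_def del: upt_Suc)
    also have "\<dots> = F (\<lambda>p q. \<Sum>\<sigma> | \<sigma> permutes {1..L}. of_int (sign \<sigma>) * ?f \<sigma> [1..<L+1] p q S T) i j"
      using lin unfolding sc_linear_def by (simp del: upt_Suc)
    finally show "sc (app (row_det L W) (ket (st T)) (st S)) i j = F (\<lambda>p q. univ_op k n L b g p q S T) i j"
      by (simp add: univ_op_def dop_rdet_def esum_def escale_def del: upt_Suc)
  qed
qed

lemma rep_row_det_M:
  "T \<in> idxs k n \<Longrightarrow> rep series_n (app (row_det n M) (ket (st T))) (univ_op k n n \<alpha> (pi_n k n z)) T"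
  by (rule rep_dop_rdet[where B = "{1..k}" and w = z and E = "\<lambda>i j a. xi_d k n (a, j) (a, i)"])
    (auto simp: sc_linear_series_n rep_one_series_n pi_n_def intro!: rep_M xi_d_supported)

lemma rep_row_det_M_dual:
  "T \<in> idxs k n \<Longrightarrow> rep series_k (app (row_det k M_dual) (ket (st T))) (univ_op k n k z (pi_k k n \<alpha>)) T"
  by (rule rep_dop_rdet[where B = "{1..n}" and w = "\<lambda>a. - \<alpha> a" and E = "\<lambda>i j a. xi_d k n (j, a) (i, a)"])
    (auto simp: sc_linear_series_k rep_one_series_k pi_k_def intro!: rep_M_dual xi_d_supported)

end

text \<open>Only diagonal entries contain d/dx, so order \<open>L\<close> is reached by the identity
  permutation alone. The generators enter with negative powers of x, so the coefficients of x^0 are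
  scalars.\<close>

lemma univ_op_structure:
  assumes A: "finite A" and g: "\<And>i j s. g j i s = esum A (\<lambda>a. escale (w a ^ s) (E i j a))"
    and E: "\<And>i j a. i \<in> {1..L} \<Longrightarrow> j \<in> {1..L} \<Longrightarrow> a \<in> A \<Longrightarrow> endo_supported k n (E i j a)"
  shows "endo_supported k n (univ_op k n L \<beta> g p q)"
    and "p > L \<Longrightarrow> univ_op k n L \<beta> g p q = ezero"
    and "univ_op k n L \<beta> g L q = (if q = 0 then eone k n else ezero)"
    and "\<exists>c. univ_op k n L \<beta> g p 0 = escale c (eone k n)"
proof -
  let ?ent = "univ_entry k n \<beta> g"
  let ?f = "\<lambda>\<sigma> l. dop_prod k n (map (\<lambda>i. ?ent i (\<sigma> i)) l)"
  let ?good = "\<lambda>\<sigma> l. (\<forall>p q. endo_supported k n (?f \<sigma> l p q)) \<and> dop_order (?f \<sigma> l) (length l)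
     \<and> (\<forall>q S T. ?f \<sigma> l (length l) q S T = (if q = 0 \<and> (\<forall>i\<in>set l. \<sigma> i = i) then eone k n S T else 0))
     \<and> (\<forall>p. \<exists>c. \<forall>S T. ?f \<sigma> l p 0 S T = c * eone k n S T)"
  have all: "?good \<sigma> l" if \<sigma>: "\<sigma> permutes {1..L}" and l: "set l \<subseteq> {1..L}" for \<sigma> l
    using l
  proof (induction l)
    case Nil
    have "\<exists>c. \<forall>S T. dop_one k n p 0 S T = c * eone k n S T" for p
      by (rule exI[of _ "if p = 0 then 1 else 0"]) (simp add: dop_one_def)
    then show ?case by (simp add: dop_prod_def endo_supported_dop_one dop_order_dop_one) (simp add: dop_one_def)
  next
    case (Cons i l)
    then have i: "i \<in> {1..L}" "\<sigma> i \<in> {1..L}" using permutes_in_image[OF \<sigma>] by auto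
    have f: "?f \<sigma> (i # l) = dop_mul k n (?ent i (\<sigma> i)) (?f \<sigma> l)" by (simp add: dop_prod_def)
    have IH: "\<And>p q. endo_supported k n (?f \<sigma> l p q)" "dop_order (?f \<sigma> l) (length l)"
      "\<And>q S T. ?f \<sigma> l (length l) q S T = (if q = 0 \<and> (\<forall>i\<in>set l. \<sigma> i = i) then eone k n S T else 0)"
      "\<And>p. \<exists>c. \<forall>S T. ?f \<sigma> l p 0 S T = c * eone k n S T"
      using Cons by auto
    have zero: "?f \<sigma> l p q S T = 0" if "p > length l" for p q S T using IH(2) that by (simp add: dop_order_def)
    note mul = dop_mul_univ_entry[of k n "?f \<sigma> l" A g "\<sigma> i" i w "E i (\<sigma> i)", OF IH(1) A g]
    show ?case
    proof (intro conjI allI)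
      show "endo_supported k n (?f \<sigma> (i # l) p q)" for p q
        unfolding f 
        by (rule endo_supported_dop_mul[of k n "?f \<sigma> l" A g "\<sigma> i" i w "E i (\<sigma> i)", OF IH(1) A g E[OF i]])
      show "dop_order (?f \<sigma> (i # l)) (length (i # l))"
        unfolding f
        using dop_order_dop_mul[of k n "?f \<sigma> l" A g "\<sigma> i" i w "E i (\<sigma> i)", OF IH(1) A g IH(2)] by simp
      show "?f \<sigma> (i # l) (length (i # l)) q S T = (if q = 0 \<and> (\<forall>i\<in>set (i # l). \<sigma> i = i) then eone k n S T else 0)" for q S T
        unfolding f mul by (auto simp: ddx_def resolvent_def zero IH(3))
      show "\<exists>c. \<forall>S T. ?f \<sigma> (i # l) p 0 S T = c * eone k n S T" for p
      proof -
        obtain c1 c2 where c: "\<And>S T. ?f \<sigma> l (p - Suc 0) 0 S T = c1 * eone k n S T" "\<And>S T. ?f \<sigma> l p 0 S T = c2 * eone k n S T"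
          using IH(4) by metis
        show ?thesis unfolding f mul
          by (rule exI[of _ "if i = \<sigma> i then (if p \<ge> 1 then c1 else 0) - \<beta> i * c2 else 0"])
            (simp add: ddx_def c left_diff_distrib)
      qed
    qed
  qed
  have good: "?good \<sigma> [1..<L+1]" if "\<sigma> permutes {1..L}" for \<sigma> by (rule all[OF that]) auto
  have d: "univ_op k n L \<beta> g p q S T = (\<Sum>\<sigma> | \<sigma> permutes {1..L}. of_int (sign \<sigma>) * ?f \<sigma> [1..<L+1] p q S T)" for p q S T
    by (simp add: univ_op_def dop_rdet_def esum_def escale_def del: upt_Suc)
  show "endo_supported k n (univ_op k n L \<beta> g p q)"
    using good unfolding endo_supported_def d by (auto intro!: sum.neutral simp del: upt_Suc)
  show "univ_op k n L \<beta> g p q = ezero" if "p > L"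
    using good that unfolding fun_eq_iff d dop_order_def by (auto intro!: sum.neutral simp del: upt_Suc)
  have len: "length [1..<L+1] = L" by simp
  show "univ_op k n L \<beta> g L q = (if q = 0 then eone k n else ezero)"
  proof (intro ext)
    fix S T
    have "univ_op k n L \<beta> g L q S T
      = (\<Sum>\<sigma> | \<sigma> permutes {1..L}. if \<sigma> = id then (if q = 0 then eone k n S T else 0) else 0)"
      unfolding d
    proof (rule sum.cong[OF refl])
      fix \<sigma> assume "\<sigma> \<in> {\<sigma>. \<sigma> permutes {1..L}}"
      then have \<sigma>: "\<sigma> permutes {1..L}" by simp
      have "(\<forall>i\<in>set [1..<L+1]. \<sigma> i = i) \<longleftrightarrow> \<sigma> = id"
      proof -
        have "set [1..<L+1] = {1..L}" by auto
        then show ?thesis using permutes_not_in[OF \<sigma>] unfolding fun_eq_iff id_apply by metis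
      qed
      then show "of_int (sign \<sigma>) * ?f \<sigma> [1..<L+1] L q S T = (if \<sigma> = id then (if q = 0 then eone k n S T else 0) else 0)"
        using good[OF \<sigma>] unfolding len by (auto simp: sign_id simp del: upt_Suc)
    qed
    then show "univ_op k n L \<beta> g L q S T = (if q = 0 then eone k n else ezero) S T"
      by (simp add: permutes_id finite_permutations)
  qed
  show "\<exists>c. univ_op k n L \<beta> g p 0 = escale c (eone k n)"
  proof -
    have "\<forall>\<sigma>. \<exists>c. \<sigma> permutes {1..L} \<longrightarrow> (\<forall>S T. ?f \<sigma> [1..<L+1] p 0 S T = c * eone k n S T)" using good by blast
    then obtain c where "\<And>\<sigma> S T. \<sigma> permutes {1..L} \<Longrightarrow> ?f \<sigma> [1..<L+1] p 0 S T = c \<sigma> * eone k n S T" by metis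
    then show ?thesis
      by (intro exI[of _ "\<Sum>\<sigma> | \<sigma> permutes {1..L}. of_int (sign \<sigma>) * c \<sigma>"])
        (simp add: fun_eq_iff d escale_def sum_distrib_right mult.assoc del: upt_Suc)
  qed
qed

section \<open>Extraction of coefficients\<close>

definition subalgebra :: "nat \<Rightarrow> nat \<Rightarrow> endo set \<Rightarrow> bool" where
  "subalgebra k n S \<longleftrightarrow> eone k n \<in> S \<and> (\<forall>A\<in>S. \<forall>B\<in>S. eadd A B \<in> S \<and> emul k n A B \<in> S) \<and> (\<forall>A\<in>S. \<forall>c. escale c A \<in> S)"

lemma subalgebra_subalg: "subalgebra k n (subalg k n G)"
  by (auto simp: subalgebra_def intro: subalg.intros)

lemma subalg_minimal: "subalgebra k n S \<Longrightarrow> G \<subseteq> S \<Longrightarrow> subalg k n G \<subseteq> S"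
proof
  fix B assume S: "subalgebra k n S" "G \<subseteq> S" "B \<in> subalg k n G"
  from S(3) show "B \<in> S" by induction (use S(1,2) in \<open>auto simp: subalgebra_def\<close>)
qed

context
  fixes k n :: nat and S :: "endo set"
  assumes S: "subalgebra k n S"
begin

lemma subalgebra_zero: "(\<lambda>P Q. 0) \<in> S"
proof -
  have "escale 0 (eone k n) \<in> S" using S by (simp add: subalgebra_def)
  then show ?thesis by (simp add: escale_def)
qed

lemma subalgebra_lincomb: "A \<in> S \<Longrightarrow> B \<in> S \<Longrightarrow> (\<lambda>P Q. c * A P Q + d * B P Q) \<in> S"
proof -
  assume "A \<in> S" "B \<in> S"
  then have "eadd (escale c A) (escale d B) \<in> S" using S by (simp add: subalgebra_def)
  then show ?thesis by (simp add: eadd_def escale_def)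
qed

lemma subalgebra_sum: "(\<And>x. x \<in> F \<Longrightarrow> f x \<in> S) \<Longrightarrow> (\<lambda>P Q. \<Sum>x\<in>F. c x * f x P Q) \<in> S"
proof (induction F rule: infinite_finite_induct)
  case (insert x F)
  then have "(\<lambda>P Q. c x * f x P Q + 1 * (\<Sum>x\<in>F. c x * f x P Q)) \<in> S"
    by (intro subalgebra_lincomb) auto
  then show ?case using insert.hyps by simp
qed (simp_all add: subalgebra_zero)

lemma subalgebra_solve:
  assumes F: "finite F" and x: "x0 \<in> F" "c x0 = 1" and sum: "(\<lambda>P Q. \<Sum>x\<in>F. c x * f x P Q) \<in> S"
    and others: "\<And>x. x \<in> F \<Longrightarrow> x \<noteq> x0 \<Longrightarrow> f x \<in> S"
  shows "f x0 \<in> S"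
proof -
  have "(\<lambda>P Q. \<Sum>x\<in>F - {x0}. c x * f x P Q) \<in> S" by (rule subalgebra_sum) (use others in auto)
  from subalgebra_lincomb[OF sum this, of 1 "-1"]
  have "(\<lambda>P Q. (\<Sum>x\<in>F. c x * f x P Q) - (\<Sum>x\<in>F - {x0}. c x * f x P Q)) \<in> S" by simp
  moreover have "(\<Sum>x\<in>F. c x * f x P Q) - (\<Sum>x\<in>F - {x0}. c x * f x P Q) = f x0 P Q" for P Q
    using sum.remove[OF F x(1), of "\<lambda>x. c x * f x P Q"] x(2) by simp
  ultimately show ?thesis by simp
qed

lemma emul_in: "A \<in> S \<Longrightarrow> B \<in> S \<Longrightarrow> emul k n A B \<in> S"
  using S by (simp add: subalgebra_def)

lemma emul_zero: "emul k n (\<lambda>P Q. 0) B = (\<lambda>P Q. 0)" "emul k n B (\<lambda>P Q. 0) = (\<lambda>P Q. 0)"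
  by (simp_all add: emul_def)

end

lemma emul_eone_right: "endo_supported k n B \<Longrightarrow> emul k n B (eone k n) = B"
proof (intro ext)
  fix P Q assume B: "endo_supported k n B"
  have "emul k n B (eone k n) P Q = (\<Sum>R\<in>idxs k n. if R = Q then B P R else 0)"
    unfolding emul_def eone_def by (intro sum.cong) auto
  then show "emul k n B (eone k n) P Q = B P Q"
    using B by (cases "Q \<in> idxs k n") (auto simp: finite_idxs endo_supported_def)
qed

definition star_box :: "int \<Rightarrow> int \<Rightarrow> int \<Rightarrow> int \<Rightarrow> int \<Rightarrow> int \<Rightarrow> (nat \<times> int \<times> int) set" where
  "star_box K L K' L' I J = {..nat (K + K' - I)} \<times> {I - K'..K} \<times> {J - L'..L}"

text \<open>Each of two series whose product is known is determined by the other one from the top down,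
  when both leading coefficients are the identity.\<close>

lemma triangular_solve:
  fixes f g :: "int \<Rightarrow> int \<Rightarrow> endo"
  assumes S: "subalgebra k n S"
    and f: "\<And>i j. endo_supported k n (f i j)" "\<And>i j. i > K \<or> j > L \<Longrightarrow> f i j = (\<lambda>P Q. 0)" "f K L = eone k n"
    and g: "\<And>i j. endo_supported k n (g i j)" "\<And>i j. i > K' \<or> j > L' \<Longrightarrow> g i j = (\<lambda>P Q. 0)" "g K' L' = eone k n"
    and fg: "\<And>I J. (\<lambda>P Q. \<Sum>(m, a, b)\<in>star_box K L K' L' I J.
        star_coeff m (I - a) b * emul k n (f a (b + int m)) (g (I - a + int m) (J - b)) P Q) \<in> S"
  shows "(\<And>i j. g i j \<in> S) \<Longrightarrow> f i j \<in> S"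
    and "(\<And>i j. f i j \<in> S) \<Longrightarrow> g i j \<in> S"
proof -
  define t where "t I J = (\<lambda>(m, a, b). emul k n (f a (b + int m)) (g (I - a + int m) (J - b)))" for I J
  define c where "c I = (\<lambda>(m, a, b). star_coeff m (I - a) b)" for I :: int
  have fin: "finite (star_box K L K' L' I J)" for I J by (simp add: star_box_def)
  have fg': "(\<lambda>P Q. \<Sum>x\<in>star_box K L K' L' I J. c I x * t I J x P Q) \<in> S" for I J
    using fg[of I J] by (simp add: t_def c_def case_prod_unfold)
  show "f i j \<in> S" if gS: "\<And>i j. g i j \<in> S"
  proof (induction "nat (K - i) + nat (L - j)" arbitrary: i j rule: less_induct)
    case less
    show ?case
    proof (cases "i > K \<or> j > L")
      case True
      then show ?thesis using f(2) subalgebra_zero[OF S] by simp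
    next
      case False
      let ?I = "i + K'" and ?J = "j + L'"
      \<comment> \<open>Here the right factor is the leading coefficient \<open>g K' L'\<close>, the
        identity. Every other nonzero term of the sum contains an \<open>f\<close> closer to the
        corner (K, L), to which the induction hypothesis applies.\<close>
      have "t ?I ?J (0, i, j) \<in> S"
      proof (rule subalgebra_solve[OF S fin _ _ fg'])
        show "(0, i, j) \<in> star_box K L K' L' ?I ?J" using False by (simp add: star_box_def)
        show "c ?I (0, i, j) = 1" by (simp add: c_def)
        fix x assume x: "x \<in> star_box K L K' L' ?I ?J" "x \<noteq> (0, i, j)"
        obtain m a b where [simp]: "x = (m, a, b)" by (cases x)
        show "t ?I ?J x \<in> S"
        proof (cases "a \<ge> i + int m \<and> b \<ge> j \<and> b + int m \<le> L")
          case True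
          then have "nat (K - a) + nat (L - (b + int m)) < nat (K - i) + nat (L - j)"
            using x by (cases "m = 0") (auto simp: star_box_def)
          then have "f a (b + int m) \<in> S" by (rule less)
          then show ?thesis by (simp add: t_def emul_in[OF S] gS)
        next
          case False
          then have "f a (b + int m) = (\<lambda>P Q. 0) \<or> g (?I - a + int m) (?J - b) = (\<lambda>P Q. 0)"
            using f(2)[of a "b + int m"] g(2)[of "?I - a + int m" "?J - b"] by force
          then show ?thesis by (auto simp: t_def emul_zero[OF S] subalgebra_zero[OF S])
        qed
      qed
      then show ?thesis by (simp add: t_def g(3) emul_eone_right[OF f(1)])
    qed
  qed
  show "g i j \<in> S" if fS: "\<And>i j. f i j \<in> S"
  proof (induction "nat (K' - i) + nat (L' - j)" arbitrary: i j rule: less_induct)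
    case less
    show ?case
    proof (cases "i > K' \<or> j > L'")
      case True
      then show ?thesis using g(2) subalgebra_zero[OF S] by simp
    next
      case False
      let ?I = "i + K" and ?J = "j + L"
      \<comment> \<open>The mirror choice: now the left factor is the leading coefficient
        \<open>f K L\<close>.\<close>
      have "t ?I ?J (0, K, L) \<in> S"
      proof (rule subalgebra_solve[OF S fin _ _ fg'])
        show "(0, K, L) \<in> star_box K L K' L' ?I ?J" using False by (simp add: star_box_def)
        show "c ?I (0, K, L) = 1" by (simp add: c_def)
        fix x assume x: "x \<in> star_box K L K' L' ?I ?J" "x \<noteq> (0, K, L)"
        obtain m a b where [simp]: "x = (m, a, b)" by (cases x)
        show "t ?I ?J x \<in> S"
        proof (cases "b + int m \<le> L \<and> ?I - a + int m \<le> K' \<and> ?J - b \<le> L'")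
          case True
          then have "nat (K' - (?I - a + int m)) + nat (L' - (?J - b)) < nat (K' - i) + nat (L' - j)"
            using x by (cases "m = 0") (auto simp: star_box_def)
          then have "g (?I - a + int m) (?J - b) \<in> S" by (rule less)
          then show ?thesis by (simp add: t_def emul_in[OF S] fS)
        next
          case False
          then have "f a (b + int m) = (\<lambda>P Q. 0) \<or> g (?I - a + int m) (?J - b) = (\<lambda>P Q. 0)"
            using f(2)[of a "b + int m"] g(2)[of "?I - a + int m" "?J - b"] by force
          then show ?thesis by (auto simp: t_def emul_zero[OF S] subalgebra_zero[OF S])
        qed
      qed
      moreover have "emul k n (eone k n) (g i j) = g i j" by (intro ext emul_eone g(1))
      ultimately show ?thesis by (simp add: t_def f(3))
    qed
  qed
qed

section \<open>Matrix coefficients of Fock operators\<close>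

context fock
begin

definition coefs :: "fock_op \<Rightarrow> int \<Rightarrow> int \<Rightarrow> endo" where
  "coefs W i j = (\<lambda>P Q. if P \<in> idxs k n \<and> Q \<in> idxs k n then sc (app W (ket (st Q)) (st P)) i j else 0)"

lemma coefs_supported: "endo_supported k n (coefs W i j)"
  by (auto simp: endo_supported_def coefs_def)

definition coefs_bounded where
  "coefs_bounded W K L \<longleftrightarrow> (\<forall>i j. i > K \<or> j > L \<longrightarrow> coefs W i j = (\<lambda>P Q. 0))"

lemma coefs_X: "coefs (lmul (sX a) * W) i j = (\<lambda>P Q. coefs W (i - 1) j P Q - a * coefs W i j P Q)"
  by (auto simp: coefs_def sc_sX fun_eq_iff)

lemma coefs_Xi:
  "coefs (lmul (sXi a) * W) (i - 1) j = (\<lambda>P Q. coefs W i j P Q + a * coefs (lmul (sXi a) * W) i j P Q)"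
proof -
  have "lmul (sX a) * (lmul (sXi a) * W) = W"
    by (simp add: mult.assoc[symmetric] lmul_mult sX_inverse lmul_one)
  then show ?thesis using coefs_X[of a "lmul (sXi a) * W" i j] by (auto simp: fun_eq_iff)
qed

text \<open>Since 1/(x - a) starts with 1/x, the top power of x drops by one without changing its
  coefficient. This makes the leading coefficient of \<open>Xi_all * row_det n M\<close> the
  identity.\<close>

lemma coefs_Xi_bounded:
  assumes b: "coefs_bounded W K L"
  shows "coefs_bounded (lmul (sXi a) * W) (K - 1) L"
    and "coefs (lmul (sXi a) * W) (K - 1) j = coefs W K j"
proof -
  let ?V = "lmul (sXi a) * W"
  have zero: "coefs ?V i j P Q = 0" if ij: "i > K - 1 \<or> j > L" for i j P Q
  proof -
    \<comment> \<open>This bound depends on \<open>P\<close> and \<open>Q\<close>; it only starts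
      the recursion, and the bound obtained from it is uniform.\<close>
    obtain K1 where K1: "\<And>i j. i > K1 \<Longrightarrow> coefs ?V i j P Q = 0"
      using symbol_outer_bound[of "app ?V (ket (st Q)) (st P)"] unfolding coefs_def by (metis (full_types))
    have "(i > K - 1 \<or> j > L) \<longrightarrow> coefs ?V i j P Q = 0"
    proof (rule int_downward_induct[of K1 "\<lambda>i. (i > K - 1 \<or> j > L) \<longrightarrow> coefs ?V i j P Q = 0"])
      fix i assume "i > K1"
      then show "(i > K - 1 \<or> j > L) \<longrightarrow> coefs ?V i j P Q = 0" using K1 by simp
    next
      fix i assume "(i + 1 > K - 1 \<or> j > L) \<longrightarrow> coefs ?V (i + 1) j P Q = 0"
      then show "(i > K - 1 \<or> j > L) \<longrightarrow> coefs ?V i j P Q = 0"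
        using coefs_Xi[of a W "i + 1" j] b by (auto simp: coefs_bounded_def fun_eq_iff)
    qed
    then show ?thesis using ij by blast
  qed
  then show "coefs_bounded ?V (K - 1) L" by (simp add: coefs_bounded_def fun_eq_iff)
  show "coefs ?V (K - 1) j = coefs W K j" using coefs_Xi[of a W K j] zero[of K j] by (simp add: fun_eq_iff)
qed

lemma coefs_Xi_in:
  assumes S: "subalgebra k n S" and b: "coefs_bounded W K L" and W: "\<And>i j. coefs W i j \<in> S"
  shows "coefs (lmul (sXi a) * W) i j \<in> S"
proof (rule int_downward_induct[of "K - 1" "\<lambda>i. coefs (lmul (sXi a) * W) i j \<in> S"])
  fix i assume "i > K - 1"
  then have "coefs (lmul (sXi a) * W) i j = (\<lambda>P Q. 0)"
    using coefs_Xi_bounded(1)[OF b] by (simp add: coefs_bounded_def)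
  then show "coefs (lmul (sXi a) * W) i j \<in> S" by (simp add: subalgebra_zero[OF S])
next
  fix i assume "coefs (lmul (sXi a) * W) (i + 1) j \<in> S"
  then show "coefs (lmul (sXi a) * W) i j \<in> S"
    using coefs_Xi[of a W "i + 1" j] subalgebra_lincomb[OF S W[of "i + 1" j], of "coefs (lmul (sXi a) * W) (i + 1) j" 1 a]
    by simp
qed

lemma coefs_X_in:
  assumes S: "subalgebra k n S" and W: "\<And>i j. coefs W i j \<in> S"
  shows "coefs (lmul (sX a) * W) i j \<in> S"
  using subalgebra_lincomb[OF S W[of "i - 1" j] W[of i j], of 1 "- a"] by (simp add: coefs_X)

lemma coefs_Xi_list:
  assumes "coefs_bounded W K L"
  shows "coefs_bounded (prod_list (map (\<lambda>a. lmul (sXi (z a))) l) * W) (K - int (length l)) L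
    \<and> coefs (prod_list (map (\<lambda>a. lmul (sXi (z a))) l) * W) (K - int (length l)) j = coefs W K j"
proof (induction l)
  case Nil
  then show ?case using assms by simp
next
  case (Cons a l)
  let ?V = "prod_list (map (\<lambda>a. lmul (sXi (z a))) l) * W"
  have e: "K - int (length (a # l)) = K - int (length l) - 1" by simp
  have e': "prod_list (map (\<lambda>a. lmul (sXi (z a))) (a # l)) * W = lmul (sXi (z a)) * ?V" by (simp add: mult.assoc)
  show ?case unfolding e e' using coefs_Xi_bounded[of ?V "K - int (length l)" L "z a"] Cons by simp
qed

lemma coefs_Xi_list_in:
  assumes S: "subalgebra k n S" and b: "coefs_bounded W K L" and W: "\<And>i j. coefs W i j \<in> S"
  shows "coefs (prod_list (map (\<lambda>a. lmul (sXi (z a))) l) * W) i j \<in> S"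
proof (induction l arbitrary: i j)
  case (Cons a l)
  then show ?case using coefs_Xi_in[OF S conjunct1[OF coefs_Xi_list[OF b, of l]]] by (simp add: mult.assoc)
qed (simp add: W)

lemma coefs_X_list_in:
  assumes S: "subalgebra k n S" and W: "\<And>i j. coefs W i j \<in> S"
  shows "coefs (prod_list (map (\<lambda>a. lmul (sX (z a))) l) * W) i j \<in> S"
proof (induction l arbitrary: i j)
  case (Cons a l)
  then show ?case using coefs_X_in[OF S, of "prod_list (map (\<lambda>a. lmul (sX (z a))) l) * W"] by (simp add: mult.assoc)
qed (simp add: W)

abbreviation op_n where "op_n \<equiv> univ_op k n n \<alpha> (pi_n k n z)"
abbreviation op_k where "op_k \<equiv> univ_op k n k z (pi_k k n \<alpha>)"

lemma pi_n_form: "pi_n k n z j i s = esum {1..k} (\<lambda>a. escale (z a ^ s) (xi_d k n (a, j) (a, i)))"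
  and pi_k_form: "pi_k k n \<alpha> j i s = esum {1..n} (\<lambda>a. escale ((- \<alpha> a) ^ s) (xi_d k n (j, a) (i, a)))"
  by (simp_all add: pi_n_def pi_k_def)

lemma op_n_structure:
  "endo_supported k n (op_n p r)" "p > n \<Longrightarrow> op_n p r = ezero"
  "op_n n r = (if r = 0 then eone k n else ezero)" "\<exists>c. op_n p 0 = escale c (eone k n)"
  using univ_op_structure[where A = "{1..k}" and g = "pi_n k n z" and w = z
      and E = "\<lambda>i j a. xi_d k n (a, j) (a, i)" and L = n and k = k and n = n and \<beta> = \<alpha>,
      OF finite_atLeastAtMost pi_n_form xi_d_supported] by auto

lemma op_k_structure:
  "endo_supported k n (op_k p r)" "p > k \<Longrightarrow> op_k p r = ezero"
  "op_k k r = (if r = 0 then eone k n else ezero)" "\<exists>c. op_k p 0 = escale c (eone k n)"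
  using univ_op_structure[where A = "{1..n}" and g = "pi_k k n \<alpha>" and w = "\<lambda>a. - \<alpha> a"
      and E = "\<lambda>i j a. xi_d k n (j, a) (i, a)" and L = k and k = k and n = n and \<beta> = z,
      OF finite_atLeastAtMost pi_k_form xi_d_supported] by auto

lemma coefs_M: "coefs (row_det n M) i j = (\<lambda>P Q. series_n (\<lambda>p q. op_n p q P Q) i j)"
proof (intro ext)
  fix P Q
  show "coefs (row_det n M) i j P Q = series_n (\<lambda>p q. op_n p q P Q) i j"
    using rep_row_det_M[of Q] op_n_structure(1) by (auto simp: coefs_def rep_def series_n_def endo_supported_def)
qed

lemma coefs_M_dual: "coefs (row_det k M_dual) i j = (\<lambda>P Q. series_k (\<lambda>p q. op_k p q P Q) i j)"
proof (intro ext)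
  fix P Q
  show "coefs (row_det k M_dual) i j P Q = series_k (\<lambda>p q. op_k p q P Q) i j"
    using rep_row_det_M_dual[of Q] op_k_structure(1)
    by (auto simp: coefs_def rep_def series_k_def endo_supported_def)
qed

end

context fock
begin

lemma app_lmul_list: "app (prod_list (map (\<lambda>i. lmul (r i)) l)) v s = prod_list (map r l) * v s"
  by (induction l arbitrary: v s) (simp_all add: mult.assoc)

lemma coefs_D_all: "coefs D_all i j = escale (sc (prod_list (map (\<lambda>i. sD (\<alpha> i)) [1..<n+1])) i j) (eone k n)"
proof (intro ext)
  fix P Q
  let ?d = "prod_list (map (\<lambda>i. sD (\<alpha> i)) [1..<n+1])"
  have "st P = st Q \<longleftrightarrow> P = Q" if "P \<in> idxs k n" "Q \<in> idxs k n"
    using inj_onD[OF base_state_inj] that by blast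
  then show "coefs D_all i j P Q = escale (sc ?d i j) (eone k n) P Q"
    unfolding coefs_def app_lmul_list by (auto simp: escale_def eone_def ket_def simp del: upt_Suc)
qed

text \<open>The vector \<open>app W (ket (st Q))\<close> lies in the span of the base states and is
  expanded there; \<open>sc_mult\<close> then applies to each summand.\<close>

lemma coefs_product:
  assumes W: "\<And>Q. Q \<in> idxs k n \<Longrightarrow> supported (app W (ket (st Q)))"
    and V: "\<And>Q. Q \<in> idxs k n \<Longrightarrow> app V (app W (ket (st Q))) = app Y (ket (st Q))"
    and b: "coefs_bounded V K L" "coefs_bounded W K' L'"
  shows "(\<lambda>P Q. \<Sum>(m, a, b)\<in>star_box K L K' L' I J.
      star_coeff m (I - a) b * emul k n (coefs V a (b + int m)) (coefs W (I - a + int m) (J - b)) P Q) = coefs Y I J"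
proof (intro ext)
  fix P Q
  show "(\<Sum>(m, a, b)\<in>star_box K L K' L' I J. star_coeff m (I - a) b *
      emul k n (coefs V a (b + int m)) (coefs W (I - a + int m) (J - b)) P Q) = coefs Y I J P Q"
  proof (cases "P \<in> idxs k n \<and> Q \<in> idxs k n")
    case False
    then show ?thesis by (auto simp: coefs_def emul_def intro!: sum.neutral)
  next
    case True
    then have PQ: "P \<in> idxs k n" "Q \<in> idxs k n" by auto
    let ?v = "\<lambda>R. app V (ket (st R)) (st P)" and ?w = "\<lambda>R. app W (ket (st Q)) (st R)"
    have v: "bounded_by (sc (?v R)) K L" if "R \<in> idxs k n" for R
      using b(1) that PQ unfolding coefs_bounded_def bounded_by_def coefs_def by (meson fun_cong)
    have w: "bounded_by (sc (?w R)) K' L'" if "R \<in> idxs k n" for R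
      using b(2) that PQ unfolding coefs_bounded_def bounded_by_def coefs_def by (meson fun_cong)
    have "coefs Y I J P Q = sc (app V (app W (ket (st Q))) (st P)) I J"
      using PQ by (simp add: coefs_def V)
    also have "app V (app W (ket (st Q))) (st P) = (\<Sum>R\<in>idxs k n. ?v R * ?w R)"
      by (rule ket_expand[OF finite_idxs base_state_inj]) (use W[OF PQ(2)] in \<open>auto simp: supported_def\<close>)
    also have "sc (\<Sum>R\<in>idxs k n. ?v R * ?w R) I J = (\<Sum>R\<in>idxs k n. \<Sum>(m, a, b)\<in>star_box K L K' L' I J.
       star_coeff m (I - a) b * (sc (?v R) a (b + int m) * sc (?w R) (I - a + int m) (J - b)))"
      unfolding sc_sum star_box_def
    proof (rule sum.cong[OF refl])
      fix R assume "R \<in> idxs k n"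
      from sc_mult[OF v[OF this] w[OF this], of I J]
      show "sc (?v R * ?w R) I J = (\<Sum>(m, a, b)\<in>{..nat (K + K' - I)} \<times> {I - K'..K} \<times> {J - L'..L}.
       star_coeff m (I - a) b * (sc (?v R) a (b + int m) * sc (?w R) (I - a + int m) (J - b)))"
        by (simp add: sum.cartesian_product mult.assoc case_prod_unfold)
    qed
    also have "\<dots> = (\<Sum>(m, a, b)\<in>star_box K L K' L' I J. star_coeff m (I - a) b *
      emul k n (coefs V a (b + int m)) (coefs W (I - a + int m) (J - b)) P Q)"
      by (subst sum.swap) (use PQ in \<open>simp add: emul_def coefs_def sum_distrib_left case_prod_unfold cong: sum.cong\<close>)
    finally show ?thesis by simp
  qed
qed

lemma supported_Xi_M: "Q \<in> idxs k n \<Longrightarrow> supported (app (Xi_all * row_det n M) (ket (st Q)))"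
  using rep_row_det_M[of Q] unfolding rep_def supported_def app_simps(6) app_lmul_list by (simp del: upt_Suc)

lemma op_n_coefs: "op_n p r = coefs (row_det n M) (- int r) (int p)"
  by (simp add: coefs_M series_n_def)

lemma series_k_head: "series_k h (int p) (- int r) = (-1) ^ r * (\<Sum>m\<le>r. of_nat ((r - 1) choose m) * pochhammer (of_nat p + 1) m * h (p + m) (r - m))"
  by (simp add: series_k_def)

text \<open>\<open>?V\<close> leads with x^k and \<open>?W\<close> with x^(-k) y^n, both with the
  identity as coefficient, while the product acts on base states as the scalar \<open>D_all\<close>.
  So \<open>triangular_solve\<close> obtains the coefficients of either from the other. Between
  \<open>?W\<close> and the gl(n) operator lie only the factors x - z_a, between \<open>?V\<close>
  and the gl(k) operator a triangular system.\<close>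

lemma op_in_iff:
  assumes S: "subalgebra k n S"
  shows "(\<forall>p r. op_n p r \<in> S) \<longleftrightarrow> (\<forall>p r. op_k p r \<in> S)"
proof -
  let ?V = "row_det k M_dual" and ?W = "Xi_all * row_det n M"
  have M0: "coefs_bounded (row_det n M) 0 (int n)"
    using op_n_structure(2) by (auto simp: coefs_bounded_def coefs_M series_n_def fun_eq_iff)
  have V: "coefs_bounded ?V (int k) 0"
    using op_k_structure(2) by (auto simp: coefs_bounded_def coefs_M_dual fun_eq_iff series_k_def intro!: sum.neutral)
  have Vk: "coefs ?V (int k) 0 = eone k n"
    using op_k_structure(3)[of 0] by (simp add: coefs_M_dual series_k_def)
  have W: "coefs_bounded ?W (- int k) (int n)" "coefs ?W (- int k) (int n) = eone k n"
    using coefs_Xi_list[OF M0, of "[1..<k+1]" "int n"] op_n_structure(3)[of 0]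
    by (simp_all add: coefs_M series_n_def del: upt_Suc)
  have D: "coefs D_all i j \<in> S" for i j
    unfolding coefs_D_all using S unfolding subalgebra_def by blast
  have VW: "app ?V (app ?W (ket (st Q))) = app D_all (ket (st Q))" if "Q \<in> idxs k n" for Q
    by (rule state_identity[OF idxs_finite[OF that]])
  have product: "(\<lambda>P Q. \<Sum>(m, a, b)\<in>star_box (int k) 0 (- int k) (int n) I J.
      star_coeff m (I - a) b * emul k n (coefs ?V a (b + int m)) (coefs ?W (I - a + int m) (J - b)) P Q) \<in> S"
    (is "?sum \<in> S") for I J
  proof -
    have "?sum = coefs D_all I J"
      by (rule coefs_product) (fact supported_Xi_M VW V W(1))+
    then show ?thesis using D[of I J] by (simp only:)
  qed
  have zero: "\<And>i j. i > int k \<or> j > 0 \<Longrightarrow> coefs ?V i j = (\<lambda>P Q. 0)"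
    "\<And>i j. i > - int k \<or> j > int n \<Longrightarrow> coefs ?W i j = (\<lambda>P Q. 0)"
    using V W(1) unfolding coefs_bounded_def by blast+
  have solve1: "coefs ?V i j \<in> S" if "\<And>i j. coefs ?W i j \<in> S" for i j
    by (rule triangular_solve(1)[where f = "coefs ?V" and g = "coefs ?W"]) (fact S coefs_supported zero Vk W(2) product that)+
  have solve2: "coefs ?W i j \<in> S" if "\<And>i j. coefs ?V i j \<in> S" for i j
    by (rule triangular_solve(2)[where f = "coefs ?V" and g = "coefs ?W"]) (fact S coefs_supported zero Vk W(2) product that)+
  show ?thesis
  proof
    assume n: "\<forall>p r. op_n p r \<in> S"
    then have "coefs (row_det n M) i j \<in> S" for i j
      by (cases "i \<le> 0 \<and> j \<ge> 0") (auto simp: coefs_M series_n_def subalgebra_zero[OF S])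
    then have "coefs ?W i j \<in> S" for i j by (rule coefs_Xi_list_in[OF S M0])
    then have V: "coefs ?V i j \<in> S" for i j by (rule solve1)
    \<comment> \<open>\<open>series_k\<close> mixes \<open>op_k p r\<close> only with
      \<open>op_k (p + m) (r - m)\<close>, that is, with smaller r; the term m = 0 has coefficient
      one once the sign (-1)^r is removed.\<close>
    have "\<forall>p. op_k p r \<in> S" for r
    proof (induction r rule: less_induct)
      case (less r)
      show ?case
      proof
        fix p
        let ?c = "\<lambda>m. of_nat ((r - 1) choose m) * pochhammer (of_nat p + 1) m :: complex"
        have "op_k (p + 0) (r - 0) \<in> S"
        proof (rule subalgebra_solve[OF S, of "{..r}" 0 ?c "\<lambda>m. op_k (p + m) (r - m)"])
          have "coefs ?V (int p) (- int r) = (\<lambda>P Q. (-1) ^ r * (\<Sum>m\<le>r. ?c m * op_k (p + m) (r - m) P Q))"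
            unfolding coefs_M_dual series_k_head ..
          then have "(\<lambda>P Q. \<Sum>m\<le>r. ?c m * op_k (p + m) (r - m) P Q) = (\<lambda>P Q. (-1) ^ r * coefs ?V (int p) (- int r) P Q + 0 * coefs ?V 0 0 P Q)"
            by (simp add: fun_eq_iff)
          then show "(\<lambda>P Q. \<Sum>m\<le>r. ?c m * op_k (p + m) (r - m) P Q) \<in> S"
            by (simp only:) (rule subalgebra_lincomb[OF S V V])
        qed (use less in auto)
        then show "op_k p r \<in> S" by simp
      qed
    qed
    then show "\<forall>p r. op_k p r \<in> S" by blast
  next
    assume k: "\<forall>p r. op_k p r \<in> S"
    have V: "coefs ?V i j \<in> S" for i j
    proof (cases "i \<ge> 0 \<and> j \<le> 0")
      case True
      have "coefs ?V i j = (\<lambda>P Q. \<Sum>m\<le>nat (- j). ((-1) ^ nat (- j) * (of_nat ((nat (- j) - 1) choose m) * pochhammer (of_int (i + 1)) m))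
          * op_k (nat i + m) (nat (- j) - m) P Q)"
        using True by (simp add: coefs_M_dual series_k_def sum_distrib_left mult.assoc)
      then show ?thesis using k by (simp only:) (rule subalgebra_sum[OF S], blast)
    qed (auto simp: coefs_M_dual series_k_def subalgebra_zero[OF S])
    have "coefs ?W i j \<in> S" for i j by (rule solve2) (rule V)
    then have "coefs (X_all * ?W) i j \<in> S" for i j by (rule coefs_X_list_in[OF S])
    moreover have "X_all * ?W = row_det n M" by (simp only: mult.assoc[symmetric] X_all_inverse mult_1_left)
    ultimately show "\<forall>p r. op_n p r \<in> S" unfolding op_n_coefs by simp
  qed
qed

end

text \<open>The generators omit the coefficients of x^0 and of the top power of d/dx, but these are
  scalars. So the image is the least subalgebra containing all coefficients, the form in which
  \<open>op_in_iff\<close> compares the two sides.\<close>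

lemma bethe_image_contains:
  assumes top: "\<And>q. univ_op k n L \<beta> g L q = (if q = 0 then eone k n else ezero)"
    and big: "\<And>p q. p > L \<Longrightarrow> univ_op k n L \<beta> g p q = ezero"
    and const: "\<And>p. \<exists>c. univ_op k n L \<beta> g p 0 = escale c (eone k n)"
  shows "univ_op k n L \<beta> g p q \<in> bethe_image k n L \<beta> g"
    and "subalgebra k n S \<Longrightarrow> (\<And>p q. univ_op k n L \<beta> g p q \<in> S) \<Longrightarrow> bethe_image k n L \<beta> g \<subseteq> S"
proof -
  let ?G = "{bethe_gen k n L \<beta> g i j | i j. 1 \<le> i \<and> i \<le> L \<and> 1 \<le> j}"
  have sub: "subalgebra k n (subalg k n ?G)" by (rule subalgebra_subalg)
  have zero: "ezero \<in> subalg k n ?G" using subalgebra_zero[OF sub] by (simp add: ezero_def)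
  show "univ_op k n L \<beta> g p q \<in> bethe_image k n L \<beta> g"
    unfolding bethe_image_def
  proof -
    consider "p > L" | "p = L" | "p < L" "q = 0" | "p < L" "q \<ge> 1" by linarith
    then show "univ_op k n L \<beta> g p q \<in> subalg k n ?G"
    proof cases
      case 1 then show ?thesis using big zero by simp
    next
      case 2 then show ?thesis using top zero subalg.one by simp
    next
      case 3 then show ?thesis using const[of p] subalg.scale[OF subalg.one] by auto
    next
      case 4
      then have "univ_op k n L \<beta> g p q = bethe_gen k n L \<beta> g (L - p) q" by (simp add: bethe_gen_def)
      then show ?thesis using 4 by (intro subalg.gen CollectI exI[of _ "L - p"] exI[of _ q]) simp
    qed
  qed
  show "bethe_image k n L \<beta> g \<subseteq> S" if "subalgebra k n S" "\<And>p q. univ_op k n L \<beta> g p q \<in> S"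
    unfolding bethe_image_def by (rule subalg_minimal[OF that(1)]) (use that(2) in \<open>auto simp: bethe_gen_def\<close>)
qed

theorem theorem5p2:
  fixes k n :: nat and z \<alpha> :: "nat \<Rightarrow> complex"
  assumes "k \<ge> 1" and "n \<ge> 1"
    and "inj_on z {1..k}" and "inj_on \<alpha> {1..n}"
  shows "bethe_image k n n \<alpha> (pi_n k n z) = bethe_image k n k z (pi_k k n \<alpha>)"
proof -
  interpret fock k n z \<alpha> .
  note gl_n = bethe_image_contains[where L = n and \<beta> = \<alpha> and g = "pi_n k n z", OF op_n_structure(3) _ op_n_structure(4)]
  note gl_k = bethe_image_contains[where L = k and \<beta> = z and g = "pi_k k n \<alpha>", OF op_k_structure(3) _ op_k_structure(4)]
  have sub: "subalgebra k n (bethe_image k n L b g)" for L b g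
    unfolding bethe_image_def by (rule subalgebra_subalg)
  \<comment> \<open>Each inclusion takes the right-hand image as \<open>S\<close> in
    \<open>op_in_iff\<close>: it contains the coefficients of its own operator, hence those of the
    other one.\<close>
  show ?thesis
  proof
    show "bethe_image k n n \<alpha> (pi_n k n z) \<subseteq> bethe_image k n k z (pi_k k n \<alpha>)"
      using op_in_iff[OF sub] gl_k(1) op_k_structure(2) by (intro gl_n(2) sub op_n_structure(2)) blast+
    show "bethe_image k n k z (pi_k k n \<alpha>) \<subseteq> bethe_image k n n \<alpha> (pi_n k n z)"
      using op_in_iff[OF sub] gl_n(1) op_n_structure(2) by (intro gl_k(2) sub op_k_structure(2)) blast+
  qed
qed

end
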